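(* Let $\mathfrak g$ be of type $B_n^{(1)}$. (1) If $\Lambda=\Lambda_0$ or $\Lambda_1$, then $$\Sigma^\Lambda_\Lambda(q)=\frac12\left(\frac{1}{(q^{\frac12})_\infty\,(q)_\infty^{\,n-1}\,(q^2)_\infty}+\frac{(q^{\frac12})_\infty}{(q)_\infty^{\,n+2}}\right).$$ (2) If $\Lambda=\Lambda_n$, then $\displaystyle\Sigma^\Lambda_\Lambda(q)=\frac{(q^2)_\infty}{(q)_\infty^{\,n+2}}$.
   Context: **Type and weights.** $\mathfrak g$ of type $B_n^{(1)}$ ($n\ge3$), colors $0,\dots,n$, $\delta=\alpha_0+\alpha_1+2(\alpha_2+\cdots+\alpha_n)$, level 1 weights $\Lambda\in\{\Lambda_0,\Lambda_1,\Lambda_n\}$, $\ell=2n$. **Proper Young walls.** There are infinitely many columns, numbered $1,2,\dots$ from right to left. Each column is a stack of unit-height floors. A floor is a unit cube of the indicated color, or a split floor $\{0,1\}$ made of two half-thickness blocks of colors $0,1$ in two positions A and B, or a floor $[n]$ made of two half-height $n$-blocks one on top of the other. The floors from bottom to top are, repeated cyclically: $\{0,1\},2,\dots,n-1,[n],n-1,\dots,2$ if $\Lambda\in\{\Lambda_0,\Lambda_1\}$; $[n],n-1,\dots,2,\{0,1\},2,\dots,n-1$ if $\Lambda=\Lambda_n$. On a floor $\{0,1\}$ of column $k$, position A has color $1$ for $k$ odd and $0$ for $k$ even, except that for $\Lambda=\Lambda_1$ this is reversed; B has the other color. The ground state wall $Y_\Lambda$ consists, in every column, of the A-block of the bottom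 floor if $\Lambda\in\{\Lambda_0,\Lambda_1\}$, and of the lower half-height $n$-block of the bottom floor if $\Lambda=\Lambda_n$. A Young wall $Y=(y_k)_{k\ge1}$ is obtained by adding finitely many blocks, where a floor may be started only when the floor below it is completely filled, the two blocks of a split floor above the bottom may be added in either order, and there is no free space to the right of any block (if a place is occupied in column $k+1$, the same place is occupied in column $k$). $|y_k|$ is the number of added blocks in column $k$. A column is full if its top floor is completely filled, i.e. $n\nmid|y_k|$; $Y$ is proper if no two full columns have the same height. Put $r=0$ if $\Lambda\in\{\Lambda_0,\Lambda_1\}$ and $r=n$ if $\Lambda=\Lambda_n$. Equivalently, a proper Young wall is a partition $(|y_k|)_k$ whose parts not divisible by $n$ are distinct, with a choice A or B for each positive part $\equiv r\pmod\ell$ (the position of the top half-thickness block), equal parts having equal choices. $\mathcal Z(\Lambda)$ is the set of proper Young walls, $\mathrm{wt}(Y)=\Lambda-\sum_ik_i\alpha_i$ with $k_i$ the number of added $i$-blocks, $\mathcal Z(\Lambda)_\lambda=\{Y:\mathrm{wt}(Y)=\lambda\}$. The string function (of the Fock space representation with crystal $\mathcal Z(\Lambda)$) is $\Sigma^\Lambda_\lambda(q)=\sum_{m\ge0}|\mathcal Z(\Lambda)_{\lambda-m\delta}|\,q^m$. $(q^a)_\infty=\prod_{m\ge1}(1-q^{am})$; the identity in (1) is one of formal power series in $q^{1/2}$. *)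

theory Defs
  imports
    "HOL-Computational_Algebra.Computational_Algebra"
    "HOL-Analysis.Infinite_Products"
begin

text \<open>
  The parameter \<open>n\<close> is the rank, the colors (vertices of the Dynkin diagram) are
  \<open>0, \<dots>, n\<close>. A weight is given by its pairings with the simple coroots
  \<open>h\<^sub>i\<close> (at \<open>Some i\<close>) and with the scaling element \<open>d\<close> (at \<open>None\<close>), where
  \<open>d\<close> takes the value \<open>1\<close> on \<open>\<alpha>\<^sub>0\<close> and \<open>0\<close> on the other simple roots and on all
  fundamental weights.
\<close>

type_synonym weight = "nat option \<Rightarrow> int"

text \<open>
  \<open>cartan n i j\<close> is the value of \<open>\<alpha>\<^sub>j\<close> on \<open>h\<^sub>i\<close>. The diagram is the chain
  \<open>1 - 2 - \<dots> - (n-1) \<Rightarrow> n\<close> with \<open>0\<close> attached to \<open>2\<close>; the root \<open>\<alpha>\<^sub>n\<close> is short.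
\<close>

definition cartan :: "nat \<Rightarrow> nat \<Rightarrow> nat \<Rightarrow> int" where
  "cartan n i j =
     (if i > n \<or> j > n then 0
      else if i = j then 2
      else if i = n \<and> j = n - 1 then -2
      else if {i, j} = {0, 2} then -1
      else if i \<ge> 1 \<and> j \<ge> 1 \<and> (i = Suc j \<or> j = Suc i) then -1
      else 0)"

definition simple_root :: "nat \<Rightarrow> nat \<Rightarrow> weight" where
  "simple_root n j =
     (\<lambda>x. case x of Some i \<Rightarrow> cartan n i j | None \<Rightarrow> (if j = 0 then 1 else 0))"

definition fundamental_weight :: "nat \<Rightarrow> weight" where
  "fundamental_weight i = (\<lambda>x. if x = Some i then 1 else 0)"

definition null_root :: "nat \<Rightarrow> weight" where
  "null_root n =
     (\<lambda>x. simple_root n 0 x + simple_root n 1 x + 2 * (\<Sum>i = 2..n. simple_root n i x))"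

text \<open>
  The parameter \<open>t \<in> {0, 1, n}\<close> selects the weight \<open>\<Lambda> = \<Lambda>\<^sub>t\<close>.
  A place is a triple (column, floor, place within the floor); columns are numbered
  \<open>1, 2, \<dots>\<close> from right to left and floors \<open>0, 1, \<dots>\<close> from bottom to top. A wall is the set
  of its occupied places, including those of the ground state.
\<close>

datatype floor_kind = Cube nat | Split | Halves
datatype place = Whole | PosA | PosB | Lower | Upper

type_synonym block = "nat \<times> nat \<times> place"

definition floor_pattern :: "nat \<Rightarrow> nat \<Rightarrow> floor_kind list" where
  "floor_pattern n t =
     (if t = n
      then [Halves] @ map Cube (rev [2..<n]) @ [Split] @ map Cube [2..<n]
      else [Split] @ map Cube [2..<n] @ [Halves] @ map Cube (rev [2..<n]))"

definition floor_at :: "nat \<Rightarrow> nat \<Rightarrow> nat \<Rightarrow> floor_kind" where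
  "floor_at n t j = floor_pattern n t ! (j mod length (floor_pattern n t))"

fun places :: "floor_kind \<Rightarrow> place set" where
  "places (Cube i) = {Whole}"
| "places Split = {PosA, PosB}"
| "places Halves = {Lower, Upper}"

definition all_places :: "nat \<Rightarrow> nat \<Rightarrow> block set" where
  "all_places n t = {(k, j, p). k \<ge> 1 \<and> p \<in> places (floor_at n t j)}"

fun color :: "nat \<Rightarrow> nat \<Rightarrow> block \<Rightarrow> nat" where
  "color n t (k, j, p) =
     (case floor_at n t j of
        Cube i \<Rightarrow> i
      | Halves \<Rightarrow> n
      | Split \<Rightarrow>
          (let a = (if t = 1 then (if odd k then 0 else 1) else (if odd k then 1 else 0))
           in if p = PosA then a else 1 - a))"

definition ground_state :: "nat \<Rightarrow> nat \<Rightarrow> block set" where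
  "ground_state n t = {(k, j, p). k \<ge> 1 \<and> j = 0 \<and> p = (if t = n then Lower else PosA)}"

definition floor_filled :: "nat \<Rightarrow> nat \<Rightarrow> block set \<Rightarrow> nat \<Rightarrow> nat \<Rightarrow> bool" where
  "floor_filled n t Y k j \<longleftrightarrow> (\<forall>p \<in> places (floor_at n t j). (k, j, p) \<in> Y)"

text \<open>
  A static description of the walls that arise from the ground state by adding finitely many
  blocks. On a split floor no order is imposed between A and B. The condition relating
  neighbouring columns compares places, whose colors differ on split floors.
\<close>

definition young_wall :: "nat \<Rightarrow> nat \<Rightarrow> block set \<Rightarrow> bool" where
  "young_wall n t Y \<longleftrightarrow>
     Y \<subseteq> all_places n t \<and>
     ground_state n t \<subseteq> Y \<and>
     finite (Y - ground_state n t) \<and>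
     (\<forall>k j p. (k, Suc j, p) \<in> Y \<longrightarrow> floor_filled n t Y k j) \<and>
     (\<forall>k j. (k, j, Upper) \<in> Y \<longrightarrow> (k, j, Lower) \<in> Y) \<and>
     (\<forall>k\<ge>1. \<forall>j p. (Suc k, j, p) \<in> Y \<longrightarrow> (k, j, p) \<in> Y)"

text \<open>
  The number of occupied floors of a column. A top floor with only its lower half is counted
  as a whole one; this is harmless since heights are compared for full columns only.
\<close>

definition column_height :: "block set \<Rightarrow> nat \<Rightarrow> nat" where
  "column_height Y k = card {j. \<exists>p. (k, j, p) \<in> Y}"

definition full_column :: "nat \<Rightarrow> nat \<Rightarrow> block set \<Rightarrow> nat \<Rightarrow> bool" where
  "full_column n t Y k \<longleftrightarrow> floor_filled n t Y k (column_height Y k - 1)"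

definition proper_young_walls :: "nat \<Rightarrow> nat \<Rightarrow> block set set" where
  "proper_young_walls n t =
     {Y. young_wall n t Y \<and>
         (\<forall>k\<ge>1. \<forall>l\<ge>1. k \<noteq> l \<longrightarrow> full_column n t Y k \<longrightarrow> full_column n t Y l \<longrightarrow>
            column_height Y k \<noteq> column_height Y l)}"

definition added_blocks :: "nat \<Rightarrow> nat \<Rightarrow> block set \<Rightarrow> nat \<Rightarrow> nat" where
  "added_blocks n t Y i = card {b \<in> Y - ground_state n t. color n t b = i}"

definition wt :: "nat \<Rightarrow> nat \<Rightarrow> block set \<Rightarrow> weight" where
  "wt n t Y =
     (\<lambda>x. fundamental_weight t x - (\<Sum>i = 0..n. int (added_blocks n t Y i) * simple_root n i x))"

definition proper_young_walls_of_weight :: "nat \<Rightarrow> nat \<Rightarrow> weight \<Rightarrow> block set set" where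
  "proper_young_walls_of_weight n t \<mu> = {Y \<in> proper_young_walls n t. wt n t Y = \<mu>}"

text \<open>
  Weight spaces are finite, because a weight determines the number of added blocks;
  so the cardinalities below are genuine. The variable \<open>fps_X\<close> stands for $q$; an identity
  in $q^{1/2}$ is stated with \<open>fps_X\<close> for $q^{1/2}$, after composing the string function
  with \<open>fps_X ^ 2\<close>.
\<close>

definition string_function :: "nat \<Rightarrow> nat \<Rightarrow> weight \<Rightarrow> rat fps" where
  "string_function n t \<mu> =
     Abs_fps (\<lambda>m. of_nat (card
       (proper_young_walls_of_weight n t (\<lambda>x. \<mu> x - int m * null_root n x))))"

text \<open>
  \<open>euler_prod Q\<close> is $(Q)_\infty = \prod_{m \ge 1} (1 - Q^m)$, the infinite product being
  taken in the topology of formal power series; $(q^a)_\infty$ is \<open>euler_prod (q ^ a)\<close>.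
\<close>

definition euler_prod :: "rat fps \<Rightarrow> rat fps" where
  "euler_prod Q = (\<Prod>m. 1 - Q ^ Suc m)"

end

theory Submission
  imports Defs "HOL-Library.FuncSet"
begin

text \<open>
  The theorem is proved by counting walls, in three steps.

  A proper wall is determined by the multiplicities of its column sizes, together with a choice of A
  or B for each size that ends in one block of a split floor. This choice is recorded as a sign of
  the multiplicity. The bijection \<open>bij_betw_wall_of\<close> uses as sign not the place of the
  top block but its color in the first column of the group of equal columns. The colors of a place
  alternate from column to column, so that within a group the top blocks cancel in pairs, and the
  group contributes to the difference of the numbers of 1-blocks and 0-blocks, up to a sign common
  to the whole wall, the sign of its multiplicity if this is odd, and nothing if it is even
  (\<open>added_color_difference\<close>).

  If the colors 0 and 1 are merged, then a column of size $nb$ contains \<open>b\<close> blocks of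
  each color, and a column of size $n(2a+1) \mp j$ with $1 \le j < n$ contains $2a+1$ blocks of each
  color except that in some colors, namely beyond a threshold depending on \<open>j\<close>, there
  is one block less or one block more, respectively. Therefore a wall has weight $\Lambda - m\delta$
  if and only if (\<open>wt_wall_of_iff_decode\<close>) for each \<open>j\<close> there are as many
  columns of sizes $n(2a+1) - j$ as of sizes $n(2a+1) + j$, the numbers \<open>b\<close> and $2a+1$
  add up to $2m$, and the charges of the signed multiplicities add up to 0 if $\Lambda = \Lambda_n$,
  and to 0 or 1 if $\Lambda$ is $\Lambda_0$ or $\Lambda_1$. These conditions do not involve the
  order of the columns, so the generating function in $y = q^{1/2}$ is a product of those of
  independent words: one free word, one word of signed multiplicities, and $n - 1$ pairs of finite
  sets of the same cardinality.

  With a variable \<open>w\<close> for the charge, the last two kinds of words have generating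
  functions of the form $\prod_a (1 + w x_a)(1 + w^{-1} x_a)$, divided by $\prod_a (1 - x_a^2)$ in
  the signed case. The coefficients of the finite products are Gaussian binomial coefficients
  (\<open>gauss_binomial_recursion\<close>), and the central ones tend to $1/(q)_\infty$. In the
  case $\Lambda_0$, $\Lambda_1$ the product $1/((q^{1/2})_\infty (q)_\infty^{n-1} (q^2)_\infty)$ so
  obtained also contains odd powers of $y$, which belong to no walls of weight $\Lambda - m\delta$.
  Passing to the even part gives the second summand of the theorem, by the substitution $y \mapsto
  -y$.
\<close>

section \<open>Partial Euler products\<close>

text \<open>
  A coefficient of a product involves only finitely many coefficients of the factors, and each of
  these is eventually constant.
\<close>

lemma tendsto_fps_mult:
  fixes f g :: "'b \<Rightarrow> 'a :: ring fps"
  assumes "(f \<longlongrightarrow> a) F" "(g \<longlongrightarrow> b) F"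
  shows "((\<lambda>x. f x * g x) \<longlongrightarrow> a * b) F"
proof (unfold tendsto_fps_iff, intro allI)
  fix k
  have "eventually (\<lambda>x. \<forall>i\<in>{..k}. fps_nth (f x) i = fps_nth a i) F"
    using assms(1) by (intro eventually_ball_finite) (auto simp: tendsto_fps_iff)
  moreover have "eventually (\<lambda>x. \<forall>i\<in>{..k}. fps_nth (g x) i = fps_nth b i) F"
    using assms(2) by (intro eventually_ball_finite) (auto simp: tendsto_fps_iff)
  ultimately show "eventually (\<lambda>x. fps_nth (f x * g x) k = fps_nth (a * b) k) F"
    by eventually_elim (simp add: fps_mult_nth)
qed

definition euler_partial :: "nat \<Rightarrow> nat \<Rightarrow> rat fps" where
  "euler_partial c N = (\<Prod>i<N. 1 - fps_X ^ (c * Suc i))"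

lemma euler_partial_Suc:
  "euler_partial c (Suc N) = euler_partial c N * (1 - fps_X ^ (c * Suc N))"
  by (simp add: euler_partial_def)

lemma euler_partial_stable:
  assumes "c > 0" "k \<le> N"
  shows "fps_nth (euler_partial c N) k = fps_nth (euler_partial c k) k"
  using assms(2)
proof (induction N rule: dec_induct)
  case (step N)
  have "k < c * Suc N"
    using step.hyps assms(1) by (metis le_imp_less_Suc less_le_trans mult.commute mult_le_mono2 nat_mult_1_right Suc_leI One_nat_def)
  then have "fps_nth (euler_partial c N * fps_X ^ (c * Suc N)) k = 0"
    by (simp only: fps_X_power_mult_right_nth) simp
  then show ?case
    using step.IH by (simp add: euler_partial_Suc right_diff_distrib)
qed simp

lemma euler_partial_nth_0: "c > 0 \<Longrightarrow> fps_nth (euler_partial c N) 0 = 1"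
  using euler_partial_stable[of c 0 N] by (simp add: euler_partial_def)

lemma euler_partial_tendsto:
  assumes "c > 0"
  shows "(euler_partial c) \<longlonglongrightarrow> euler_prod (fps_X ^ c)"
proof -
  \<comment> \<open>The coefficient of $X^k$ no longer changes from the $k$-th partial product on.\<close>
  define P where "P = Abs_fps (\<lambda>k. fps_nth (euler_partial c k) k)"
  have lim: "(euler_partial c) \<longlonglongrightarrow> P"
    unfolding tendsto_fps_iff
  proof (intro allI eventually_sequentiallyI)
    fix k N :: nat
    assume "k \<le> N"
    then show "fps_nth (euler_partial c N) k = fps_nth P k"
      unfolding P_def fps_nth_Abs_fps by (rule euler_partial_stable[OF assms])
  qed
  have "fps_nth P 0 = 1"
    using assms by (simp add: P_def euler_partial_nth_0)
  then have "P \<noteq> 0" by auto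
  have "(\<lambda>N. euler_partial c (Suc N)) \<longlonglongrightarrow> P"
    using lim by (rule LIMSEQ_Suc)
  then have "raw_has_prod (\<lambda>m. 1 - (fps_X ^ c) ^ Suc m) 0 P"
    using \<open>P \<noteq> 0\<close> unfolding raw_has_prod_def euler_partial_def lessThan_Suc_atMost
    by (simp only: power_mult add_0_right simp_thms)
  then have "(\<lambda>m. 1 - (fps_X ^ c) ^ Suc m) has_prod P"
    by (simp add: has_prod_def)
  then have "P = euler_prod (fps_X ^ c)"
    unfolding euler_prod_def by (rule has_prod_unique)
  with lim show ?thesis by simp
qed

lemma euler_prod_nth_0:
  assumes "c > 0"
  shows "fps_nth (euler_prod (fps_X ^ c)) 0 = 1"
proof -
  have "eventually (\<lambda>N. fps_nth (euler_partial c N) 0 = fps_nth (euler_prod (fps_X ^ c)) 0) sequentially"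
    using euler_partial_tendsto[OF assms] by (simp add: tendsto_fps_iff)
  then show ?thesis
    using euler_partial_nth_0[OF assms] by (auto simp: eventually_sequentially)
qed

lemma euler_prod_nonzero: "c > 0 \<Longrightarrow> euler_prod (fps_X ^ c) \<noteq> 0"
  using euler_prod_nth_0[of c] by auto

text \<open>
  Sorting the factors by the parity of their index. In the limit this evaluates the products over
  odd exponents, which are not themselves Euler products.
\<close>

lemma euler_partial_even_odd:
  "euler_partial c (2 * N) = (\<Prod>a<N. 1 - fps_X ^ (c * (2 * a + 1))) * euler_partial (2 * c) N"
proof (induction N)
  case (Suc N)
  have "euler_partial c (2 * Suc N) = euler_partial c (Suc (Suc (2 * N)))"
    by (simp only: mult_Suc_right) simp
  also have "\<dots> = euler_partial c (2 * N) * (1 - fps_X ^ (c * Suc (2 * N))) * (1 - fps_X ^ (c * Suc (Suc (2 * N))))"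
    by (simp only: euler_partial_Suc)
  also have "c * Suc (Suc (2 * N)) = 2 * c * Suc N" by simp
  also have "Suc (2 * N) = 2 * N + 1" by simp
  finally have "euler_partial c (2 * Suc N) =
     (\<Prod>a<N. 1 - fps_X ^ (c * (2 * a + 1))) * euler_partial (2 * c) N
      * (1 - fps_X ^ (c * (2 * N + 1))) * (1 - fps_X ^ (2 * c * Suc N))"
    unfolding Suc.IH .
  then show ?case
    unfolding euler_partial_Suc prod.lessThan_Suc by (simp only: mult_ac)
qed (simp add: euler_partial_def)

section \<open>A finite Jacobi triple product\<close>

text \<open>
  Words are counted in powers of $y = q^{1/2}$, for which \<open>fps_X\<close> stands; hence the $q$-factorial has
  the factors $1 - y^{2i}$.
\<close>

definition qfac :: "nat \<Rightarrow> rat fps" where "qfac = euler_partial 2"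

text \<open>
  The reciprocal $q$-factorial, with $0$ at negative arguments. With this convention the closed form
  for Gaussian binomial coefficients and the recursion \<open>qinv_pred\<close> hold for all integers, so that
  no boundary cases occur below.
\<close>

definition qinv :: "int \<Rightarrow> rat fps" where
  "qinv m = (if m < 0 then 0 else inverse (qfac (nat m)))"

lemma qfac_nth_0: "fps_nth (qfac m) 0 = 1"
  by (simp add: qfac_def euler_partial_nth_0)

lemma qinv_pred: "qinv (m - 1) = (1 - fps_X ^ (2 * nat m)) * qinv m"
proof (cases "m \<le> 0")
  case False
  then obtain k where m: "m = int (Suc k)"
    by (metis not_le zero_less_imp_eq_int gr0_implies_Suc)
  have "inverse (qfac (Suc k)) * (1 - fps_X ^ (2 * Suc k)) = inverse (qfac k)"
  proof -
    have "qfac (Suc k) = qfac k * (1 - fps_X ^ (2 * Suc k))"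
      by (simp add: qfac_def euler_partial_Suc)
    moreover have "inverse (1 - fps_X ^ (2 * Suc k)) * (1 - fps_X ^ (2 * Suc k) :: rat fps) = 1"
      by (intro inverse_mult_eq_1) simp
    ultimately show ?thesis
      by (simp add: fps_inverse_mult mult.assoc del: power_Suc mult_Suc_right)
  qed
  then show ?thesis
    by (simp add: qinv_def m mult.commute nat_add_distrib del: mult_Suc_right)
qed (auto simp: qinv_def)

text \<open>
  The $q$-Pascal rule applied twice, cleared of denominators: \<open>a\<close> and \<open>b\<close> stand for
  $q^A$ and $q^B$, and \<open>u1\<close>, \<open>u2\<close>, \<open>v\<close> for $q^{A-1}$, $q^{B-1}$, $q^{A+B-1}$. If $A = 0$, then
  $q^{A-1}$ is not a power series, but its coefficient $1 - a$ vanishes; this is what the disjunctions say.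
\<close>

lemma binomial_step_identity:
  fixes a b u v q :: "'a :: idom"
  assumes "v * q = a * b" "u1 * q = a \<or> a = 1" "u2 * q = b \<or> b = 1" "q \<noteq> 0"
  shows "(1 + v) * ((1 - a) * (1 - b)) + b * ((1 - u1) * (1 - a)) + a * ((1 - u2) * (1 - b))
      = (1 - v) * (1 - a * b)"
proof -
  have *: "(1 - u1) * (1 - a) * q = (q - a) * (1 - a)" "(1 - u2) * (1 - b) * q = (q - b) * (1 - b)"
    using assms by (auto simp: algebra_simps)
  have "((1 + v) * ((1 - a) * (1 - b)) + b * ((1 - u1) * (1 - a)) + a * ((1 - u2) * (1 - b))) * q
     = (q + v * q) * ((1 - a) * (1 - b)) + b * ((1 - u1) * (1 - a) * q) + a * ((1 - u2) * (1 - b) * q)"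
    by (simp add: algebra_simps)
  also have "\<dots> = (q - v * q) * (1 - a * b)"
    unfolding * assms(1) by (simp add: algebra_simps)
  also have "\<dots> = ((1 - v) * (1 - a * b)) * q"
    by (simp add: algebra_simps)
  finally show ?thesis using assms(4) by simp
qed

text \<open>
  A finite form of the Jacobi triple product. The recursion says that \<open>c N k\<close> is the coefficient of
  $w^k$ in $(1+w)^s \prod_{a<N} (1 + w x_a)(1 + w^{-1} x_a)$ with $x_a = y^{2a+1+s}$. Multiplied out
  by the $q$-binomial theorem, it is a power of $y$ times a Gaussian binomial coefficient
  ${2N+s \brack N+k}$. The shifted version $s = 1$ is needed because the product with $x_a = q^{a+1}$
  alone has one factor too few for such a closed form.
\<close>

lemma gauss_binomial_recursion:
  fixes c :: "nat \<Rightarrow> int \<Rightarrow> rat fps" and s :: nat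
  assumes s: "s \<le> 1"
    and c0: "\<And>k. c 0 k = (if k = 0 \<or> k = int s then 1 else 0)"
    and rec: "\<And>N k. c (Suc N) k = (1 + (fps_X ^ (2 * N + 1 + s))\<^sup>2) * c N k
                 + fps_X ^ (2 * N + 1 + s) * (c N (k - 1) + c N (k + 1))"
  shows "c N k = fps_X ^ nat (k * (k - int s)) * qfac (2 * N + s) *
                   (qinv (int N + k) * qinv (int N + int s - k))"
proof (induction N arbitrary: k)
  case 0
  show ?case
  proof (cases "k = 0 \<or> k = int s")
    case True
    have "qfac 0 = 1" by (simp add: qfac_def euler_partial_def)
    moreover have "qfac s * inverse (qfac s) = 1"
      by (intro inverse_mult_eq_1') (simp add: qfac_nth_0)
    ultimately show ?thesis
      using True by (auto simp: c0 qinv_def)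
  next
    case False
    then have "k < 0 \<or> int s - k < 0" using s by linarith
    then show ?thesis
      using False by (auto simp: c0 qinv_def)
  qed
next
  case (Suc N)
  define A where "A = int (Suc N) + k"
  define B where "B = int (Suc N) + int s - k"
  define M where "M = 2 * N + s"
  define x :: "rat fps" where "x = fps_X ^ (2 * N + 1 + s)"
  define y :: "rat fps" where "y = fps_X ^ nat (k * (k - int s))"
  define U where "U = qinv A"
  define V where "V = qinv B"
  define a :: "rat fps" where "a = fps_X ^ (2 * nat A)"
  define b :: "rat fps" where "b = fps_X ^ (2 * nat B)"
  define a' :: "rat fps" where "a' = fps_X ^ (2 * nat (A - 1))"
  define b' :: "rat fps" where "b' = fps_X ^ (2 * nat (B - 1))"
  have A1: "qinv (A - 1) = (1 - a) * U" "qinv (B - 1) = (1 - b) * V"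
    unfolding a_def b_def U_def V_def by (rule qinv_pred)+
  have A2: "qinv (A - 2) = (1 - a') * ((1 - a) * U)" "qinv (B - 2) = (1 - b') * ((1 - b) * V)"
    using qinv_pred[of "A - 1"] qinv_pred[of "B - 1"] A1 by (simp_all add: a'_def b'_def)
  have mid: "c N k = y * qfac M * ((1 - a) * U * ((1 - b) * V))"
    unfolding Suc.IH y_def M_def A1[symmetric] by (simp add: A_def B_def algebra_simps)
  \<comment> \<open>A product of consecutive integers, or a square.\<close>
  have nonneg: "0 \<le> l * (l - int s)" for l
    using s by (cases "l \<le> 0") (auto intro: mult_nonpos_nonpos)
  have lo: "x * c N (k - 1) = y * qfac M * (b * ((1 - a') * ((1 - a) * U) * V))"
  proof (cases "B < 0")
    case True
    then have "V = 0" by (simp add: V_def qinv_def)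
    moreover have "int N + int s - (k - 1) < 0" using True by (simp add: B_def)
    ultimately show ?thesis by (simp add: Suc.IH qinv_def)
  next
    case False
    have "(2 * N + 1 + s) + nat ((k - 1) * (k - 1 - int s)) = nat (k * (k - int s)) + 2 * nat B"
    proof -
      have "int ((2 * N + 1 + s) + nat ((k - 1) * (k - 1 - int s))) = int (nat (k * (k - int s)) + 2 * nat B)"
        using False nonneg[of "k - 1"] nonneg[of k] by (simp add: B_def algebra_simps)
      then show ?thesis by (simp only: of_nat_eq_iff)
    qed
    then have "x * fps_X ^ nat ((k - 1) * (k - 1 - int s)) = y * b"
      unfolding x_def y_def b_def by (metis power_add)
    moreover have "int N + (k - 1) = A - 2" "int N + int s - (k - 1) = B"
      by (simp_all add: A_def B_def)
    ultimately show ?thesis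
      unfolding Suc.IH M_def[symmetric] by (simp only: A2 V_def[symmetric] mult.assoc[symmetric])
        (simp only: mult_ac)
  qed
  have hi: "x * c N (k + 1) = y * qfac M * (a * ((1 - b') * ((1 - b) * V) * U))"
  proof (cases "A < 0")
    case True
    then have "U = 0" by (simp add: U_def qinv_def)
    moreover have "int N + (k + 1) < 0" using True by (simp add: A_def)
    ultimately show ?thesis by (simp add: Suc.IH qinv_def)
  next
    case False
    have "(2 * N + 1 + s) + nat ((k + 1) * (k + 1 - int s)) = nat (k * (k - int s)) + 2 * nat A"
    proof -
      have "int ((2 * N + 1 + s) + nat ((k + 1) * (k + 1 - int s))) = int (nat (k * (k - int s)) + 2 * nat A)"
        using False nonneg[of "k + 1"] nonneg[of k] by (simp add: A_def algebra_simps)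
      then show ?thesis by (simp only: of_nat_eq_iff)
    qed
    then have "x * fps_X ^ nat ((k + 1) * (k + 1 - int s)) = y * a"
      unfolding x_def y_def a_def by (metis power_add)
    moreover have "int N + (k + 1) = A" "int N + int s - (k + 1) = B - 2"
      by (simp_all add: A_def B_def)
    ultimately show ?thesis
      unfolding Suc.IH M_def[symmetric] by (simp only: A2 U_def[symmetric] mult.assoc[symmetric])
        (simp only: mult_ac)
  qed
  have "c (Suc N) k = y * qfac M * (((1 + x\<^sup>2) * ((1 - a) * (1 - b)) + b * ((1 - a') * (1 - a))
          + a * ((1 - b') * (1 - b))) * (U * V))"
    unfolding rec x_def[symmetric] distrib_left lo hi mid by (simp add: algebra_simps)
  also have "\<dots> = y * qfac M * (((1 - x\<^sup>2) * (1 - fps_X ^ (2 * (M + 2)))) * (U * V))"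
  proof (cases "A < 0 \<or> B < 0")
    case True
    then show ?thesis by (auto simp: U_def V_def qinv_def)
  next
    case False
    have ab: "a * b = fps_X ^ (2 * (M + 2))"
    proof -
      have "nat A + nat B = M + 2" using False by (simp add: A_def B_def M_def nat_add_distrib[symmetric])
      then show ?thesis by (simp add: a_def b_def power_add[symmetric] distrib_left[symmetric] del: distrib_left_numeral)
    qed
    have "x\<^sup>2 * fps_X ^ 2 = a * b"
      by (simp add: ab x_def M_def power_add[symmetric] power_mult[symmetric] algebra_simps)
    moreover have "a' * fps_X ^ 2 = a \<or> a = 1"
    proof (cases "A = 0")
      case False
      then have "nat A = Suc (nat (A - 1))" using \<open>\<not> (A < 0 \<or> B < 0)\<close> by linarith
      then show ?thesis by (simp add: a_def a'_def power2_eq_square)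
    qed (simp add: a_def)
    moreover have "b' * fps_X ^ 2 = b \<or> b = 1"
    proof (cases "B = 0")
      case False
      then have "nat B = Suc (nat (B - 1))" using \<open>\<not> (A < 0 \<or> B < 0)\<close> by linarith
      then show ?thesis by (simp add: b_def b'_def power2_eq_square)
    qed (simp add: b_def)
    ultimately have "(1 + x\<^sup>2) * ((1 - a) * (1 - b)) + b * ((1 - a') * (1 - a)) + a * ((1 - b') * (1 - b))
      = (1 - x\<^sup>2) * (1 - a * b)"
      by (intro binomial_step_identity[where q = "fps_X ^ 2"]) auto
    then show ?thesis by (simp only: ab)
  qed
  also have "\<dots> = y * qfac (2 * Suc N + s) * (U * V)"
  proof -
    have "x\<^sup>2 = fps_X ^ (2 * Suc M)" by (simp only: x_def M_def power_mult[symmetric]) (simp add: algebra_simps)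
    then have "qfac (2 * Suc N + s) = qfac M * (1 - x\<^sup>2) * (1 - fps_X ^ (2 * (M + 2)))"
      by (simp add: M_def qfac_def euler_partial_Suc)
    then show ?thesis by (simp only: mult_ac)
  qed
  finally show ?case
    by (simp add: y_def U_def V_def A_def B_def)
qed

section \<open>Generating functions by size\<close>

text \<open>
  The generating function of \<open>A\<close> by the size \<open>s\<close>. It is meaningful only when every size is attained
  finitely often, which \<open>finite_levels\<close> expresses.
\<close>

definition gf :: "'a set \<Rightarrow> ('a \<Rightarrow> nat) \<Rightarrow> rat fps" where
  "gf A s = Abs_fps (\<lambda>k. of_nat (card {a \<in> A. s a = k}))"

definition finite_levels :: "'a set \<Rightarrow> ('a \<Rightarrow> nat) \<Rightarrow> bool" where
  "finite_levels A s \<longleftrightarrow> (\<forall>k. finite {a \<in> A. s a = k})"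

lemma gf_cong_bij:
  assumes "bij_betw h A B" "\<And>a. a \<in> A \<Longrightarrow> s' (h a) = s a"
  shows "gf A s = gf B s'"
proof -
  have "card {a \<in> A. s a = k} = card {b \<in> B. s' b = k}" for k
  proof (rule bij_betw_same_card)
    show "bij_betw h {a \<in> A. s a = k} {b \<in> B. s' b = k}"
      using assms unfolding bij_betw_def by (auto simp: inj_on_def)
  qed
  then show ?thesis by (simp add: gf_def)
qed

lemma gf_cong:
  assumes "\<And>a. a \<in> A \<Longrightarrow> s' a = s a"
  shows "gf A s = gf A s'"
  by (rule gf_cong_bij[where h = "\<lambda>a. a"]) (simp_all add: assms bij_betw_def)

lemma finite_levels_cong_bij:
  assumes "bij_betw h A B" "\<And>a. a \<in> A \<Longrightarrow> s' (h a) = s a" "finite_levels B s'"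
  shows "finite_levels A s"
  unfolding finite_levels_def
proof
  fix k
  have "h ` {a \<in> A. s a = k} \<subseteq> {b \<in> B. s' b = k}" "inj_on h {a \<in> A. s a = k}"
    using assms unfolding bij_betw_def by (auto simp: inj_on_def)
  moreover have "finite {b \<in> B. s' b = k}"
    using assms(3) by (simp add: finite_levels_def)
  ultimately show "finite {a \<in> A. s a = k}"
    by (meson finite_imageD finite_subset)
qed

lemma finite_levels_finite: "finite A \<Longrightarrow> finite_levels A s"
  by (simp add: finite_levels_def)

lemma finite_levels_subset: "finite_levels A s \<Longrightarrow> B \<subseteq> A \<Longrightarrow> finite_levels B s"
  unfolding finite_levels_def
proof
  fix k
  assume *: "\<forall>k. finite {a \<in> A. s a = k}" "B \<subseteq> A"
  then have "{a \<in> B. s a = k} \<subseteq> {a \<in> A. s a = k}" by auto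
  then show "finite {a \<in> B. s a = k}" using *(1) by (meson finite_subset)
qed

lemma finite_levels_Times:
  assumes "finite_levels A s" "finite_levels B s'"
  shows "finite_levels (A \<times> B) (\<lambda>(a, b). s a + s' b)"
  unfolding finite_levels_def
proof
  fix k
  have "{x \<in> A \<times> B. (case x of (a, b) \<Rightarrow> s a + s' b) = k}
        = (\<Union>i\<in>{..k}. {a \<in> A. s a = i} \<times> {b \<in> B. s' b = k - i})"
    by auto
  then show "finite {x \<in> A \<times> B. (case x of (a, b) \<Rightarrow> s a + s' b) = k}"
    using assms by (simp add: finite_levels_def)
qed

lemma gf_Times:
  assumes "finite_levels A s" "finite_levels B s'"
  shows "gf (A \<times> B) (\<lambda>(a, b). s a + s' b) = gf A s * gf B s'"
proof (rule fps_ext)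
  fix k
  have "{x \<in> A \<times> B. (case x of (a, b) \<Rightarrow> s a + s' b) = k}
        = (\<Union>i\<in>{0..k}. {a \<in> A. s a = i} \<times> {b \<in> B. s' b = k - i})"
    by auto
  moreover have "card (\<Union>i\<in>{0..k}. {a \<in> A. s a = i} \<times> {b \<in> B. s' b = k - i})
      = (\<Sum>i=0..k. card ({a \<in> A. s a = i} \<times> {b \<in> B. s' b = k - i}))"
    using assms by (intro card_UN_disjoint) (auto simp: finite_levels_def)
  ultimately show "fps_nth (gf (A \<times> B) (\<lambda>(a, b). s a + s' b)) k = fps_nth (gf A s * gf B s') k"
    by (simp add: gf_def fps_mult_nth card_cartesian_product)
qed

lemma gf_UN_disjoint:
  assumes "finite I" "\<And>i. i \<in> I \<Longrightarrow> finite_levels (A i) s"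
    and "\<And>i j. i \<in> I \<Longrightarrow> j \<in> I \<Longrightarrow> i \<noteq> j \<Longrightarrow> A i \<inter> A j = {}"
  shows "gf (\<Union>i\<in>I. A i) s = (\<Sum>i\<in>I. gf (A i) s)"
proof (rule fps_ext)
  fix k
  have "{a \<in> (\<Union>i\<in>I. A i). s a = k} = (\<Union>i\<in>I. {a \<in> A i. s a = k})" by auto
  moreover have "card (\<Union>i\<in>I. {a \<in> A i. s a = k}) = (\<Sum>i\<in>I. card {a \<in> A i. s a = k})"
    using assms(1,2) assms(3)[THEN equalityD1]
    by (intro card_UN_disjoint) (auto simp: finite_levels_def, blast)
  ultimately show "fps_nth (gf (\<Union>i\<in>I. A i) s) k = fps_nth (\<Sum>i\<in>I. gf (A i) s) k"
    by (simp add: gf_def fps_sum_nth)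
qed

lemma gf_Un_disjoint:
  assumes "finite_levels A s" "finite_levels B s" "A \<inter> B = {}"
  shows "gf (A \<union> B) s = gf A s + gf B s"
proof (rule fps_ext)
  fix k
  have "{a \<in> A \<union> B. s a = k} = {a \<in> A. s a = k} \<union> {a \<in> B. s a = k}" by auto
  moreover have "card \<dots> = card {a \<in> A. s a = k} + card {a \<in> B. s a = k}"
    using assms by (intro card_Un_disjoint) (auto simp: finite_levels_def)
  ultimately show "fps_nth (gf (A \<union> B) s) k = fps_nth (gf A s + gf B s) k"
    by (simp add: gf_def)
qed

lemma gf_singleton: "gf {a} s = fps_X ^ s a"
proof (rule fps_ext)
  fix k
  have "{b \<in> {a}. s b = k} = (if s a = k then {a} else {})" by auto
  then show "fps_nth (gf {a} s) k = fps_nth (fps_X ^ s a) k"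
    by (simp add: gf_def)
qed

text \<open>
  Both statements are proved in one induction, because the product rule for two factors needs the
  finiteness of the levels.
\<close>

lemma gf_PiE:
  assumes "finite I" "\<And>i. i \<in> I \<Longrightarrow> finite_levels (A i) (s i)"
  shows "finite_levels (PiE I A) (\<lambda>f. \<Sum>i\<in>I. s i (f i))
       \<and> gf (PiE I A) (\<lambda>f. \<Sum>i\<in>I. s i (f i)) = (\<Prod>i\<in>I. gf (A i) (s i))"
  using assms
proof (induction I rule: finite_induct)
  case empty
  then show ?case by (simp add: finite_levels_finite gf_singleton)
next
  case (insert x I)
  define h where "h = (\<lambda>f :: 'a \<Rightarrow> 'b. (f x, restrict f I))"
  have bij: "bij_betw h (PiE (insert x I) A) (A x \<times> PiE I A)"
  proof (rule bij_betw_byWitness[where f' = "\<lambda>(a, f). f(x := a)"])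
    show "\<forall>f\<in>PiE (insert x I) A. (case h f of (a, g) \<Rightarrow> g(x := a)) = f"
      by (auto simp: h_def fun_eq_iff PiE_def extensional_def restrict_def)
    show "\<forall>y\<in>A x \<times> PiE I A. h (case y of (a, g) \<Rightarrow> g(x := a)) = y"
      using insert.hyps by (fastforce simp: h_def fun_eq_iff PiE_def extensional_def restrict_def)
    show "h ` PiE (insert x I) A \<subseteq> A x \<times> PiE I A"
      by (auto simp: h_def PiE_def Pi_def)
    show "(\<lambda>(a, f). f(x := a)) ` (A x \<times> PiE I A) \<subseteq> PiE (insert x I) A"
      using insert.hyps by (auto simp: PiE_def Pi_def extensional_def)
  qed
  have size: "(case h f of (a, g) \<Rightarrow> s x a + (\<Sum>i\<in>I. s i (g i))) = (\<Sum>i\<in>insert x I. s i (f i))" for f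
    using insert.hyps by (simp add: h_def)
  have IH: "finite_levels (PiE I A) (\<lambda>f. \<Sum>i\<in>I. s i (f i))"
     "gf (PiE I A) (\<lambda>f. \<Sum>i\<in>I. s i (f i)) = (\<Prod>i\<in>I. gf (A i) (s i))"
    using insert by auto
  have "finite_levels (A x) (s x)" using insert.prems by simp
  note prod = finite_levels_Times[OF this IH(1)] gf_Times[OF this IH(1)]
  show ?case
    using finite_levels_cong_bij[where s' = "\<lambda>(a, g). s x a + (\<Sum>i\<in>I. s i (g i))"
        and s = "\<lambda>f. \<Sum>i\<in>insert x I. s i (f i)", OF bij size prod(1)]
      gf_cong_bij[where s' = "\<lambda>(a, g). s x a + (\<Sum>i\<in>I. s i (g i))"
        and s = "\<lambda>f. \<Sum>i\<in>insert x I. s i (f i)", OF bij size] prod(2) insert.hyps IH(2)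
    by simp
qed

section \<open>Words of given charge\<close>

text \<open>
  Words over the alphabet \<open>D\<close>, infinite to the right, with blank letter \<open>d\<close> and prescribed total
  charge. In the next two definitions the letters are blank from position \<open>N\<close> on, respectively
  almost everywhere.
\<close>

definition words_below :: "'l set \<Rightarrow> 'l \<Rightarrow> ('l \<Rightarrow> int) \<Rightarrow> nat \<Rightarrow> int \<Rightarrow> (nat \<Rightarrow> 'l) set" where
  "words_below D d ch N k =
     {w. (\<forall>a. w a \<in> D) \<and> (\<forall>a\<ge>N. w a = d) \<and> (\<Sum>a<N. ch (w a)) = k}"

definition words :: "'l set \<Rightarrow> 'l \<Rightarrow> ('l \<Rightarrow> int) \<Rightarrow> int \<Rightarrow> (nat \<Rightarrow> 'l) set" where
  "words D d ch k =
     {w. (\<forall>a. w a \<in> D) \<and> finite {a. w a \<noteq> d} \<and> (\<Sum>a | w a \<noteq> d. ch (w a)) = k}"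

lemma finite_levels_words_below:
  assumes "\<And>a. finite_levels D (sz a)"
  shows "finite_levels (words_below D d ch N k) (\<lambda>w. \<Sum>a<N. sz a (w a))"
  unfolding finite_levels_def
proof
  fix m
  \<comment> \<open>The letters of size at most \<open>m\<close> at some position below \<open>N\<close>.\<close>
  define S where "S = (\<Union>a<N. \<Union>i\<le>m. {l \<in> D. sz a l = i})"
  have "finite S" unfolding S_def using assms by (auto simp: finite_levels_def)
  then have "finite {w. \<forall>a. (a \<in> {..<N} \<longrightarrow> w a \<in> S) \<and> (a \<notin> {..<N} \<longrightarrow> w a = d)}"
    by (intro finite_set_of_finite_funs) auto
  moreover have "{w \<in> words_below D d ch N k. (\<Sum>a<N. sz a (w a)) = m}
      \<subseteq> {w. \<forall>a. (a \<in> {..<N} \<longrightarrow> w a \<in> S) \<and> (a \<notin> {..<N} \<longrightarrow> w a = d)}"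
  proof (intro subsetI CollectI allI conjI impI)
    fix w a
    assume w: "w \<in> {w \<in> words_below D d ch N k. (\<Sum>a<N. sz a (w a)) = m}"
    then show "a \<notin> {..<N} \<Longrightarrow> w a = d" by (auto simp: words_below_def)
    assume "a \<in> {..<N}"
    then have "sz a (w a) \<le> m" using w member_le_sum[of a "{..<N}" "\<lambda>a. sz a (w a)"] by auto
    then show "w a \<in> S"
      using w \<open>a \<in> {..<N}\<close> by (force simp: S_def words_below_def)
  qed
  ultimately show "finite {w \<in> words_below D d ch N k. (\<Sum>a<N. sz a (w a)) = m}"
    by (rule finite_subset[rotated])
qed

text \<open>
  Splitting off the last letter, sorted by its charge.
\<close>

lemma gf_words_below_Suc:
  assumes D: "d \<in> D" "\<And>a. finite_levels D (sz a)" and E: "finite E" "ch ` D \<subseteq> E"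
  shows "gf (words_below D d ch (Suc N) k) (\<lambda>w. \<Sum>a<Suc N. sz a (w a))
       = (\<Sum>e\<in>E. gf {l \<in> D. ch l = e} (sz N) * gf (words_below D d ch N (k - e)) (\<lambda>w. \<Sum>a<N. sz a (w a)))"
proof -
  define W where "W e = {w \<in> words_below D d ch (Suc N) k. ch (w N) = e}" for e
  have split: "words_below D d ch (Suc N) k = (\<Union>e\<in>E. W e)"
    using E by (auto simp: W_def words_below_def)
  have "gf (words_below D d ch (Suc N) k) (\<lambda>w. \<Sum>a<Suc N. sz a (w a))
      = (\<Sum>e\<in>E. gf (W e) (\<lambda>w. \<Sum>a<Suc N. sz a (w a)))"
    unfolding split
  proof (rule gf_UN_disjoint[OF E(1)])
    show "finite_levels (W e) (\<lambda>w. \<Sum>a<Suc N. sz a (w a))" for e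
      by (rule finite_levels_subset[OF finite_levels_words_below[OF D(2)]]) (auto simp: W_def)
  qed (auto simp: W_def)
  also have "\<dots> = (\<Sum>e\<in>E. gf {l \<in> D. ch l = e} (sz N) * gf (words_below D d ch N (k - e)) (\<lambda>w. \<Sum>a<N. sz a (w a)))"
  proof (rule sum.cong[OF refl])
    fix e
    define h where "h = (\<lambda>w :: nat \<Rightarrow> 'a. (w N, w(N := d)))"
    have "bij_betw h (W e) ({l \<in> D. ch l = e} \<times> words_below D d ch N (k - e))"
    proof (rule bij_betw_byWitness[where f' = "\<lambda>(l, w). w(N := l)"])
      show "\<forall>w\<in>W e. (case h w of (l, w) \<Rightarrow> w(N := l)) = w"
        by (simp add: h_def)
      show "\<forall>y\<in>{l \<in> D. ch l = e} \<times> words_below D d ch N (k - e). h (case y of (l, w) \<Rightarrow> w(N := l)) = y"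
        by (auto simp: h_def words_below_def fun_eq_iff)
      show "h ` W e \<subseteq> {l \<in> D. ch l = e} \<times> words_below D d ch N (k - e)"
        using D(1) by (auto simp: h_def W_def words_below_def less_Suc_eq_le[symmetric] le_Suc_eq)
      show "(\<lambda>(l, w). w(N := l)) ` ({l \<in> D. ch l = e} \<times> words_below D d ch N (k - e)) \<subseteq> W e"
        by (auto simp: W_def words_below_def)
    qed
    then have "gf (W e) (\<lambda>w. \<Sum>a<Suc N. sz a (w a))
      = gf ({l \<in> D. ch l = e} \<times> words_below D d ch N (k - e)) (\<lambda>(l, w). sz N l + (\<Sum>a<N. sz a (w a)))"
      by (rule gf_cong_bij) (simp add: h_def)
    also have "\<dots> = gf {l \<in> D. ch l = e} (sz N) * gf (words_below D d ch N (k - e)) (\<lambda>w. \<Sum>a<N. sz a (w a))"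
      by (intro gf_Times finite_levels_words_below D(2) finite_levels_subset[OF D(2)]) auto
    finally show "gf (W e) (\<lambda>w. \<Sum>a<Suc N. sz a (w a)) = \<dots>" .
  qed
  finally show ?thesis .
qed

text \<open>
  A letter at position \<open>a\<close> has size more than \<open>a\<close>, so a word of size \<open>m\<close> is blank from position \<open>m\<close> on.
\<close>

lemma words_level_eq:
  assumes d: "\<And>a. sz a d = 0" "ch d = 0" and large: "\<And>a l. l \<in> D \<Longrightarrow> l \<noteq> d \<Longrightarrow> a < sz a l"
    and "m \<le> N"
  shows "{w \<in> words D d ch k. (\<Sum>a | w a \<noteq> d. sz a (w a)) = m}
       = {w \<in> words_below D d ch N k. (\<Sum>a<N. sz a (w a)) = m}"
proof -
  have sub: "{a. w a \<noteq> d} \<subseteq> {..<N}" if "\<forall>a\<ge>N. w a = d" for w :: "nat \<Rightarrow> 'a"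
  proof
    fix a assume "a \<in> {a. w a \<noteq> d}"
    then have "\<not> N \<le> a" using that by auto
    then show "a \<in> {..<N}" by simp
  qed
  have eq: "(\<Sum>a | w a \<noteq> d. f a (w a)) = (\<Sum>a<N. f a (w a))"
    if "\<forall>a\<ge>N. w a = d" "\<And>a. f a d = 0" for w and f :: "nat \<Rightarrow> 'a \<Rightarrow> 'b :: comm_monoid_add"
    using sub[OF that(1)] that(2) by (intro sum.mono_neutral_left) auto
  have fin: "finite {a. w a \<noteq> d}" if "\<forall>a\<ge>N. w a = d" for w :: "nat \<Rightarrow> 'a"
    using sub[OF that] by (rule finite_subset) simp
  have supp: "\<forall>a\<ge>N. w a = d"
    if "w \<in> words D d ch k" "(\<Sum>a | w a \<noteq> d. sz a (w a)) = m" for w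
  proof (intro allI impI)
    fix a assume "a \<ge> N"
    show "w a = d"
    proof (rule ccontr)
      assume "w a \<noteq> d"
      then have "sz a (w a) \<le> m"
        using that member_le_sum[of a "{a. w a \<noteq> d}" "\<lambda>a. sz a (w a)"] by (auto simp: words_def)
      moreover have "a < sz a (w a)" using that \<open>w a \<noteq> d\<close> by (intro large) (auto simp: words_def)
      ultimately show False using \<open>a \<ge> N\<close> \<open>m \<le> N\<close> by simp
    qed
  qed
  show ?thesis
  proof (intro set_eqI iffI)
    fix w assume "w \<in> {w \<in> words D d ch k. (\<Sum>a | w a \<noteq> d. sz a (w a)) = m}"
    then have w: "w \<in> words D d ch k" "(\<Sum>a | w a \<noteq> d. sz a (w a)) = m" by auto
    then show "w \<in> {w \<in> words_below D d ch N k. (\<Sum>a<N. sz a (w a)) = m}"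
      using supp[OF w] eq[of w sz] eq[of w "\<lambda>_. ch"] d by (auto simp: words_def words_below_def)
  next
    fix w assume w: "w \<in> {w \<in> words_below D d ch N k. (\<Sum>a<N. sz a (w a)) = m}"
    then have "\<forall>a\<ge>N. w a = d" by (auto simp: words_below_def)
    then show "w \<in> {w \<in> words D d ch k. (\<Sum>a | w a \<noteq> d. sz a (w a)) = m}"
      using w fin[of w] eq[of w sz] eq[of w "\<lambda>_. ch"] d by (auto simp: words_def words_below_def)
  qed
qed

lemma finite_levels_words:
  assumes "\<And>a. sz a d = 0" "ch d = 0" "\<And>a l. l \<in> D \<Longrightarrow> l \<noteq> d \<Longrightarrow> a < sz a l"
    and "\<And>a. finite_levels D (sz a)"
  shows "finite_levels (words D d ch k) (\<lambda>w. \<Sum>a | w a \<noteq> d. sz a (w a))"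
  unfolding finite_levels_def
proof
  fix m
  show "finite {w \<in> words D d ch k. (\<Sum>a | w a \<noteq> d. sz a (w a)) = m}"
    using finite_levels_words_below[where D = D and sz = sz and d = d and ch = ch and N = m and k = k, OF assms(4)]
      words_level_eq[where sz = sz and D = D and d = d and ch = ch and k = k and N = m and m = m, OF assms(1,2,3) order_refl]
    by (simp add: finite_levels_def)
qed

text \<open>
  This reduces the generating functions of words to the finite products for which closed forms exist.
\<close>

lemma gf_words_below_tendsto:
  assumes "\<And>a. sz a d = 0" "ch d = 0" "\<And>a l. l \<in> D \<Longrightarrow> l \<noteq> d \<Longrightarrow> a < sz a l"
  shows "(\<lambda>N. gf (words_below D d ch N k) (\<lambda>w. \<Sum>a<N. sz a (w a)))
           \<longlonglongrightarrow> gf (words D d ch k) (\<lambda>w. \<Sum>a | w a \<noteq> d. sz a (w a))"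
  unfolding tendsto_fps_iff
proof (intro allI eventually_sequentiallyI)
  fix m N :: nat
  assume "m \<le> N"
  show "fps_nth (gf (words_below D d ch N k) (\<lambda>w. \<Sum>a<N. sz a (w a))) m
      = fps_nth (gf (words D d ch k) (\<lambda>w. \<Sum>a | w a \<noteq> d. sz a (w a))) m"
    using words_level_eq[where sz = sz and D = D and d = d and ch = ch and k = k, OF assms \<open>m \<le> N\<close>]
    by (simp add: gf_def)
qed

text \<open>
  Sizes in an arithmetic progression: removing the first element is the same as increasing all
  sizes by \<open>c\<close>.
\<close>

lemma geometric_levels:
  fixes v :: "nat \<Rightarrow> 'a"
  assumes "inj v" "c > 0" "\<And>i. s (v i) = b + c * i"
  shows "finite_levels (range v) s" "gf (range v) s * (1 - fps_X ^ c) = fps_X ^ b"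
proof -
  have bij: "bij_betw v UNIV (range v)" using assms(1) by (simp add: bij_betw_def)
  have inj: "inj (\<lambda>i. b + c * i)" using assms(2) by (auto simp: inj_on_def)
  have lev: "finite_levels UNIV (\<lambda>i. b + c * i)"
    unfolding finite_levels_def
  proof
    fix k
    have "{i \<in> UNIV. b + c * i = k} \<subseteq> {..k}"
      using assms(2) by (auto intro!: trans_le_add2)
    then show "finite {i \<in> UNIV. b + c * i = k}" by (rule finite_subset) simp
  qed
  have "bij_betw (inv v) (range v) UNIV" using bij by (simp add: bij_betw_inv_into)
  then show "finite_levels (range v) s"
    by (rule finite_levels_cong_bij[OF _ _ lev]) (use assms in auto)
  have G: "gf (range v) s = gf UNIV (\<lambda>i. b + c * i)"
    by (rule gf_cong_bij[OF bij, symmetric]) (simp add: assms(3))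
  have "bij_betw Suc UNIV {1..}"
    by (rule bij_betw_byWitness[where f' = "\<lambda>i. i - 1"]) auto
  have "gf UNIV (\<lambda>i. b + c * i) = gf ({0} \<union> {1..}) (\<lambda>i. b + c * i)"
    by (rule arg_cong[where f = "\<lambda>A. gf A _"]) auto
  also have "\<dots> = gf {0} (\<lambda>i. b + c * i) + gf {1..} (\<lambda>i. b + c * i)"
    by (intro gf_Un_disjoint finite_levels_subset[OF lev]) auto
  also have "gf {1..} (\<lambda>i. b + c * i) = gf UNIV (\<lambda>i. b + c * Suc i)"
    by (rule gf_cong_bij[OF \<open>bij_betw Suc UNIV {1..}\<close>, symmetric]) simp
  also have "\<dots> = gf ({()} \<times> UNIV) (\<lambda>(_, i). c + (b + c * i))"
    by (rule gf_cong_bij[where h = "\<lambda>i. ((), i)"])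
       (auto intro!: bij_betw_byWitness[where f' = snd] simp: algebra_simps)
  also have "\<dots> = gf {()} (\<lambda>_. c) * gf UNIV (\<lambda>i. b + c * i)"
    by (intro gf_Times lev finite_levels_finite) simp
  finally show "gf (range v) s * (1 - fps_X ^ c) = fps_X ^ b"
    unfolding G gf_singleton by (simp add: algebra_simps)
qed

section \<open>Free, signed and balanced words\<close>

lemma euler_partial_shift_tendsto: "c > 0 \<Longrightarrow> (\<lambda>N. euler_partial c (N + b)) \<longlonglongrightarrow> euler_prod (fps_X ^ c)"
  by (rule LIMSEQ_ignore_initial_segment[OF euler_partial_tendsto])

lemma euler_partial_double_tendsto:
  assumes "c > 0"
  shows "(\<lambda>N. euler_partial c (2 * N + b)) \<longlonglongrightarrow> euler_prod (fps_X ^ c)"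
proof -
  have "strict_mono (\<lambda>N::nat. 2 * N + b)" by (auto simp: strict_mono_def)
  from LIMSEQ_subseq_LIMSEQ[OF euler_partial_tendsto[OF assms] this] show ?thesis
    by (simp add: o_def)
qed

lemma qfac_nonzero: "qfac m \<noteq> 0"
  using qfac_nth_0[of m] by auto

lemma qinv_of_nat: "qinv (int m) * qfac m = 1"
  unfolding qinv_def by (simp add: inverse_mult_eq_1 qfac_nth_0)

lemma gf_empty: "gf {} s = 0"
  by (simp add: gf_def fps_eq_iff)

lemma gf_words_below_0:
  assumes "d \<in> D"
  shows "gf (words_below D d ch 0 k) (\<lambda>w. \<Sum>a<0. sz a (w a)) = (if k = 0 then 1 else 0)"
proof -
  have "words_below D d ch 0 k = (if k = 0 then {\<lambda>_. d} else {})"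
    using assms by (auto simp: words_below_def)
  then show ?thesis by (simp add: gf_singleton gf_empty)
qed

text \<open>
  A balanced word of pairs is a pair of finite sets of the same cardinality. It will record the parts
  $n(2a+1) - j$ and $n(2a+1) + j$ of a wall for a fixed $j$.
\<close>

definition pair_letters :: "(int \<times> int) set" where
  "pair_letters = {0, 1} \<times> {0, 1}"

definition balance :: "int \<times> int \<Rightarrow> int" where
  "balance l = snd l - fst l"

definition pair_size :: "nat \<Rightarrow> int \<times> int \<Rightarrow> nat" where
  "pair_size a l = nat (fst l + snd l) * (2 * a + 1)"

definition balanced_pairs :: "(nat \<Rightarrow> int \<times> int) set" where
  "balanced_pairs = words pair_letters (0, 0) balance 0"

definition pairs_size :: "(nat \<Rightarrow> int \<times> int) \<Rightarrow> nat" where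
  "pairs_size w = (\<Sum>a | w a \<noteq> (0, 0). pair_size a (w a))"

lemma pair_letters_facts:
  "pair_size a (0, 0) = 0" "balance (0, 0) = 0"
  "l \<in> pair_letters \<Longrightarrow> l \<noteq> (0, 0) \<Longrightarrow> a < pair_size a l"
  "finite_levels pair_letters (pair_size a)"
  by (auto simp: pair_size_def balance_def pair_letters_def finite_levels_finite)

lemma finite_levels_balanced_pairs: "finite_levels balanced_pairs pairs_size"
  unfolding balanced_pairs_def pairs_size_def
  by (rule finite_levels_words) (use pair_letters_facts in auto)

text \<open>
  The letters contribute $1 + x(w + w^{-1}) + x^2 = (1 + wx)(1 + w^{-1}x)$ with $x = y^{2N+1}$, so the
  words of length $N$ are counted by the constant term ${2N \brack N}$, which tends to
  $1/(q)_\infty$.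
\<close>

lemma gf_balanced_pairs: "gf balanced_pairs pairs_size * euler_prod (fps_X ^ 2) = 1"
proof -
  define c where "c N k = gf (words_below pair_letters (0, 0) balance N k) (\<lambda>w. \<Sum>a<N. pair_size a (w a))"
    for N and k :: int
  have rec: "c (Suc N) k = (1 + (fps_X ^ (2 * N + 1 + 0))\<^sup>2) * c N k
                 + fps_X ^ (2 * N + 1 + 0) * (c N (k - 1) + c N (k + 1))" for N k
  proof -
    have sets: "{l \<in> pair_letters. balance l = 0} = {(0, 0)} \<union> {(1, 1)}"
      "{l \<in> pair_letters. balance l = 1} = {(0, 1)}"
      "{l \<in> pair_letters. balance l = - 1} = {(1, 0)}"
      by (auto simp: pair_letters_def balance_def)
    have "gf ({(0, 0)} \<union> {(1, 1)}) (pair_size N) = fps_X ^ pair_size N (0, 0) + fps_X ^ pair_size N (1, 1)"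
      by (subst gf_Un_disjoint) (simp_all only: finite_levels_finite finite.intros gf_singleton, simp)
    also have "\<dots> = 1 + (fps_X ^ (2 * N + 1))\<^sup>2"
      unfolding power_mult[symmetric] by (simp add: pair_size_def mult.commute)
    finally have letters:
      "gf {l \<in> pair_letters. balance l = 0} (pair_size N) = 1 + (fps_X ^ (2 * N + 1))\<^sup>2"
      "gf {l \<in> pair_letters. balance l = 1} (pair_size N) = fps_X ^ (2 * N + 1)"
      "gf {l \<in> pair_letters. balance l = - 1} (pair_size N) = fps_X ^ (2 * N + 1)"
      unfolding sets by (simp_all add: gf_singleton pair_size_def)
    have "c (Suc N) k = (\<Sum>e\<in>{-1, 0, 1}. gf {l \<in> pair_letters. balance l = e} (pair_size N) * c N (k - e))"
      unfolding c_def
      by (rule gf_words_below_Suc) (use pair_letters_facts in \<open>auto simp: pair_letters_def balance_def\<close>)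
    then show ?thesis
      unfolding letters[symmetric] by (simp add: letters algebra_simps)
  qed
  have c0: "c 0 k = (if k = 0 \<or> k = int 0 then 1 else 0)" for k
    unfolding c_def by (subst gf_words_below_0) (auto simp: pair_letters_def)
  have "c N 0 * qfac N * qfac N = qfac (2 * N)" for N
  proof -
    have "c N 0 = qfac (2 * N) * (qinv (int N) * qinv (int N))"
      by (subst gauss_binomial_recursion[of 0 c, OF _ c0 rec]) simp_all
    then have "c N 0 * qfac N * qfac N = qfac (2 * N) * (qinv (int N) * qfac N) * (qinv (int N) * qfac N)"
      by (simp only: mult_ac)
    then show ?thesis by (simp add: qinv_of_nat)
  qed
  moreover have "(\<lambda>N. c N 0) \<longlonglongrightarrow> gf balanced_pairs pairs_size"
    unfolding c_def balanced_pairs_def pairs_size_def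
    by (rule gf_words_below_tendsto) (use pair_letters_facts in auto)
  then have lim: "(\<lambda>N. c N 0 * qfac N * qfac N) \<longlonglongrightarrow>
     gf balanced_pairs pairs_size * euler_prod (fps_X ^ 2) * euler_prod (fps_X ^ 2)"
    unfolding qfac_def by (intro tendsto_fps_mult euler_partial_tendsto) simp_all
  moreover have "(\<lambda>N. qfac (2 * N)) \<longlonglongrightarrow> euler_prod (fps_X ^ 2)"
    using euler_partial_double_tendsto[of 2 0] by (simp add: qfac_def)
  ultimately have "(\<lambda>N. c N 0 * qfac N * qfac N) \<longlonglongrightarrow> euler_prod (fps_X ^ 2)" by simp
  from LIMSEQ_unique[OF lim this] have "gf balanced_pairs pairs_size * euler_prod (fps_X ^ 2) * euler_prod (fps_X ^ 2)
      = euler_prod (fps_X ^ 2)"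
    .
  then show ?thesis using euler_prod_nonzero[of 2] by simp
qed

text \<open>
  The parameter \<open>s\<close> is 1 if the split floors occur at even heights (in units of half a period), and 0
  if they occur at odd heights. Free words record the multiplicities of the parts whose top is the lower
  half-height \<open>n\<close>-block, and signed words those whose top is one block of a split floor.
\<close>

definition free_size :: "nat \<Rightarrow> (nat \<Rightarrow> int) \<Rightarrow> nat" where
  "free_size s w = (\<Sum>a | w a \<noteq> 0. nat (w a) * (2 * a + 2 - s))"

definition free_words :: "(nat \<Rightarrow> int) set" where
  "free_words = words {0..} 0 (\<lambda>_. 0) 0"

lemma nonneg_letters:
  assumes "c > 0"
  shows "finite_levels {0..} (\<lambda>l :: int. nat l * c)" "gf {0..} (\<lambda>l :: int. nat l * c) * (1 - fps_X ^ c) = 1"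
proof -
  have "{0..} = range int" by (metis UNIV_I atLeast_iff image_iff nonneg_int_cases of_nat_0_le_iff subsetI subset_antisym image_subsetI)
  then show "finite_levels {0..} (\<lambda>l :: int. nat l * c)" "gf {0..} (\<lambda>l :: int. nat l * c) * (1 - fps_X ^ c) = 1"
    using geometric_levels[of int c "\<lambda>l. nat l * c" 0] assms by (auto simp: mult.commute)
qed

text \<open>
  For \<open>s = 1\<close> the sizes are the odd numbers and the generating function is
  $\prod (1 - y^{2a+1})^{-1} = (y^2)_\infty / (y)_\infty$.
\<close>

lemma gf_free_words:
  assumes "s \<le> 1"
  shows "finite_levels free_words (free_size s)"
    "gf free_words (free_size s) * euler_prod (fps_X ^ (2 - s)) = (if s = 1 then euler_prod (fps_X ^ 2) else 1)"
proof -
  have large: "a < nat l * (2 * a + 2 - s)" if "l \<in> {0..}" "l \<noteq> (0 :: int)" for a l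
  proof -
    have "1 * (2 * a + 2 - s) \<le> nat l * (2 * a + 2 - s)" using that by (intro mult_right_mono) auto
    then show ?thesis using assms by linarith
  qed
  have lev: "finite_levels {0..} (\<lambda>l :: int. nat l * (2 * a + 2 - s))" for a
    using assms by (intro nonneg_letters) simp
  show "finite_levels free_words (free_size s)"
    unfolding free_words_def free_size_def
    by (rule finite_levels_words) (use large lev in auto)
  define c where "c N = gf (words_below {0..} 0 (\<lambda>_. 0) N 0) (\<lambda>w. \<Sum>a<N. nat (w a :: int) * (2 * a + 2 - s))" for N
  have rec: "c (Suc N) * (1 - fps_X ^ (2 * N + 2 - s)) = c N" for N
  proof -
    have "c (Suc N) = (\<Sum>e\<in>{0}. gf {l \<in> {0..}. (0 :: int) = e} (\<lambda>l :: int. nat l * (2 * N + 2 - s)) *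
       gf (words_below {0..} 0 (\<lambda>_. 0) N (0 - e)) (\<lambda>w. \<Sum>a<N. nat (w a :: int) * (2 * a + 2 - s)))"
      unfolding c_def by (rule gf_words_below_Suc) (use lev in auto)
    also have "\<dots> = gf {0..} (\<lambda>l :: int. nat l * (2 * N + 2 - s)) * c N"
      by (simp add: c_def atLeast_def)
    finally have "c (Suc N) * (1 - fps_X ^ (2 * N + 2 - s))
        = (gf {0..} (\<lambda>l :: int. nat l * (2 * N + 2 - s)) * (1 - fps_X ^ (2 * N + 2 - s))) * c N"
      by (simp only: mult_ac)
    then show ?thesis using assms by (subst (asm) nonneg_letters(2)) auto
  qed
  have prod: "c N * (\<Prod>a<N. 1 - fps_X ^ (2 * a + 2 - s)) = 1" for N
  proof (induction N)
    case 0
    show ?case unfolding c_def by (subst gf_words_below_0) auto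
  next
    case (Suc N)
    have "c (Suc N) * (\<Prod>a<Suc N. 1 - fps_X ^ (2 * a + 2 - s))
      = (c (Suc N) * (1 - fps_X ^ (2 * N + 2 - s))) * (\<Prod>a<N. 1 - fps_X ^ (2 * a + 2 - s))"
      by (simp only: prod.lessThan_Suc mult_ac)
    then show ?case unfolding rec Suc.IH .
  qed
  have lim: "c \<longlonglongrightarrow> gf free_words (free_size s)"
    unfolding c_def free_words_def free_size_def
    by (rule gf_words_below_tendsto) (use large in auto)
  show "gf free_words (free_size s) * euler_prod (fps_X ^ (2 - s)) = (if s = 1 then euler_prod (fps_X ^ 2) else 1)"
  proof (cases "s = 0")
    case True
    have "c N * euler_partial 2 N = 1" for N
      using prod[of N] True by (simp add: euler_partial_def)
    moreover have "(\<lambda>N. c N * euler_partial 2 N) \<longlonglongrightarrow> gf free_words (free_size s) * euler_prod (fps_X ^ 2)"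
      by (intro tendsto_fps_mult lim euler_partial_tendsto) simp
    ultimately have "gf free_words (free_size s) * euler_prod (fps_X ^ 2) = 1"
      by (simp add: LIMSEQ_const_iff)
    then show ?thesis using True by simp
  next
    case False
    then have s: "s = 1" using assms by simp
    have "c N * euler_partial 1 (2 * N) = euler_partial 2 N" for N
    proof -
      have "euler_partial 1 (2 * N) = (\<Prod>a<N. 1 - fps_X ^ (2 * a + 2 - s)) * euler_partial 2 N"
        using euler_partial_even_odd[of 1 N] by (simp add: s)
      then have "c N * euler_partial 1 (2 * N) = c N * (\<Prod>a<N. 1 - fps_X ^ (2 * a + 2 - s)) * euler_partial 2 N"
        by (simp only: mult_ac)
      then show ?thesis by (simp only: prod mult_1)
    qed
    moreover have "(\<lambda>N. c N * euler_partial 1 (2 * N + 0)) \<longlonglongrightarrow> gf free_words (free_size s) * euler_prod (fps_X ^ 1)"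
      by (intro tendsto_fps_mult lim euler_partial_double_tendsto) simp
    ultimately have "euler_partial 2 \<longlonglongrightarrow> gf free_words (free_size s) * euler_prod (fps_X ^ 1)"
      by simp
    from LIMSEQ_unique[OF this euler_partial_tendsto] show ?thesis
      using s by simp
  qed
qed

text \<open>
  The charge of a group of \<open>\<bar>v\<bar>\<close> equal columns ending in single blocks of a split floor: the colors
  of these blocks alternate between 0 and 1, so all but possibly one of them cancel.
\<close>

definition parity_sign :: "int \<Rightarrow> int" where
  "parity_sign v = (if odd v then sgn v else 0)"

definition signed_size :: "nat \<Rightarrow> (nat \<Rightarrow> int) \<Rightarrow> nat" where
  "signed_size s w = (\<Sum>a | w a \<noteq> 0. nat \<bar>w a\<bar> * (2 * a + 1 + s))"

definition signed_words :: "int \<Rightarrow> (nat \<Rightarrow> int) set" where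
  "signed_words k = words UNIV 0 parity_sign k"

text \<open>
  The even, the positive odd and the negative odd integers. Together they give
  $(1 + wx)(1 + w^{-1}x)/(1 - x^2)$ with $x = y^c$: the same numerator as for pairs.
\<close>

lemma signed_letters:
  assumes "c > 0"
  shows "finite_levels UNIV (\<lambda>l :: int. nat \<bar>l\<bar> * c)"
    "gf {l. parity_sign l = 0} (\<lambda>l. nat \<bar>l\<bar> * c) * (1 - fps_X ^ (2 * c)) = 1 + fps_X ^ (2 * c)"
    "gf {l. parity_sign l = 1} (\<lambda>l. nat \<bar>l\<bar> * c) * (1 - fps_X ^ (2 * c)) = fps_X ^ c"
    "gf {l. parity_sign l = - 1} (\<lambda>l. nat \<bar>l\<bar> * c) * (1 - fps_X ^ (2 * c)) = fps_X ^ c"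
proof -
  show lev: "finite_levels UNIV (\<lambda>l :: int. nat \<bar>l\<bar> * c)"
    unfolding finite_levels_def
  proof
    fix k
    have "{l \<in> UNIV. nat \<bar>l\<bar> * c = k} \<subseteq> {- int k..int k}"
    proof
      fix l assume "l \<in> {l \<in> UNIV. nat \<bar>l\<bar> * c = k}"
      then have "nat \<bar>l\<bar> * c = k" by simp
      moreover have "nat \<bar>l\<bar> * 1 \<le> nat \<bar>l\<bar> * c" using assms by (intro mult_left_mono) auto
      ultimately have "nat \<bar>l\<bar> \<le> k" by simp
      then show "l \<in> {- int k..int k}" by auto
    qed
    then show "finite {l \<in> UNIV. nat \<bar>l\<bar> * c = k}" by (rule finite_subset) simp
  qed
  define pos neg where "pos = (\<lambda>b i. int b + 2 * int i)" and "neg = (\<lambda>b i. - (int b + 2 * int i))"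
  have inj: "inj (pos b)" "inj (neg b)" for b by (auto simp: pos_def neg_def inj_on_def)
  have size: "nat \<bar>pos b i\<bar> * c = b * c + (2 * c) * i" "nat \<bar>neg b i\<bar> * c = b * c + (2 * c) * i" for b i
    by (simp_all add: pos_def neg_def nat_add_distrib nat_mult_distrib algebra_simps)
  have g: "gf (range (pos b)) (\<lambda>l. nat \<bar>l\<bar> * c) * (1 - fps_X ^ (2 * c)) = fps_X ^ (b * c)"
    "gf (range (neg b)) (\<lambda>l. nat \<bar>l\<bar> * c) * (1 - fps_X ^ (2 * c)) = fps_X ^ (b * c)" for b
    using assms by (intro geometric_levels inj size; simp)+
  have "{l. parity_sign l = 1} = range (pos 1)"
  proof (intro set_eqI iffI)
    fix l assume "l \<in> {l. parity_sign l = 1}"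
    then have "odd l" "l > 0" by (auto simp: parity_sign_def sgn_if split: if_splits)
    then have "l = pos 1 (nat (l div 2))" by (auto simp: pos_def elim!: oddE)
    then show "l \<in> range (pos 1)" by blast
  qed (auto simp: pos_def parity_sign_def)
  then show "gf {l. parity_sign l = 1} (\<lambda>l. nat \<bar>l\<bar> * c) * (1 - fps_X ^ (2 * c)) = fps_X ^ c"
    using g(1)[of 1] by simp
  have "{l. parity_sign l = - 1} = range (neg 1)"
  proof (intro set_eqI iffI)
    fix l assume "l \<in> {l. parity_sign l = - 1}"
    then have "odd (- l)" "- l > 0" by (auto simp: parity_sign_def sgn_if split: if_splits)
    then obtain j where "- l = 2 * j + 1" "- l > 0" by (blast elim: oddE)
    then have "l = neg 1 (nat j)" by (auto simp: neg_def)
    then show "l \<in> range (neg 1)" by blast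
  qed (auto simp: neg_def parity_sign_def)
  then show "gf {l. parity_sign l = - 1} (\<lambda>l. nat \<bar>l\<bar> * c) * (1 - fps_X ^ (2 * c)) = fps_X ^ c"
    using g(2)[of 1] by simp
  have "{l. parity_sign l = 0} = range (pos 0) \<union> range (neg 2)"
  proof (intro set_eqI iffI)
    fix l assume "l \<in> {l. parity_sign l = 0}"
    then have "even l" by (auto simp: parity_sign_def sgn_if split: if_splits)
    then obtain j where j: "l = 2 * j" by blast
    have "l = pos 0 (nat j) \<or> l = neg 2 (nat (- j - 1))"
      using j by (cases "j \<ge> 0") (auto simp: pos_def neg_def)
    then show "l \<in> range (pos 0) \<union> range (neg 2)" by blast
  qed (auto simp: pos_def neg_def parity_sign_def)
  moreover have "pos 0 i \<noteq> neg 2 j" for i j by (simp add: pos_def neg_def)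
  then have "range (pos 0) \<inter> range (neg 2) = {}" by auto
  ultimately have "gf {l. parity_sign l = 0} (\<lambda>l. nat \<bar>l\<bar> * c)
     = gf (range (pos 0)) (\<lambda>l. nat \<bar>l\<bar> * c) + gf (range (neg 2)) (\<lambda>l. nat \<bar>l\<bar> * c)"
    by (simp add: gf_Un_disjoint finite_levels_subset[OF lev])
  then show "gf {l. parity_sign l = 0} (\<lambda>l. nat \<bar>l\<bar> * c) * (1 - fps_X ^ (2 * c)) = 1 + fps_X ^ (2 * c)"
    using g(1)[of 0] g(2)[of 2] by (simp add: distrib_right)
qed

lemma signed_letter_size_large: "l \<noteq> (0 :: int) \<Longrightarrow> a < nat \<bar>l\<bar> * (2 * a + 1 + s)"
proof -
  assume "l \<noteq> 0"
  then have "1 * (2 * a + 1 + s) \<le> nat \<bar>l\<bar> * (2 * a + 1 + s)" by (intro mult_right_mono) auto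
  then show "a < nat \<bar>l\<bar> * (2 * a + 1 + s)" by (rule less_le_trans[rotated]) simp
qed

lemma finite_levels_signed_words: "finite_levels (signed_words k) (signed_size s)"
  unfolding signed_words_def signed_size_def
  by (rule finite_levels_words)
     (use signed_letter_size_large in \<open>auto simp: parity_sign_def simp del: add_Suc_right mult_Suc_right intro!: signed_letters(1)\<close>)

text \<open>
  After multiplication by the denominators $1 - x_a^2$ the recursion is that of
  \<open>gauss_binomial_recursion\<close>. For \<open>s = 1\<close> adding two neighbouring charges amounts to the extra factor
  $1 + w$.
\<close>

lemma gf_signed_words_below:
  fixes s N :: nat
  assumes s: "s \<le> 1"
  defines "c \<equiv> (\<lambda>N k. gf (words_below UNIV 0 parity_sign N k) (\<lambda>w. \<Sum>a<N. nat \<bar>w a\<bar> * (2 * a + 1 + s)))"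
  shows "(\<Prod>a<N. 1 - fps_X ^ (2 * (2 * a + 1 + s))) * (c N (int s) + of_nat s * c N (int s - 1))
           * qfac N * qfac (N + s) = qfac (2 * N + s)"
proof -
  define Z :: "nat \<Rightarrow> rat fps" where "Z N = (\<Prod>a<N. 1 - fps_X ^ (2 * (2 * a + 1 + s)))" for N
  \<comment> \<open>Multiplication by $(1 + w)^s$, so that the initial condition has the right form.\<close>
  define C where "C N k = Z N * (c N k + of_nat s * c N (k - 1))" for N k
  have rec: "Z (Suc N) * c (Suc N) k = (1 + (fps_X ^ (2 * N + 1 + s))\<^sup>2) * (Z N * c N k)
                 + fps_X ^ (2 * N + 1 + s) * (Z N * c N (k - 1) + Z N * c N (k + 1))" for N k
  proof -
    define x :: "rat fps" where "x = fps_X ^ (2 * N + 1 + s)"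
    define p where "p e = gf {l. parity_sign l = e} (\<lambda>l. nat \<bar>l\<bar> * (2 * N + 1 + s))" for e
    have x2: "fps_X ^ (2 * (2 * N + 1 + s)) = x\<^sup>2"
      by (simp only: x_def power_mult[symmetric] mult.commute)
    have p: "p 0 * (1 - x\<^sup>2) = 1 + x\<^sup>2" "p 1 * (1 - x\<^sup>2) = x" "p (- 1) * (1 - x\<^sup>2) = x"
      unfolding p_def x2[symmetric] by (subst signed_letters; simp add: x_def)+
    have "c (Suc N) k = (\<Sum>e\<in>{-1, 0, 1}. gf {l \<in> UNIV. parity_sign l = e} (\<lambda>l. nat \<bar>l\<bar> * (2 * N + 1 + s)) * c N (k - e))"
      unfolding c_def
      by (rule gf_words_below_Suc) (auto simp: parity_sign_def sgn_if simp del: add_Suc_right mult_Suc_right intro!: signed_letters(1))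
    then have "c (Suc N) k = p (- 1) * c N (k + 1) + p 0 * c N k + p 1 * c N (k - 1)"
      by (simp add: p_def)
    then have "Z (Suc N) * c (Suc N) k = (p (- 1) * (1 - x\<^sup>2)) * (Z N * c N (k + 1))
       + (p 0 * (1 - x\<^sup>2)) * (Z N * c N k) + (p 1 * (1 - x\<^sup>2)) * (Z N * c N (k - 1))"
      unfolding Z_def prod.lessThan_Suc x2 by (simp only: distrib_left distrib_right mult_ac)
    then show ?thesis unfolding p x_def[symmetric] by (simp add: algebra_simps)
  qed
  have "C (Suc N) k = (1 + (fps_X ^ (2 * N + 1 + s))\<^sup>2) * C N k
                 + fps_X ^ (2 * N + 1 + s) * (C N (k - 1) + C N (k + 1))" for N k
  proof -
    have "C (Suc N) k = Z (Suc N) * c (Suc N) k + of_nat s * (Z (Suc N) * c (Suc N) (k - 1))"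
      by (simp only: C_def distrib_left mult_ac)
    then show ?thesis unfolding rec C_def by (simp add: algebra_simps)
  qed
  moreover have "C 0 k = (if k = 0 \<or> k = int s then 1 else 0)" for k
  proof -
    have "c 0 k = (if k = 0 then 1 else 0)" for k
      unfolding c_def by (rule gf_words_below_0) simp
    then show ?thesis using s by (cases s) (auto simp: C_def Z_def)
  qed
  ultimately have "C N (int s) = qfac (2 * N + s) * (qinv (int (N + s)) * qinv (int N))"
    using gauss_binomial_recursion[of s C N "int s"] s by simp
  then have "C N (int s) * qfac N * qfac (N + s)
     = qfac (2 * N + s) * (qinv (int (N + s)) * qfac (N + s)) * (qinv (int N) * qfac N)"
    by (simp only: mult_ac)
  then show ?thesis unfolding qinv_of_nat C_def Z_def mult_1_right .
qed

lemma gf_signed_words_tendsto: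
  "(\<lambda>N. gf (words_below UNIV 0 parity_sign N k) (\<lambda>w. \<Sum>a<N. nat \<bar>w a\<bar> * (2 * a + 1 + s)))
     \<longlonglongrightarrow> gf (signed_words k) (signed_size s)"
  unfolding signed_words_def signed_size_def
  by (rule gf_words_below_tendsto) (use signed_letter_size_large in \<open>auto simp: parity_sign_def\<close>)

lemma gf_neutral_signed_words:
  "gf (signed_words 0) (signed_size 0) * euler_prod (fps_X ^ 2) ^ 2 = euler_prod (fps_X ^ 4)"
proof -
  define c where "c N = gf (words_below UNIV 0 parity_sign N 0) (\<lambda>w. \<Sum>a<N. nat \<bar>w a\<bar> * (2 * a + 1 + 0))" for N
  have "c N * qfac N * qfac N = euler_partial 4 N" for N
  proof -
    define Z :: "rat fps" where "Z = (\<Prod>a<N. 1 - fps_X ^ (2 * (2 * a + 1)))"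
    have "Z * c N * qfac N * qfac N = qfac (2 * N)"
      using gf_signed_words_below[of 0 N] by (simp add: c_def Z_def)
    \<comment> \<open>The denominators of the letters are the odd half of the numerator of the Gaussian binomial.\<close>
    moreover have ZE: "qfac (2 * N) = Z * euler_partial 4 N"
      using euler_partial_even_odd[of 2 N] by (simp add: qfac_def Z_def)
    ultimately have "Z * (c N * qfac N * qfac N) = Z * euler_partial 4 N"
      by (simp only: mult_ac)
    moreover have "Z \<noteq> 0" using ZE qfac_nonzero[of "2 * N"] by auto
    ultimately show ?thesis by simp
  qed
  then have "(\<lambda>N. c N * qfac N * qfac N) \<longlonglongrightarrow> euler_prod (fps_X ^ 4)"
    using euler_partial_tendsto[of 4] by simp
  moreover have "(\<lambda>N. c N * qfac N * qfac N) \<longlonglongrightarrow>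
     gf (signed_words 0) (signed_size 0) * euler_prod (fps_X ^ 2) * euler_prod (fps_X ^ 2)"
    unfolding qfac_def c_def
    by (intro tendsto_fps_mult euler_partial_tendsto gf_signed_words_tendsto) simp_all
  ultimately show ?thesis
    using LIMSEQ_unique by (fastforce simp: power2_eq_square mult.assoc)
qed

lemma gf_short_signed_words:
  "gf (signed_words 0 \<union> signed_words 1) (signed_size 1)
     * (euler_prod (fps_X ^ 2) * euler_prod (fps_X ^ 4)) = 1"
proof -
  define c where "c k N = gf (words_below UNIV 0 parity_sign N k) (\<lambda>w. \<Sum>a<N. nat \<bar>w a\<bar> * (2 * a + 1 + 1))"
    for k and N :: nat
  define G where "G k = gf (signed_words k) (signed_size 1)" for k
  have "euler_partial 4 N * (c 1 N + c 0 N) * qfac N * qfac (N + 1) = qfac (2 * N + 1)" for N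
  proof -
    have "(\<Prod>a<N. 1 - fps_X ^ (2 * (2 * a + 1 + 1))) = euler_partial 4 N"
      unfolding euler_partial_def by (intro prod.cong refl arg_cong[where f = "\<lambda>e. 1 - fps_X ^ e"]) simp
    then show ?thesis
      using gf_signed_words_below[of 1 N] by (simp add: c_def)
  qed
  note sum = this
  have eq: "euler_partial 4 N * c 1 N * qfac N * qfac (N + 1)
     = qfac (2 * N + 1) - euler_partial 4 N * c 0 N * qfac N * qfac (N + 1)" for N
    unfolding sum[symmetric] by (simp only: distrib_left distrib_right add_diff_cancel_right')
  have lim: "(\<lambda>N. euler_partial 4 N * c k N * qfac N * qfac (N + 1)) \<longlonglongrightarrow>
      euler_prod (fps_X ^ 4) * G k * euler_prod (fps_X ^ 2) * euler_prod (fps_X ^ 2)" for k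
    unfolding qfac_def c_def G_def
    by (intro tendsto_fps_mult euler_partial_tendsto euler_partial_shift_tendsto gf_signed_words_tendsto) simp_all
  have "(\<lambda>N. qfac (2 * N + 1)) \<longlonglongrightarrow> euler_prod (fps_X ^ 2)"
    unfolding qfac_def by (rule euler_partial_double_tendsto) simp
  with lim[of 0] have "(\<lambda>N. qfac (2 * N + 1) - euler_partial 4 N * c 0 N * qfac N * qfac (N + 1)) \<longlonglongrightarrow>
     euler_prod (fps_X ^ 2) - euler_prod (fps_X ^ 4) * G 0 * euler_prod (fps_X ^ 2) * euler_prod (fps_X ^ 2)"
    unfolding tendsto_fps_iff
  proof (intro allI)
    fix k
    assume "\<forall>k. \<forall>\<^sub>F N in sequentially. fps_nth (euler_partial 4 N * c 0 N * qfac N * qfac (N + 1)) k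
        = fps_nth (euler_prod (fps_X ^ 4) * G 0 * euler_prod (fps_X ^ 2) * euler_prod (fps_X ^ 2)) k"
      "\<forall>k. \<forall>\<^sub>F N in sequentially. fps_nth (qfac (2 * N + 1)) k = fps_nth (euler_prod (fps_X ^ 2)) k"
    from spec[OF this(1), of k] spec[OF this(2), of k]
    show "\<forall>\<^sub>F N in sequentially. fps_nth (qfac (2 * N + 1) - euler_partial 4 N * c 0 N * qfac N * qfac (N + 1)) k
       = fps_nth (euler_prod (fps_X ^ 2) - euler_prod (fps_X ^ 4) * G 0 * euler_prod (fps_X ^ 2) * euler_prod (fps_X ^ 2)) k"
      by eventually_elim simp
  qed
  from LIMSEQ_unique[OF lim[of 1, unfolded eq] this]
  have "(G 0 + G 1) * (euler_prod (fps_X ^ 2) * euler_prod (fps_X ^ 4)) * euler_prod (fps_X ^ 2)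
      = 1 * euler_prod (fps_X ^ 2)"
    by (simp add: algebra_simps)
  then have "(G 0 + G 1) * (euler_prod (fps_X ^ 2) * euler_prod (fps_X ^ 4)) = 1"
    using euler_prod_nonzero[of 2] by simp
  moreover have "gf (signed_words 0 \<union> signed_words 1) (signed_size 1) = G 0 + G 1"
    unfolding G_def
    by (intro gf_Un_disjoint finite_levels_signed_words) (auto simp: signed_words_def words_def)
  ultimately show ?thesis by simp
qed

section \<open>The generating function of the wall data\<close>

type_synonym wall_data = "(nat \<Rightarrow> int) \<times> (nat \<Rightarrow> int) \<times> (nat \<Rightarrow> nat \<Rightarrow> int \<times> int)"

text \<open>
  A proper wall will be encoded by a free word, a signed word and one balanced word of pairs for each
  $j = 1, \dots, n-1$. The charge of the signed word may be 0 or 1 if \<open>s = 1\<close>.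
\<close>

definition wall_data :: "nat \<Rightarrow> nat \<Rightarrow> wall_data set" where
  "wall_data n s = free_words \<times> (if s = 0 then signed_words 0 else signed_words 0 \<union> signed_words 1)
       \<times> (PiE {1..<n} (\<lambda>_. balanced_pairs))"

definition data_size :: "nat \<Rightarrow> nat \<Rightarrow> wall_data \<Rightarrow> nat" where
  "data_size n s = (\<lambda>(f, v, P). free_size s f + (signed_size s v + (\<Sum>j\<in>{1..<n}. pairs_size (P j))))"

lemma finite_levels_Un: "finite_levels A s \<Longrightarrow> finite_levels B s \<Longrightarrow> finite_levels (A \<union> B) s"
  unfolding finite_levels_def
proof
  fix k
  assume "\<forall>k. finite {a \<in> A. s a = k}" "\<forall>k. finite {a \<in> B. s a = k}"
  then have "finite ({a \<in> A. s a = k} \<union> {a \<in> B. s a = k})" by simp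
  then show "finite {a \<in> A \<union> B. s a = k}" by (rule rev_finite_subset) auto
qed

lemma gf_wall_data:
  assumes "s \<le> 1"
  shows "gf (wall_data n s) (data_size n s) =
     gf free_words (free_size s) *
     (gf (if s = 0 then signed_words 0 else signed_words 0 \<union> signed_words 1) (signed_size s) *
     gf balanced_pairs pairs_size ^ (n - 1))"
proof -
  define V where "V = (if s = 0 then signed_words 0 else signed_words 0 \<union> signed_words 1)"
  have V: "finite_levels V (signed_size s)"
    unfolding V_def using finite_levels_signed_words by (simp add: finite_levels_Un)
  have P: "finite_levels (PiE {1..<n} (\<lambda>_. balanced_pairs)) (\<lambda>P. \<Sum>j\<in>{1..<n}. pairs_size (P j))"
    "gf (PiE {1..<n} (\<lambda>_. balanced_pairs)) (\<lambda>P. \<Sum>j\<in>{1..<n}. pairs_size (P j))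
       = gf balanced_pairs pairs_size ^ (n - 1)"
    using gf_PiE[of "{1..<n}" "\<lambda>_. balanced_pairs" "\<lambda>_. pairs_size"] finite_levels_balanced_pairs
    by simp_all
  have "gf (wall_data n s) (data_size n s) =
      gf (free_words \<times> (V \<times> PiE {1..<n} (\<lambda>_. balanced_pairs)))
       (\<lambda>(f, y). free_size s f + (case y of (v, P) \<Rightarrow> signed_size s v + (\<Sum>j\<in>{1..<n}. pairs_size (P j))))"
    unfolding wall_data_def data_size_def V_def by (rule gf_cong) auto
  also have "\<dots> = gf free_words (free_size s) * (gf V (signed_size s) * gf balanced_pairs pairs_size ^ (n - 1))"
    unfolding gf_Times[OF gf_free_words(1)[OF assms] finite_levels_Times[OF V P(1)]] gf_Times[OF V P(1)] P(2) ..
  finally show ?thesis unfolding V_def .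
qed

lemma fps_eq_divideI:
  fixes a b c :: "rat fps"
  assumes "a * b = c" "fps_nth b 0 = 1"
  shows "a = c / b"
proof -
  have "c / b = a * (b * inverse b)"
    using assms by (simp add: fps_divide_unit mult.assoc)
  also have "b * inverse b = 1" using assms(2) by (intro inverse_mult_eq_1') simp
  finally show ?thesis by simp
qed

lemma gf_wall_data_spin:
  assumes "n \<ge> 3"
  shows "gf (wall_data n 0) (data_size n 0) =
    euler_prod (fps_X ^ 4) / euler_prod (fps_X ^ 2) ^ (n + 2)"
proof (rule fps_eq_divideI)
  define E where "E = euler_prod (fps_X ^ 2)"
  define F S P where "F = gf free_words (free_size 0)" and "S = gf (signed_words 0) (signed_size 0)"
    and "P = gf balanced_pairs pairs_size"
  have eqs: "F * E = 1" "S * E ^ 2 = euler_prod (fps_X ^ 4)" "P * E = 1"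
    using gf_free_words(2)[of 0] gf_neutral_signed_words gf_balanced_pairs
    by (simp_all add: F_def S_def P_def E_def)
  have "n + 2 = Suc (2 + (n - 1))" using assms by simp
  then have "E ^ (n + 2) = E * (E ^ 2 * E ^ (n - 1))" by (simp only: power_Suc power_add)
  moreover have "gf (wall_data n 0) (data_size n 0) = F * (S * P ^ (n - 1))"
    using gf_wall_data[of 0 n] by (simp add: F_def S_def P_def)
  ultimately have "gf (wall_data n 0) (data_size n 0) * E ^ (n + 2) = (F * E) * (S * E ^ 2) * (P * E) ^ (n - 1)"
    by (simp only: power_mult_distrib mult_ac)
  then show "gf (wall_data n 0) (data_size n 0) * euler_prod (fps_X ^ 2) ^ (n + 2) = euler_prod (fps_X ^ 4)"
    by (simp add: eqs E_def[symmetric])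
  show "fps_nth (euler_prod (fps_X ^ 2) ^ (n + 2)) 0 = 1"
    by (simp only: fps_nth_power_0 euler_prod_nth_0) simp
qed

lemma gf_wall_data_vector:
  assumes "n \<ge> 3"
  shows "gf (wall_data n 1) (data_size n 1) =
    1 / (euler_prod fps_X * euler_prod (fps_X ^ 2) ^ (n - 1) * euler_prod (fps_X ^ 4))"
proof (rule fps_eq_divideI)
  define E where "E = (\<lambda>c. euler_prod (fps_X ^ c))"
  define F S P where "F = gf free_words (free_size 1)"
    and "S = gf (signed_words 0 \<union> signed_words 1) (signed_size 1)"
    and "P = gf balanced_pairs pairs_size"
  have eqs: "F * E 1 = E 2" "S * (E 2 * E 4) = 1" "P * E 2 = 1"
    using gf_free_words(2)[of 1] gf_short_signed_words gf_balanced_pairs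
    by (simp_all add: F_def S_def P_def E_def)
  have "gf (wall_data n 1) (data_size n 1) = F * (S * P ^ (n - 1))"
    using gf_wall_data[of 1 n] by (simp add: F_def S_def P_def)
  then have "gf (wall_data n 1) (data_size n 1) * (E 1 * E 2 ^ (n - 1) * E 4)
      = (F * E 1) * (S * E 4) * (P * E 2) ^ (n - 1)"
    by (simp only: power_mult_distrib mult_ac)
  also have "\<dots> = S * (E 2 * E 4)"
    unfolding eqs(1) eqs(3) power_one by (simp only: mult_1_right mult_1 mult_ac)
  also have "\<dots> = 1" by (rule eqs(2))
  finally show "gf (wall_data n 1) (data_size n 1) *
      (euler_prod fps_X * euler_prod (fps_X ^ 2) ^ (n - 1) * euler_prod (fps_X ^ 4)) = 1"
    by (simp add: E_def)
  show "fps_nth (euler_prod fps_X * euler_prod (fps_X ^ 2) ^ (n - 1) * euler_prod (fps_X ^ 4)) 0 = 1"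
    using euler_prod_nth_0[of 1] by (simp add: fps_nth_power_0 euler_prod_nth_0)
qed

lemma fps_nth_compose_X_square:
  fixes f :: "rat fps"
  shows "fps_nth (fps_compose f (fps_X ^ 2)) k = (if even k then fps_nth f (k div 2) else 0)"
proof -
  have "fps_nth (fps_compose f (fps_X ^ 2)) k = (\<Sum>i\<in>{0..k}. if k = 2 * i then fps_nth f i else 0)"
    unfolding fps_compose_nth by (intro sum.cong refl) (simp add: power_mult[symmetric])
  also have "\<dots> = (\<Sum>i\<in>{0..k}. if i = k div 2 then (if even k then fps_nth f i else 0) else 0)"
    by (intro sum.cong refl) auto
  also have "\<dots> = (if even k then fps_nth f (k div 2) else 0)" by simp
  finally show ?thesis .
qed

lemma euler_prod_compose_X_square:
  assumes "c > 0"
  shows "fps_compose (euler_prod (fps_X ^ c)) (fps_X ^ 2) = euler_prod (fps_X ^ (2 * c))"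
proof (rule LIMSEQ_unique)
  have "fps_compose (euler_partial c N) (fps_X ^ 2) = euler_partial (2 * c) N" for N
    unfolding euler_partial_def
    by (subst fps_compose_prod_distrib)
       (auto intro!: prod.cong simp: fps_compose_sub_distrib fps_compose_power[symmetric]
          power_mult[symmetric] mult.assoc simp del: mult_Suc_right power_Suc)
  then show "(\<lambda>N. fps_compose (euler_partial c N) (fps_X ^ 2)) \<longlonglongrightarrow> euler_prod (fps_X ^ (2 * c))"
    using euler_partial_tendsto[of "2 * c"] assms by simp
  show "(\<lambda>N. fps_compose (euler_partial c N) (fps_X ^ 2)) \<longlonglongrightarrow> fps_compose (euler_prod (fps_X ^ c)) (fps_X ^ 2)"
    using euler_partial_tendsto[OF assms] unfolding tendsto_fps_iff
    by (auto simp: fps_nth_compose_X_square)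
qed

text \<open>
  Substituting $-y$ for $y$ picks out the even powers of $y$; the Euler products in even powers are
  unaffected.
\<close>

lemma euler_partial_compose_neg:
  "fps_compose (euler_partial 2 N) (- fps_X) = euler_partial 2 N"
  "fps_compose (euler_partial 4 N) (- fps_X) = euler_partial 4 N"
  unfolding euler_partial_def
  by (subst fps_compose_prod_distrib;
      auto intro!: prod.cong simp: fps_compose_sub_distrib fps_compose_power[symmetric] power_mult
        simp del: mult_Suc_right power_Suc)+

lemma fps_compose_neg_tendsto:
  fixes f :: "nat \<Rightarrow> rat fps"
  assumes "f \<longlonglongrightarrow> a"
  shows "(\<lambda>N. fps_compose (f N) (- fps_X)) \<longlonglongrightarrow> fps_compose a (- fps_X)"
  unfolding tendsto_fps_iff
proof
  fix k
  have "eventually (\<lambda>N. fps_nth (f N) k = fps_nth a k) sequentially"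
    using assms by (simp add: tendsto_fps_iff)
  then show "eventually (\<lambda>N. fps_nth (fps_compose (f N) (- fps_X)) k = fps_nth (fps_compose a (- fps_X)) k) sequentially"
    by eventually_elim (simp add: fps_compose_uminus')
qed

lemma euler_prod_compose_neg:
  "fps_compose (euler_prod (fps_X ^ 2)) (- fps_X) = euler_prod (fps_X ^ 2)"
  "fps_compose (euler_prod (fps_X ^ 4)) (- fps_X) = euler_prod (fps_X ^ 4)"
  using fps_compose_neg_tendsto[OF euler_partial_tendsto[of 2]] euler_partial_tendsto[of 2]
    fps_compose_neg_tendsto[OF euler_partial_tendsto[of 4]] euler_partial_tendsto[of 4]
  by (auto simp: euler_partial_compose_neg intro: LIMSEQ_unique)

text \<open>
  If $O_1$ and $P_1$ denote the products of $1 - y^{2a+1}$ and $1 + y^{2a+1}$, then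
  $(y)_\infty = O_1 (y^2)_\infty$ becomes $P_1 (y^2)_\infty$ under $y \mapsto -y$, and
  $O_1 P_1 (y^4)_\infty = \prod (1 - y^{4a+2}) (y^4)_\infty = (y^2)_\infty$.
\<close>

lemma euler_prod_neg_product:
  "fps_compose (euler_prod fps_X) (- fps_X) * euler_prod fps_X * euler_prod (fps_X ^ 4)
     = euler_prod (fps_X ^ 2) ^ 3"
proof -
  have fin: "fps_compose (euler_partial 1 (2 * N)) (- fps_X) * euler_partial 1 (2 * N) * euler_partial 4 N
     = euler_partial 2 (2 * N) * euler_partial 2 N * euler_partial 2 N" for N
  proof -
    define O1 where "O1 = (\<Prod>a<N. 1 - fps_X ^ (2 * a + 1) :: rat fps)"
    define P1 where "P1 = (\<Prod>a<N. 1 + fps_X ^ (2 * a + 1) :: rat fps)"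
    have e1: "euler_partial 1 (2 * N) = O1 * euler_partial 2 N"
      using euler_partial_even_odd[of 1 N] by (simp add: O1_def)
    have "fps_compose O1 (- fps_X) = P1"
      unfolding O1_def P1_def
      by (subst fps_compose_prod_distrib)
         (auto intro!: prod.cong simp: fps_compose_sub_distrib fps_compose_power[symmetric] simp del: power_Suc)
    then have neg: "fps_compose (euler_partial 1 (2 * N)) (- fps_X) = P1 * euler_partial 2 N"
      unfolding e1 by (simp add: fps_compose_mult_distrib euler_partial_compose_neg)
    have "P1 * O1 = (\<Prod>a<N. 1 - fps_X ^ (2 * (2 * a + 1)))"
      unfolding P1_def O1_def prod.distrib[symmetric]
    proof (rule prod.cong[OF refl])
      fix a
      have "fps_X ^ (2 * (2 * a + 1)) = (fps_X ^ (2 * a + 1) * fps_X ^ (2 * a + 1) :: rat fps)"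
        unfolding power_add[symmetric] mult_2 ..
      then show "(1 + fps_X ^ (2 * a + 1)) * (1 - fps_X ^ (2 * a + 1)) = (1 - fps_X ^ (2 * (2 * a + 1)) :: rat fps)"
        by (simp only:) (simp only: distrib_right right_diff_distrib mult_1 mult_1_right, simp)
    qed
    then have "euler_partial 2 (2 * N) = P1 * O1 * euler_partial 4 N"
      using euler_partial_even_odd[of 2 N] by simp
    then show ?thesis unfolding neg unfolding e1 by (simp only: mult_ac)
  qed
  have "(\<lambda>N. fps_compose (euler_partial 1 (2 * N)) (- fps_X) * euler_partial 1 (2 * N) * euler_partial 4 N)
     \<longlonglongrightarrow> fps_compose (euler_prod (fps_X ^ 1)) (- fps_X) * euler_prod (fps_X ^ 1) * euler_prod (fps_X ^ 4)"
    using euler_partial_double_tendsto[of 1 0]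
    by (intro tendsto_fps_mult fps_compose_neg_tendsto euler_partial_tendsto) simp_all
  moreover have "(\<lambda>N. euler_partial 2 (2 * N) * euler_partial 2 N * euler_partial 2 N)
     \<longlonglongrightarrow> euler_prod (fps_X ^ 2) * euler_prod (fps_X ^ 2) * euler_prod (fps_X ^ 2)"
    using euler_partial_double_tendsto[of 2 0]
    by (intro tendsto_fps_mult euler_partial_tendsto) simp_all
  ultimately have "fps_compose (euler_prod (fps_X ^ 1)) (- fps_X) * euler_prod (fps_X ^ 1) * euler_prod (fps_X ^ 4)
    = euler_prod (fps_X ^ 2) * euler_prod (fps_X ^ 2) * euler_prod (fps_X ^ 2)"
    unfolding fin by (rule LIMSEQ_unique)
  then show ?thesis by (simp add: power3_eq_cube)
qed

text \<open>
  The even part of a series $G$ is $\frac12 (G(y) + G(-y))$, and by \<open>euler_prod_neg_product\<close> the second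
  term of the claim is $G(-y)$.
\<close>

lemma vector_gf_even_part:
  assumes n: "n \<ge> 3" and f: "\<And>m. fps_nth f m = fps_nth (gf (wall_data n 1) (data_size n 1)) (2 * m)"
  shows "fps_compose f (fps_X ^ 2) = fps_const (1 / 2) *
            (1 / (euler_prod fps_X * euler_prod (fps_X ^ 2) ^ (n - 1) * euler_prod (fps_X ^ 4))
             + euler_prod fps_X / euler_prod (fps_X ^ 2) ^ (n + 2))"
proof -
  define E where "E = (\<lambda>c. euler_prod (fps_X ^ c))"
  define G where "G = gf (wall_data n 1) (data_size n 1)"
  define D where "D = E 1 * E 2 ^ (n - 1) * E 4"
  have E0: "fps_nth (E c) 0 = 1" if "c > 0" for c
    using that by (simp add: E_def euler_prod_nth_0)
  have D0: "fps_nth D 0 = 1" by (simp add: D_def E0 fps_nth_power_0)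
  have "G = 1 / D" using gf_wall_data_vector[OF n] by (simp add: G_def D_def E_def)
  then have "G * D = 1" using D0 by (simp add: fps_divide_unit inverse_mult_eq_1)
  then have "fps_compose (G * D) (- fps_X) = 1" by simp
  moreover have D': "fps_compose D (- fps_X) * E 1 = E 2 ^ (n + 2)"
  proof -
    have "fps_compose D (- fps_X) * E 1
        = (fps_compose (E 1) (- fps_X) * E 1 * E 4) * E 2 ^ (n - 1)"
      unfolding D_def E_def
      by (simp add: fps_compose_mult_distrib fps_compose_power[symmetric] euler_prod_compose_neg mult_ac)
    also have "fps_compose (E 1) (- fps_X) * E 1 * E 4 = E 2 ^ 3"
      using euler_prod_neg_product by (simp add: E_def)
    also have "E 2 ^ 3 * E 2 ^ (n - 1) = E 2 ^ (n + 2)"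
      using n by (simp add: power_add[symmetric])
    finally show ?thesis .
  qed
  ultimately have "fps_compose G (- fps_X) * fps_compose D (- fps_X) = 1"
    by (simp add: fps_compose_mult_distrib)
  then have "fps_compose G (- fps_X) * E 2 ^ (n + 2) = E 1"
    unfolding D'[symmetric] mult.assoc[symmetric] by simp
  then have G': "fps_compose G (- fps_X) = E 1 / E 2 ^ (n + 2)"
    by (rule fps_eq_divideI) (simp add: fps_nth_power_0 E0)
  have fG: "fps_nth f m = fps_nth G (2 * m)" for m unfolding G_def by (rule f)
  have "fps_compose f (fps_X ^ 2) = fps_const (1 / 2) * (G + fps_compose G (- fps_X))"
  proof (rule fps_ext)
    fix k
    show "fps_nth (fps_compose f (fps_X ^ 2)) k = fps_nth (fps_const (1 / 2) * (G + fps_compose G (- fps_X))) k"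
      by (auto simp: fps_nth_compose_X_square fG fps_compose_uminus')
  qed
  then show ?thesis unfolding G' unfolding \<open>G = 1 / D\<close> by (simp add: D_def E_def)
qed

text \<open>
  Here the generating function is a series in $y^2 = q$ already.
\<close>

lemma spin_gf_even_part:
  assumes n: "n \<ge> 3" and f: "\<And>m. fps_nth f m = fps_nth (gf (wall_data n 0) (data_size n 0)) (2 * m)"
  shows "f = euler_prod (fps_X ^ 2) / euler_prod fps_X ^ (n + 2)"
proof -
  define g where "g = euler_prod (fps_X ^ 2) / euler_prod fps_X ^ (n + 2)"
  define E where "E = (\<lambda>c. euler_prod (fps_X ^ c))"
  have E0: "fps_nth (E c) 0 = 1" if "c > 0" for c
    using that by (simp add: E_def euler_prod_nth_0)
  have "g * E 1 ^ (n + 2) = E 2"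
  proof -
    have "E 1 ^ (n + 2) * inverse (E 1 ^ (n + 2)) = 1"
      by (intro inverse_mult_eq_1') (simp add: fps_nth_power_0 E0)
    moreover have "g = E 2 * inverse (E 1 ^ (n + 2))"
      unfolding g_def using E0[of 1] by (subst fps_divide_unit) (simp_all add: E_def fps_nth_power_0)
    ultimately show ?thesis by (simp add: mult.assoc mult.commute[of "inverse _"])
  qed
  then have "fps_compose (g * E 1 ^ (n + 2)) (fps_X ^ 2) = fps_compose (E 2) (fps_X ^ 2)" by simp
  then have "fps_compose g (fps_X ^ 2) * E 2 ^ (n + 2) = E 4"
    using euler_prod_compose_X_square[of 1] euler_prod_compose_X_square[of 2]
    by (simp add: fps_compose_mult_distrib fps_compose_power[symmetric] E_def)
  then have "fps_compose g (fps_X ^ 2) = E 4 / E 2 ^ (n + 2)"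
    by (rule fps_eq_divideI) (simp add: fps_nth_power_0 E0)
  then have "gf (wall_data n 0) (data_size n 0) = fps_compose g (fps_X ^ 2)"
    using gf_wall_data_spin[OF n] by (simp add: E_def)
  then have "f = g" by (intro fps_ext) (simp add: f fps_nth_compose_X_square)
  then show ?thesis by (simp add: g_def)
qed

section \<open>Walls from signed multiplicities\<close>

text \<open>
  Every half period consists of $n - 1$ floors with $n$ blocks: a floor with two blocks, followed by
  $n - 2$ cubes. The double floors are numbered by \<open>h\<close>; they are alternately split floors and pairs of
  half-height \<open>n\<close>-blocks.
\<close>

definition split_floor :: "nat \<Rightarrow> nat \<Rightarrow> nat \<Rightarrow> bool" where
  "split_floor n t h \<longleftrightarrow> (even h \<longleftrightarrow> t \<noteq> n)"

lemma length_floor_pattern: "n \<ge> 3 \<Longrightarrow> length (floor_pattern n t) = 2 * (n - 1)"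
  by (auto simp: floor_pattern_def)

lemma floor_at_base:
  assumes "n \<ge> 3" "i < n - 1"
  shows "floor_at n t ((n - 1) * h + i) =
    (if i = 0 then (if split_floor n t h then Split else Halves)
     else if split_floor n t h then Cube (Suc i) else Cube (n - i))"
proof -
  define d where "d = n - 1"
  have d: "n = Suc d" "i < d" "d \<ge> 2" using assms by (auto simp: d_def)
  have "((n - 1) * h + i) mod length (floor_pattern n t) = (if even h then i else d + i)"
  proof (cases "even h")
    case True
    then obtain k where "h = 2 * k" by blast
    then have "(n - 1) * h + i = i + (2 * d) * k" using d by simp
    then have "((n - 1) * h + i) mod (2 * d) = i mod (2 * d)" by (simp only: mod_mult_self2)
    then show ?thesis using True d assms by (simp add: length_floor_pattern)
  next
    case False
    then obtain k where "h = 2 * k + 1" by (blast elim: oddE)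
    then have "(n - 1) * h + i = (d + i) + (2 * d) * k" using d by (simp add: algebra_simps)
    then have "((n - 1) * h + i) mod (2 * d) = (d + i) mod (2 * d)" by (simp only: mod_mult_self2)
    then show ?thesis using False d assms by (simp add: length_floor_pattern)
  qed
  note index = this
  have up: "(x # map Cube [2..<n]) ! i = (if i = 0 then x else Cube (Suc i))" for x
    using d by (auto simp: nth_Cons' simp del: upt_Suc)
  have down: "(x # map Cube (rev [2..<n])) ! i = (if i = 0 then x else Cube (n - i))" for x
    using d by (auto simp: nth_Cons' rev_nth simp del: upt_Suc)
  have halves: "(A @ B) ! i = A ! i" "(A @ B) ! (d + i) = B ! i"
    if "length A = d" for A B :: "floor_kind list"
    using that d(2) by (auto simp: nth_append)
  have pattern: "floor_pattern n t =
     (if t = n then (Halves # map Cube (rev [2..<n])) @ (Split # map Cube [2..<n])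
      else (Split # map Cube [2..<n]) @ (Halves # map Cube (rev [2..<n])))"
    by (simp add: floor_pattern_def)
  have lengths: "length (x # map Cube [2..<n]) = d" "length (x # map Cube (rev [2..<n])) = d" for x
    using d by simp_all
  have "floor_at n t ((n - 1) * h + i) = floor_pattern n t ! (if even h then i else d + i)"
    unfolding floor_at_def index ..
  then show ?thesis
    unfolding split_floor_def pattern
    by (cases "t = n"; cases "even h")
       (simp_all only: if_True if_False simp_thms halves(1)[OF lengths(1)] halves(2)[OF lengths(1)]
          halves(1)[OF lengths(2)] halves(2)[OF lengths(2)] up down)
qed

text \<open>
  The number of added blocks in a column whose top floor is \<open>j\<close> and is filled (\<open>top_rank\<close>), or is occupied
  by a single block of that floor (\<open>start_rank\<close>). The two differ for double floors only.
\<close>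

definition top_rank :: "nat \<Rightarrow> nat \<Rightarrow> nat" where
  "top_rank n j = Suc (j + j div (n - 1))"

definition start_rank :: "nat \<Rightarrow> nat \<Rightarrow> nat" where
  "start_rank n j = (if n - 1 dvd j then top_rank n j - 1 else top_rank n j)"

lemma floor_cases:
  fixes j :: nat
  assumes "n \<ge> 3"
  obtains h i where "j = (n - 1) * h + i" "i < n - 1"
proof -
  have "j = (n - 1) * (j div (n - 1)) + j mod (n - 1)" by simp
  moreover have "j mod (n - 1) < n - 1" using assms by simp
  ultimately show ?thesis using that by blast
qed

lemma rank_base:
  assumes "n \<ge> 3" "i < n - 1"
  shows "top_rank n ((n - 1) * h + i) = n * h + Suc i"
    and "start_rank n ((n - 1) * h + i) = (if i = 0 then n * h else n * h + Suc i)"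
proof -
  have 1: "((n - 1) * h + i) div (n - 1) = h" using assms by simp
  have 2: "(n - 1) * h + h = n * h" using assms by (cases n) auto
  show t: "top_rank n ((n - 1) * h + i) = n * h + Suc i"
    unfolding top_rank_def 1 using 2 by simp
  have "n - 1 dvd (n - 1) * h + i \<longleftrightarrow> i = 0"
    using assms by (simp add: dvd_add_right_iff) (auto dest: nat_dvd_not_less)
  then show "start_rank n ((n - 1) * h + i) = (if i = 0 then n * h else n * h + Suc i)"
    unfolding start_rank_def t by simp
qed

lemma start_rank_Suc:
  assumes "n \<ge> 3"
  shows "start_rank n (Suc j) = Suc (top_rank n j)"
proof -
  obtain h i where j: "j = (n - 1) * h + i" "i < n - 1" using floor_cases[OF assms] .
  show ?thesis
  proof (cases "Suc i < n - 1")
    case True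
    then have "start_rank n ((n - 1) * h + Suc i) = n * h + Suc (Suc i)"
      using assms by (subst rank_base(2)) auto
    then show ?thesis using j rank_base(1)[OF assms, of i h] by simp
  next
    case False
    then have i: "Suc i = n - 1" using j by simp
    then have "Suc j = (n - 1) * Suc h + 0" using j by simp
    then have "start_rank n (Suc j) = n * Suc h"
      using assms by (simp only: rank_base(2)) simp
    moreover have "top_rank n j = n * h + (n - 1)" using j i rank_base(1)[OF assms, of i h] by simp
    ultimately show ?thesis using assms by simp
  qed
qed

lemma start_le_top: "start_rank n j \<le> top_rank n j"
  by (simp add: start_rank_def)

lemma strict_mono_start_rank:
  assumes "n \<ge> 3"
  shows "strict_mono (start_rank n)"
proof (rule strict_mono_Suc_iff[THEN iffD2], intro allI)
  show "start_rank n j < start_rank n (Suc j)" for j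
    unfolding start_rank_Suc[OF assms] using start_le_top[of n j] by simp
qed

lemma start_rank_0: "start_rank n 0 = 0"
  by (simp add: start_rank_def top_rank_def)

lemma not_dvd_top_rank:
  assumes "n \<ge> 3"
  shows "\<not> n dvd top_rank n j"
proof -
  obtain h i where j: "j = (n - 1) * h + i" "i < n - 1" using floor_cases[OF assms] .
  then have "top_rank n j = n * h + Suc i" using rank_base(1)[OF assms, of i h] by simp
  moreover have "\<not> n dvd Suc i" using j by (auto dest!: dvd_imp_le)
  ultimately show ?thesis by (metis dvd_add_right_iff dvd_triv_left)
qed

lemma rank_cases:
  assumes "n \<ge> 3"
  obtains h where "\<rho> = n * h" "\<rho> = start_rank n ((n - 1) * h)"
  | j where "\<rho> = top_rank n j" "\<not> n dvd \<rho>"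
proof (cases "n dvd \<rho>")
  case True
  then obtain h where "\<rho> = n * h" by blast
  then show ?thesis using that(1)[of h] rank_base(2)[OF assms, of 0 h] assms by simp
next
  case False
  define h where "h = \<rho> div n"
  have m: "\<rho> mod n \<noteq> 0" "\<rho> mod n < n" using False assms by (auto simp: dvd_eq_mod_eq_0)
  then have "\<rho> = n * h + Suc (\<rho> mod n - 1)" by (simp add: h_def)
  also have "\<dots> = top_rank n ((n - 1) * h + (\<rho> mod n - 1))"
    using assms m by (subst rank_base(1)) linarith+
  finally show ?thesis using that(2) False by blast
qed

text \<open>
  The signed multiplicities of the column sizes: \<open>\<bar>g p\<bar>\<close> columns have exactly \<open>p\<close> added blocks. A sign
  is possible only for $p = nh$ where \<open>h\<close> is a split floor; the sizes not divisible by \<open>n\<close> are those of the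
  full columns, which occur at most once in a proper wall.
\<close>

definition multiplicities :: "nat \<Rightarrow> nat \<Rightarrow> (nat \<Rightarrow> int) set" where
  "multiplicities n t = {g. g 0 = 0 \<and> finite {p. g p \<noteq> 0} \<and>
     (\<forall>p. \<not> n dvd p \<longrightarrow> g p \<in> {0, 1}) \<and> (\<forall>h. \<not> split_floor n t h \<longrightarrow> 0 \<le> g (n * h))}"

definition parts_from :: "(nat \<Rightarrow> int) \<Rightarrow> nat \<Rightarrow> nat" where
  "parts_from g \<rho> = (\<Sum>p | \<rho> \<le> p \<and> g p \<noteq> 0. nat \<bar>g p\<bar>)"

lemma parts_from_rec:
  assumes "finite {p. g p \<noteq> 0}"
  shows "parts_from g \<rho> = nat \<bar>g \<rho>\<bar> + parts_from g (Suc \<rho>)"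
proof (cases "g \<rho> = 0")
  case True
  then have "{p. \<rho> \<le> p \<and> g p \<noteq> 0} = {p. Suc \<rho> \<le> p \<and> g p \<noteq> 0}"
    by (auto simp: Suc_le_eq le_less)
  then show ?thesis using True by (simp add: parts_from_def)
next
  case False
  then have "{p. \<rho> \<le> p \<and> g p \<noteq> 0} = insert \<rho> {p. Suc \<rho> \<le> p \<and> g p \<noteq> 0}"
    by (auto simp: Suc_le_eq le_less)
  moreover have "finite {p. Suc \<rho> \<le> p \<and> g p \<noteq> 0}" using assms by (rule rev_finite_subset) auto
  ultimately show ?thesis by (simp add: parts_from_def)
qed

lemma parts_from_antimono:
  assumes "finite {p. g p \<noteq> 0}" "\<rho> \<le> \<sigma>"
  shows "parts_from g \<sigma> \<le> parts_from g \<rho>"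
  using assms(2)
proof (induction rule: dec_induct)
  case (step \<sigma>)
  then show ?case using parts_from_rec[OF assms(1), of \<sigma>] by simp
qed simp

lemma parts_from_bound:
  assumes "finite {p. g p \<noteq> 0}"
  obtains M where "\<And>p. p \<ge> M \<Longrightarrow> g p = 0" "\<And>\<rho>. \<rho> \<ge> M \<Longrightarrow> parts_from g \<rho> = 0"
proof -
  obtain M where M: "\<And>p. g p \<noteq> 0 \<Longrightarrow> p < M"
    using assms unfolding finite_nat_set_iff_bounded by blast
  have "g p = 0" if "p \<ge> M" for p using that M[of p] by auto
  moreover from this have "parts_from g \<rho> = 0" if "\<rho> \<ge> M" for \<rho>
  proof -
    have "{p. \<rho> \<le> p \<and> g p \<noteq> 0} = {}" using that \<open>\<And>p. p \<ge> M \<Longrightarrow> g p = 0\<close> by auto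
    then show ?thesis by (simp add: parts_from_def)
  qed
  ultimately show ?thesis using that by blast
qed

text \<open>
  Columns are ordered by decreasing size, so column \<open>k\<close> has at least \<open>\<rho>\<close> added blocks if and only if \<open>k\<close> is at most
  the number of parts that are at least \<open>\<rho>\<close>.
\<close>

definition reached :: "(nat \<Rightarrow> int) \<Rightarrow> nat \<Rightarrow> nat \<Rightarrow> bool" where
  "reached g k \<rho> \<longleftrightarrow> \<rho> = 0 \<or> k \<le> parts_from g \<rho>"

text \<open>
  Which block of a double floor is laid first. On a split floor above the ground this depends on the
  column group that ends there. A positive sign of \<open>g (n * h)\<close> does not stand for the place A itself: it says
  that the top block in the first column of the group has color 1, up to a sign common to the whole wall.
  That column has the number \<open>parts_from g (Suc (n * h)) + 1\<close>, and the color of A alternates with the column;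
  hence the power of $-1$. With this convention the weight of a wall depends on each sign locally, and not on
  how many columns are larger.
\<close>

definition first_place :: "nat \<Rightarrow> nat \<Rightarrow> (nat \<Rightarrow> int) \<Rightarrow> nat \<Rightarrow> place" where
  "first_place n t g h =
     (if \<not> split_floor n t h then Lower
      else if h = 0 \<or> 0 < g (n * h) * (-1) ^ parts_from g (Suc (n * h)) then PosA else PosB)"

definition wall_of :: "nat \<Rightarrow> nat \<Rightarrow> (nat \<Rightarrow> int) \<Rightarrow> block set" where
  "wall_of n t g = {(k, j, q). k \<ge> 1 \<and> q \<in> places (floor_at n t j) \<and>
     (reached g k (top_rank n j) \<or>
      (n - 1 dvd j \<and> q = first_place n t g (j div (n - 1)) \<and> reached g k (start_rank n j)))}"

lemma reached_antimono:
  assumes "finite {p. g p \<noteq> 0}" "\<rho> \<le> \<sigma>" "reached g k \<sigma>"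
  shows "reached g k \<rho>"
  using assms(3) parts_from_antimono[OF assms(1,2)] assms(2) unfolding reached_def by auto

lemma first_place_in_places:
  assumes "n \<ge> 3" "n - 1 dvd j"
  shows "first_place n t g (j div (n - 1)) \<in> places (floor_at n t j)"
proof -
  have "j = (n - 1) * (j div (n - 1)) + 0" using assms by simp
  then show ?thesis using floor_at_base[of n 0 t "j div (n - 1)"] assms
    by (auto simp: first_place_def)
qed

lemma places_double_floor:
  assumes "n \<ge> 3" "n - 1 dvd j"
  shows "places (floor_at n t j) = (if split_floor n t (j div (n - 1)) then {PosA, PosB} else {Lower, Upper})"
proof -
  have "j = (n - 1) * (j div (n - 1)) + 0" using assms by simp
  then show ?thesis using floor_at_base[of n 0 t "j div (n - 1)"] assms by auto
qed

lemma places_cube_floor: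
  assumes "n \<ge> 3" "\<not> n - 1 dvd j"
  shows "places (floor_at n t j) = {Whole}"
proof -
  obtain h i where j: "j = (n - 1) * h + i" "i < n - 1" using floor_cases[OF assms(1)] .
  moreover have "i \<noteq> 0" using assms(2) j by (intro notI) simp
  ultimately show ?thesis using floor_at_base[of n i t h] assms by auto
qed

lemma places_nonempty: "places (floor_at n t j) \<noteq> {}"
  by (cases "floor_at n t j") auto

lemma wall_of_started:
  assumes "n \<ge> 3" "finite {p. g p \<noteq> 0}" "k \<ge> 1"
  shows "(\<exists>q. (k, j, q) \<in> wall_of n t g) \<longleftrightarrow> reached g k (start_rank n j)"
proof
  assume "\<exists>q. (k, j, q) \<in> wall_of n t g"
  then show "reached g k (start_rank n j)"
    using reached_antimono[OF assms(2) start_le_top] by (auto simp: wall_of_def)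
next
  assume r: "reached g k (start_rank n j)"
  show "\<exists>q. (k, j, q) \<in> wall_of n t g"
  proof (cases "n - 1 dvd j")
    case True
    then have "(k, j, first_place n t g (j div (n - 1))) \<in> wall_of n t g"
      using r assms first_place_in_places[of n j t g] by (auto simp: wall_of_def)
    then show ?thesis ..
  next
    case False
    then have "reached g k (top_rank n j)" using r by (simp add: start_rank_def)
    then show ?thesis using places_cube_floor[OF assms(1) False] assms(3)
      by (auto simp: wall_of_def)
  qed
qed

lemma wall_of_filled:
  assumes "n \<ge> 3" "finite {p. g p \<noteq> 0}" "k \<ge> 1"
  shows "floor_filled n t (wall_of n t g) k j \<longleftrightarrow> reached g k (top_rank n j)"
proof
  assume f: "floor_filled n t (wall_of n t g) k j"
  show "reached g k (top_rank n j)"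
  proof (cases "n - 1 dvd j")
    case True
    obtain q where "q \<in> places (floor_at n t j)" "q \<noteq> first_place n t g (j div (n - 1))"
      using places_double_floor[OF assms(1) True, of t]
      by (cases "split_floor n t (j div (n - 1))"; cases "first_place n t g (j div (n - 1)) = PosA")
         (auto simp: first_place_def split: if_splits)
    then show ?thesis using f by (auto simp: floor_filled_def wall_of_def)
  next
    case False
    then show ?thesis using f places_cube_floor[OF assms(1) False, of t]
      by (auto simp: floor_filled_def wall_of_def)
  qed
next
  assume "reached g k (top_rank n j)"
  then show "floor_filled n t (wall_of n t g) k j"
    using assms(3) by (auto simp: floor_filled_def wall_of_def)
qed

section \<open>The walls so obtained are proper and distinct\<close>

lemma downset_nat_eq_lessThan:
  fixes S :: "nat set"
  assumes "finite S" "\<And>i j. j \<in> S \<Longrightarrow> i \<le> j \<Longrightarrow> i \<in> S"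
  shows "S = {..<card S}"
proof -
  define m where "m = (LEAST m. m \<notin> S)"
  have "\<exists>m. m \<notin> S" using assms(1) ex_new_if_finite infinite_UNIV_nat by blast
  then have m: "m \<notin> S" unfolding m_def by (rule LeastI_ex)
  have "S = {..<m}"
  proof (intro set_eqI iffI)
    fix i assume "i \<in> S"
    then show "i \<in> {..<m}" using m assms(2)[of i m] by (meson lessThan_iff not_le)
  next
    fix i assume "i \<in> {..<m}"
    then show "i \<in> S" unfolding m_def using not_less_Least by auto
  qed
  then show ?thesis by simp
qed

lemma mem_initial_segment_iff:
  fixes S :: "nat set"
  assumes "finite S" "0 \<notin> S" "\<And>k. 1 \<le> k \<Longrightarrow> Suc k \<in> S \<Longrightarrow> k \<in> S"
  shows "k \<in> S \<longleftrightarrow> 1 \<le> k \<and> k \<le> card S"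
proof -
  define S' where "S' = {i. Suc i \<in> S}"
  have S: "S = Suc ` S'"
  proof (intro set_eqI iffI)
    fix i assume "i \<in> S"
    then show "i \<in> Suc ` S'" using assms(2) by (cases i) (auto simp: S'_def)
  qed (auto simp: S'_def)
  have fin: "finite S'" using assms(1) unfolding S by (rule finite_imageD) simp
  have down: "i \<in> S'" if "j \<in> S'" "i \<le> j" for i j
    using that(2,1) by (induction rule: inc_induct) (auto simp: S'_def intro: assms(3))
  have "S' = {..<card S'}" using fin down by (rule downset_nat_eq_lessThan)
  moreover have "card S = card S'" unfolding S by (rule card_image) simp
  ultimately obtain m where "S' = {..<m}" "card S = m" by metis
  moreover have "k \<in> S \<longleftrightarrow> k \<in> Suc ` S'" using S by simp
  ultimately show ?thesis by (cases k) auto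
qed

lemma multiplicitiesD:
  assumes "g \<in> multiplicities n t"
  shows "g 0 = 0" "finite {p. g p \<noteq> 0}" "\<not> n dvd p \<Longrightarrow> g p = 0 \<or> g p = 1"
    "\<not> split_floor n t h \<Longrightarrow> 0 \<le> g (n * h)"
  using assms by (auto simp: multiplicities_def)

lemma wall_of_ground_mem:
  assumes "n \<ge> 3" "k \<ge> 1"
  shows "(k, 0, if t = n then Lower else PosA) \<in> wall_of n t g"
  using assms places_double_floor[of n 0 t]
  by (auto simp: wall_of_def first_place_def split_floor_def start_rank_0 reached_def)

lemma wall_of_young_wall:
  assumes n: "n \<ge> 3" and g: "g \<in> multiplicities n t"
  shows "young_wall n t (wall_of n t g)"
  unfolding young_wall_def
proof (intro conjI allI impI)
  note fin = multiplicitiesD(2)[OF g]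
  show "wall_of n t g \<subseteq> all_places n t"
    by (auto simp: wall_of_def all_places_def)
  show "ground_state n t \<subseteq> wall_of n t g"
    using wall_of_ground_mem[OF n, of _ t g] by (fastforce simp: ground_state_def)
  show "finite (wall_of n t g - ground_state n t)"
  proof -
    obtain M where M: "\<And>\<rho>. \<rho> \<ge> M \<Longrightarrow> parts_from g \<rho> = 0" using parts_from_bound[OF fin] by blast
    have "wall_of n t g - ground_state n t \<subseteq> {..parts_from g 1} \<times> {..M} \<times> {Whole, PosA, PosB, Lower, Upper}"
    proof
      fix b assume b: "b \<in> wall_of n t g - ground_state n t"
      obtain k j q where kjq: "b = (k, j, q)" by (cases b)
      have k: "k \<ge> 1" using b kjq by (auto simp: wall_of_def)
      obtain \<rho> where \<rho>: "\<rho> \<ge> 1" "j \<le> \<rho>" "reached g k \<rho>"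
      proof (cases "reached g k (top_rank n j)")
        case True
        then show ?thesis using that[of "top_rank n j"] by (simp add: top_rank_def)
      next
        case False
        then have q: "n - 1 dvd j" "q = first_place n t g (j div (n - 1))" "reached g k (start_rank n j)"
          using b kjq by (auto simp: wall_of_def)
        have "j \<noteq> 0"
        proof
          assume "j = 0"
          then show False using q b kjq k
            by (auto simp: ground_state_def first_place_def split_floor_def split: if_splits)
        qed
        then have "start_rank n j \<ge> 1" "j \<le> start_rank n j"
          by (auto simp: start_rank_def top_rank_def)
        then show ?thesis using that q by blast
      qed
      then have "k \<le> parts_from g \<rho>" by (auto simp: reached_def)
      moreover have "parts_from g \<rho> \<le> parts_from g 1" using \<rho>(1) by (rule parts_from_antimono[OF fin])
      moreover have "\<rho> < M"
      proof (rule ccontr)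
        assume "\<not> \<rho> < M"
        then show False using M[of \<rho>] k \<open>k \<le> parts_from g \<rho>\<close> by simp
      qed
      ultimately show "b \<in> {..parts_from g 1} \<times> {..M} \<times> {Whole, PosA, PosB, Lower, Upper}"
        using \<rho>(2) kjq by (cases q) auto
    qed
    then show ?thesis by (rule finite_subset) simp
  qed
  show "floor_filled n t (wall_of n t g) k j" if "(k, Suc j, p) \<in> wall_of n t g" for k j p
  proof -
    have k: "k \<ge> 1" using that by (auto simp: wall_of_def)
    have "reached g k (start_rank n (Suc j))" using that wall_of_started[OF n fin k] by blast
    then have "reached g k (top_rank n j)"
      unfolding start_rank_Suc[OF n] by (rule reached_antimono[OF fin, rotated]) simp
    then show ?thesis using wall_of_filled[OF n fin k] by blast
  qed
  show "(k, j, Lower) \<in> wall_of n t g" if "(k, j, Upper) \<in> wall_of n t g" for k j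
  proof -
    have mem: "Upper \<in> places (floor_at n t j)" and k: "k \<ge> 1" using that by (auto simp: wall_of_def)
    have "Upper \<noteq> first_place n t g h" for h by (auto simp: first_place_def)
    then have "reached g k (top_rank n j)" using that by (auto simp: wall_of_def)
    moreover have "Lower \<in> places (floor_at n t j)" using mem by (cases "floor_at n t j") auto
    ultimately show ?thesis using k by (auto simp: wall_of_def)
  qed
  show "(k, j, p) \<in> wall_of n t g" if "1 \<le> k" "(Suc k, j, p) \<in> wall_of n t g" for k j p
    using that by (auto simp: wall_of_def reached_def)
qed

text \<open>
  Two full columns of the same height have the same size, which is not divisible by \<open>n\<close> and would have
  multiplicity at least 2.
\<close>

lemma wall_of_proper:
  assumes n: "n \<ge> 3" and g: "g \<in> multiplicities n t"
  shows "wall_of n t g \<in> proper_young_walls n t"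
proof -
  note fin = multiplicitiesD(2)[OF g]
  define Y where "Y = wall_of n t g"
  obtain M where M: "\<And>\<rho>. \<rho> \<ge> M \<Longrightarrow> parts_from g \<rho> = 0" using parts_from_bound[OF fin] by blast
  have height: "{j. \<exists>q. (k, j, q) \<in> Y} = {..<column_height Y k}" "column_height Y k \<noteq> 0" if "k \<ge> 1" for k
  proof -
    have eq: "{j. \<exists>q. (k, j, q) \<in> Y} = {j. reached g k (start_rank n j)}"
      unfolding Y_def using wall_of_started[OF n fin that] by simp
    have "{j. reached g k (start_rank n j)} \<subseteq> {..M}"
    proof
      fix j assume j: "j \<in> {j. reached g k (start_rank n j)}"
      have "start_rank n j < Suc M"
      proof (rule ccontr)
        assume "\<not> start_rank n j < Suc M"
        then show False using M[of "start_rank n j"] j that by (auto simp: reached_def)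
      qed
      moreover have "j \<le> start_rank n j" by (simp add: start_rank_def top_rank_def)
      ultimately show "j \<in> {..M}" by simp
    qed
    then have f: "finite {j. reached g k (start_rank n j)}" by (rule finite_subset) simp
    show e: "{j. \<exists>q. (k, j, q) \<in> Y} = {..<column_height Y k}"
      unfolding column_height_def eq using f
    proof (rule downset_nat_eq_lessThan)
      fix i j assume "j \<in> {j. reached g k (start_rank n j)}" "i \<le> j"
      then show "i \<in> {j. reached g k (start_rank n j)}"
        using reached_antimono[OF fin] strict_mono_mono[OF strict_mono_start_rank[OF n]]
        by (auto dest: monoD)
    qed
    have "0 \<in> {j. reached g k (start_rank n j)}" by (simp add: start_rank_0 reached_def)
    then show "column_height Y k \<noteq> 0" using e unfolding eq by (metis lessThan_0 emptyE)
  qed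
  have full: "parts_from g (Suc (top_rank n (column_height Y k - 1))) < k \<and>
      k \<le> parts_from g (top_rank n (column_height Y k - 1))"
    if "k \<ge> 1" "full_column n t Y k" for k
  proof -
    define j where "j = column_height Y k - 1"
    have "\<not> (\<exists>q. (k, Suc j, q) \<in> Y)" using height[OF that(1)] by (auto simp: j_def)
    then have "\<not> reached g k (Suc (top_rank n j))"
      unfolding Y_def using wall_of_started[OF n fin that(1)] start_rank_Suc[OF n] by metis
    moreover have "reached g k (top_rank n j)"
      using that wall_of_filled[OF n fin that(1)] unfolding full_column_def Y_def j_def by blast
    ultimately show ?thesis by (simp add: reached_def j_def top_rank_def)
  qed
  have "column_height Y k \<noteq> column_height Y l"
    if "k \<ge> 1" "l \<ge> 1" "k \<noteq> l" "full_column n t Y k" "full_column n t Y l" for k l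
  proof
    assume eq: "column_height Y k = column_height Y l"
    define \<rho> where "\<rho> = top_rank n (column_height Y l - 1)"
    have "parts_from g (Suc \<rho>) < k" "k \<le> parts_from g \<rho>" "parts_from g (Suc \<rho>) < l" "l \<le> parts_from g \<rho>"
      using full[OF that(1,4)] full[OF that(2,5)] unfolding eq \<rho>_def by auto
    then have "nat \<bar>g \<rho>\<bar> \<ge> 2" using parts_from_rec[OF fin, of \<rho>] that(3) by linarith
    moreover have "g \<rho> = 0 \<or> g \<rho> = 1"
      using multiplicitiesD(3)[OF g] not_dvd_top_rank[OF n] unfolding \<rho>_def by blast
    ultimately show False by auto
  qed
  then show ?thesis
    using wall_of_young_wall[OF n g] unfolding proper_young_walls_def Y_def by blast
qed

text \<open>
  A wall determines how many of its columns reach each rank, hence the absolute values of the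
  multiplicities. The sign of a nonzero multiplicity is visible in the first column of its group.
\<close>

lemma inj_on_wall_of:
  assumes n: "n \<ge> 3"
  shows "inj_on (wall_of n t) (multiplicities n t)"
proof (rule inj_onI)
  fix g g' assume g: "g \<in> multiplicities n t" and g': "g' \<in> multiplicities n t"
    and eq: "wall_of n t g = wall_of n t g'"
  note fin = multiplicitiesD(2)[OF g] and fin' = multiplicitiesD(2)[OF g']
  have reached: "reached g k \<rho> \<longleftrightarrow> reached g' k \<rho>" if "k \<ge> 1" for k \<rho>
    using rank_cases[OF n, of \<rho>]
  proof cases
    case (1 h)
    show ?thesis
      unfolding 1(2) wall_of_started[OF n fin that, where t = t, symmetric] wall_of_started[OF n fin' that, where t = t, symmetric] eq ..
  next
    case (2 j)
    show ?thesis
      unfolding 2(1) wall_of_filled[OF n fin that, where t = t, symmetric] wall_of_filled[OF n fin' that, where t = t, symmetric] eq ..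
  qed
  have parts: "parts_from g \<rho> = parts_from g' \<rho>" if "\<rho> \<ge> 1" for \<rho>
  proof (rule antisym)
    show "parts_from g \<rho> \<le> parts_from g' \<rho>"
      using reached[of "parts_from g \<rho>" \<rho>] that by (cases "parts_from g \<rho> = 0") (auto simp: reached_def)
    show "parts_from g' \<rho> \<le> parts_from g \<rho>"
      using reached[of "parts_from g' \<rho>" \<rho>] that by (cases "parts_from g' \<rho> = 0") (auto simp: reached_def)
  qed
  have abs: "\<bar>g p\<bar> = \<bar>g' p\<bar>" if "p \<ge> 1" for p
    using parts_from_rec[OF fin, of p] parts_from_rec[OF fin', of p] parts[of p] parts[of "Suc p"] that by linarith
  show "g = g'"
  proof
    fix p
    show "g p = g' p"
    proof (rule ccontr)
      assume neq: "g p \<noteq> g' p"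
      then have "p \<noteq> 0" using multiplicitiesD(1)[OF g] multiplicitiesD(1)[OF g'] by metis
      then have a: "\<bar>g p\<bar> = \<bar>g' p\<bar>" using abs[of p] by simp
      then have opp: "g' p = - g p" "g p \<noteq> 0" using neq by auto
      have "n dvd p" using multiplicitiesD(3)[OF g, of p] multiplicitiesD(3)[OF g', of p] opp by auto
      then obtain h where h: "p = n * h" by blast
      have split: "split_floor n t h"
        using multiplicitiesD(4)[OF g, of h] multiplicitiesD(4)[OF g', of h] opp h by fastforce
      have "h \<noteq> 0" using \<open>p \<noteq> 0\<close> h by auto
      define T where "T = parts_from g (Suc p)"
      have T': "parts_from g' (Suc p) = T" using parts[of "Suc p"] by (simp add: T_def)
      define k where "k = Suc T"
      define j where "j = (n - 1) * h"
      have j: "n - 1 dvd j" "j div (n - 1) = h" using n by (auto simp: j_def)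
      have rk: "start_rank n j = p" "top_rank n j = Suc p"
        using rank_base[OF n, of 0 h] n by (auto simp: j_def h)
      have started: "reached g k p"
        using parts_from_rec[OF fin, of p] opp(2) by (auto simp: reached_def k_def T_def)
      have "\<not> reached g k (Suc p)" by (simp add: reached_def k_def T_def)
      then have "\<not> reached g' k (Suc p)" using reached[of k "Suc p"] by (simp add: k_def)
      have "(k, j, first_place n t g h) \<in> wall_of n t g"
        using started first_place_in_places[OF n j(1), of t g] j rk by (auto simp: wall_of_def k_def)
      then have "(k, j, first_place n t g h) \<in> wall_of n t g'" using eq by simp
      then have "first_place n t g h = first_place n t g' h"
        using \<open>\<not> reached g' k (Suc p)\<close> j rk by (auto simp: wall_of_def)
      then have "0 < g p * (-1) ^ T \<longleftrightarrow> 0 < g' p * (-1) ^ T"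
        using split \<open>h \<noteq> 0\<close> T' by (auto simp: first_place_def h[symmetric] T_def split: if_splits)
      then show False using opp by (cases "even T") auto
    qed
  qed
qed

section \<open>Every proper wall is obtained\<close>

text \<open>
  The counterpart of \<open>reached\<close> for a given wall. Every rank is the top rank of a unique floor or the
  start rank of a unique double floor.
\<close>

definition column_reaches :: "nat \<Rightarrow> nat \<Rightarrow> block set \<Rightarrow> nat \<Rightarrow> nat \<Rightarrow> bool" where
  "column_reaches n t Y k \<rho> \<longleftrightarrow>
     (\<exists>j. \<rho> = top_rank n j \<and> floor_filled n t Y k j) \<or>
     (\<exists>j. n - 1 dvd j \<and> \<rho> = start_rank n j \<and> (\<exists>q. (k, j, q) \<in> Y))"

lemma top_rank_inject: "n \<ge> 3 \<Longrightarrow> top_rank n i = top_rank n j \<longleftrightarrow> i = j"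
  using strict_mono_eq[OF strict_mono_start_rank, of n "Suc i" "Suc j"] by (simp add: start_rank_Suc)

lemma dvd_start_rank:
  assumes "n \<ge> 3" "n - 1 dvd j"
  shows "start_rank n j = n * (j div (n - 1))"
proof -
  have "j = (n - 1) * (j div (n - 1)) + 0" using assms by simp
  then show ?thesis using rank_base(2)[OF assms(1), of 0 "j div (n - 1)"] assms by simp
qed

lemma column_reaches_top:
  assumes "n \<ge> 3"
  shows "column_reaches n t Y k (top_rank n j) \<longleftrightarrow> floor_filled n t Y k j"
  unfolding column_reaches_def
  using top_rank_inject[OF assms] not_dvd_top_rank[OF assms, of j] dvd_start_rank[OF assms] by auto

lemma column_reaches_start:
  assumes "n \<ge> 3" "Y \<subseteq> all_places n t"
  shows "column_reaches n t Y k (start_rank n j) \<longleftrightarrow> (\<exists>q. (k, j, q) \<in> Y)"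
proof (cases "n - 1 dvd j")
  case True
  have "i = j" if "start_rank n i = start_rank n j" for i
    using that strict_mono_eq[OF strict_mono_start_rank[OF assms(1)]] by simp
  moreover have "start_rank n j \<noteq> top_rank n i" for i
    using not_dvd_top_rank[OF assms(1), of i] dvd_start_rank[OF assms(1) True] by (metis dvd_triv_left)
  ultimately show ?thesis using True unfolding column_reaches_def by metis
next
  case False
  then have "column_reaches n t Y k (start_rank n j) \<longleftrightarrow> floor_filled n t Y k j"
    using column_reaches_top[OF assms(1)] by (simp add: start_rank_def)
  also have "\<dots> \<longleftrightarrow> (\<exists>q. (k, j, q) \<in> Y)"
    using assms(2) places_cube_floor[OF assms(1) False] by (auto simp: floor_filled_def all_places_def)
  finally show ?thesis .
qed

text \<open>
  In this locale the signed multiplicities of a proper wall \<open>Y\<close> are recovered: \<open>T \<rho>\<close> is the number of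
  columns that reach rank \<open>\<rho>\<close>.
\<close>

locale proper_wall =
  fixes n t :: nat and Y :: "block set"
  assumes n: "n \<ge> 3" and Y: "Y \<in> proper_young_walls n t"
begin

lemma wall:
  "Y \<subseteq> all_places n t" "ground_state n t \<subseteq> Y" "finite (Y - ground_state n t)"
  "(k, Suc j, q) \<in> Y \<Longrightarrow> floor_filled n t Y k j"
  "(k, j, Upper) \<in> Y \<Longrightarrow> (k, j, Lower) \<in> Y"
  "k \<ge> 1 \<Longrightarrow> (Suc k, j, q) \<in> Y \<Longrightarrow> (k, j, q) \<in> Y"
  using Y unfolding proper_young_walls_def young_wall_def by blast+

abbreviation "R \<equiv> column_reaches n t Y"

lemma R_top: "R k (top_rank n j) \<longleftrightarrow> floor_filled n t Y k j"
  by (rule column_reaches_top[OF n])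

lemma R_start: "R k (start_rank n j) \<longleftrightarrow> (\<exists>q. (k, j, q) \<in> Y)"
  by (rule column_reaches_start[OF n wall(1)])

lemma R_Suc_rank: "R k (Suc \<rho>) \<Longrightarrow> R k \<rho>"
  using rank_cases[OF n, of \<rho>]
proof cases
  case (2 j)
  assume "R k (Suc \<rho>)"
  then have "R k (start_rank n (Suc j))" using 2 start_rank_Suc[OF n] by simp
  then show ?thesis using wall(4) R_start R_top 2 by blast
next
  case (1 h)
  assume r: "R k (Suc \<rho>)"
  have "Suc \<rho> = top_rank n ((n - 1) * h)"
    using rank_base(1)[OF n, of 0 h] n 1 by simp
  then have "floor_filled n t Y k ((n - 1) * h)" using r R_top by simp
  then have "\<exists>q. (k, (n - 1) * h, q) \<in> Y"
    using places_nonempty[of n t "(n - 1) * h"] by (auto simp: floor_filled_def)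
  then show ?thesis by (simp only: 1(2) R_start)
qed

lemma R_antimono: "\<rho> \<le> \<sigma> \<Longrightarrow> R k \<sigma> \<Longrightarrow> R k \<rho>"
  by (induction rule: inc_induct) (auto intro: R_Suc_rank)

lemma R_Suc_column: "k \<ge> 1 \<Longrightarrow> R (Suc k) \<rho> \<Longrightarrow> R k \<rho>"
  using wall(6) unfolding column_reaches_def floor_filled_def by blast

lemma R_0: "k \<ge> 1 \<Longrightarrow> R k 0"
  using wall(2) R_start[of k 0] by (auto simp: start_rank_0 ground_state_def)

lemma R_column_pos: "R k \<rho> \<Longrightarrow> k \<ge> 1"
proof -
  assume "R k \<rho>"
  moreover have "\<exists>q. (k, j, q) \<in> Y" if "floor_filled n t Y k j" for j
    using that places_nonempty[of n t j] by (auto simp: floor_filled_def)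
  ultimately have "\<exists>j q. (k, j, q) \<in> Y" unfolding column_reaches_def by blast
  then show "k \<ge> 1" using wall(1) by (auto simp: all_places_def)
qed

lemma R_added_block:
  assumes "R k \<rho>" "\<rho> \<ge> 1"
  shows "\<exists>j q. (k, j, q) \<in> Y - ground_state n t"
proof -
  have "R k (top_rank n 0)" using assms R_antimono[of 1 \<rho> k] by (simp add: top_rank_def)
  then have "floor_filled n t Y k 0" by (simp add: R_top)
  then have "(k, 0, if t = n then Upper else PosB) \<in> Y"
    using places_double_floor[OF n, of 0 t] by (auto simp: floor_filled_def split_floor_def)
  then show ?thesis by (auto simp: ground_state_def split: if_splits)
qed

definition T :: "nat \<Rightarrow> nat" where
  "T \<rho> = card {k. R k \<rho>}"

lemma R_iff: "\<rho> \<ge> 1 \<Longrightarrow> R k \<rho> \<longleftrightarrow> 1 \<le> k \<and> k \<le> T \<rho>"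
proof -
  assume \<rho>: "\<rho> \<ge> 1"
  have "{k. R k \<rho>} \<subseteq> fst ` (Y - ground_state n t)"
    using R_added_block[OF _ \<rho>] by force
  then have fin: "finite {k. R k \<rho>}" using wall(3) finite_subset by blast
  have "k \<in> {k. R k \<rho>} \<longleftrightarrow> 1 \<le> k \<and> k \<le> card {k. R k \<rho>}"
    using fin by (rule mem_initial_segment_iff) (auto dest: R_column_pos intro: R_Suc_column)
  then show ?thesis by (simp add: T_def)
qed

lemma T_antimono: "\<rho> \<ge> 1 \<Longrightarrow> T (Suc \<rho>) \<le> T \<rho>"
  using R_iff[of "Suc \<rho>" "T (Suc \<rho>)"] R_iff[of \<rho> "T (Suc \<rho>)"] R_Suc_rank[of "T (Suc \<rho>)" \<rho>]
  by (cases "T (Suc \<rho>) = 0") auto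

lemma T_bound: obtains M where "M \<ge> 1" "\<And>\<rho>. \<rho> \<ge> M \<Longrightarrow> T \<rho> = 0"
proof -
  have "finite ((\<lambda>(k, j, q). j) ` (Y - ground_state n t))" using wall(3) by (rule finite_imageI)
  then obtain J where J: "(\<lambda>(k, j, q). j) ` (Y - ground_state n t) \<subseteq> {..J}"
    by (meson finite_nat_iff_bounded_le)
  have none: "\<not> R k (start_rank n (Suc J))" for k
  proof
    assume "R k (start_rank n (Suc J))"
    then obtain q where "(k, Suc J, q) \<in> Y" using R_start by blast
    then have "(k, Suc J, q) \<in> Y - ground_state n t" by (auto simp: ground_state_def)
    then show False using J by force
  qed
  have "T \<rho> = 0" if "\<rho> \<ge> start_rank n (Suc J)" for \<rho>
  proof -
    have "{k. R k \<rho>} = {}" using none R_antimono[OF that] by blast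
    then show ?thesis by (simp add: T_def)
  qed
  moreover have "start_rank n (Suc J) \<ge> 1" by (simp add: start_rank_Suc[OF n] top_rank_def)
  ultimately show ?thesis using that by blast
qed

definition group_sign :: "nat \<Rightarrow> int" where
  "group_sign \<rho> =
     (if n dvd \<rho> \<and> split_floor n t (\<rho> div n) then
        (if (Suc (T (Suc \<rho>)), (n - 1) * (\<rho> div n), PosA) \<in> Y then 1 else - 1) * (-1) ^ T (Suc \<rho>)
      else 1)"

definition signed_mult :: "nat \<Rightarrow> int" where
  "signed_mult \<rho> = (if \<rho> = 0 then 0 else group_sign \<rho> * int (T \<rho> - T (Suc \<rho>)))"

lemma abs_signed_mult: "\<rho> \<ge> 1 \<Longrightarrow> nat \<bar>signed_mult \<rho>\<bar> = T \<rho> - T (Suc \<rho>)"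
  by (auto simp: signed_mult_def group_sign_def abs_mult power_abs)

lemma finite_signed_mult: "finite {p. signed_mult p \<noteq> 0}"
proof -
  obtain M where M: "\<And>\<rho>. \<rho> \<ge> M \<Longrightarrow> T \<rho> = 0" using T_bound by blast
  have "{p. signed_mult p \<noteq> 0} \<subseteq> {..<M}"
  proof
    fix p assume "p \<in> {p. signed_mult p \<noteq> 0}"
    moreover have "signed_mult p = 0" if "T p = 0" using that by (simp add: signed_mult_def)
    ultimately have "T p \<noteq> 0" by auto
    then show "p \<in> {..<M}" using M[of p] by (meson lessThan_iff not_le)
  qed
  then show ?thesis by (rule finite_subset) simp
qed

lemma parts_from_signed_mult: "\<rho> \<ge> 1 \<Longrightarrow> parts_from signed_mult \<rho> = T \<rho>"
proof -
  assume \<rho>: "\<rho> \<ge> 1"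
  obtain M where M: "M \<ge> 1" "\<And>\<rho>. \<rho> \<ge> M \<Longrightarrow> T \<rho> = 0" using T_bound by blast
  have top: "parts_from signed_mult \<sigma> = T \<sigma>" if "\<sigma> \<ge> M" for \<sigma>
  proof -
    have "signed_mult p = 0" if "p \<ge> \<sigma>" for p using that \<open>\<sigma> \<ge> M\<close> M(2)[of p] by (simp add: signed_mult_def)
    then have "{p. \<sigma> \<le> p \<and> signed_mult p \<noteq> 0} = {}" by auto
    then show ?thesis using M(2)[OF that] by (simp add: parts_from_def)
  qed
  show ?thesis
  proof (cases "\<rho> \<ge> M")
    case False
    then have "\<rho> \<le> M" by simp
    then show ?thesis using \<rho>
    proof (induction rule: inc_induct)
      case base
      show ?case by (rule top) simp
    next
      case (step m)
      then have "parts_from signed_mult m = nat \<bar>signed_mult m\<bar> + T (Suc m)"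
        using parts_from_rec[OF finite_signed_mult, of m] by simp
      then show ?case using abs_signed_mult[of m] T_antimono[of m] step by simp
    qed
  qed (rule top)
qed

lemma reached_signed_mult: "k \<ge> 1 \<Longrightarrow> reached signed_mult k \<rho> \<longleftrightarrow> R k \<rho>"
  using R_0[of k] R_iff[of \<rho> k] parts_from_signed_mult[of \<rho>] by (cases "\<rho> = 0") (auto simp: reached_def)

text \<open>
  Two columns with the same size not divisible by \<open>n\<close> would be full and of the same height.
\<close>

lemma T_diff_le_1:
  assumes "\<not> n dvd \<rho>"
  shows "T \<rho> - T (Suc \<rho>) \<le> 1"
proof (rule ccontr)
  assume big: "\<not> T \<rho> - T (Suc \<rho>) \<le> 1"
  have "\<rho> \<ge> 1" using assms by (cases \<rho>) auto
  obtain j where j: "\<rho> = top_rank n j" using rank_cases[OF n, of \<rho>] assms by (metis dvd_triv_left)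
  have full: "column_height Y k = Suc j \<and> full_column n t Y k"
    if "T (Suc \<rho>) < k" "k \<le> T \<rho>" for k
  proof -
    have r: "R k \<rho>" "\<not> R k (Suc \<rho>)" using that R_iff[of \<rho> k] R_iff[of "Suc \<rho>" k] \<open>\<rho> \<ge> 1\<close> by auto
    have "R k (start_rank n i) \<longleftrightarrow> i \<le> j" for i
    proof
      assume "i \<le> j"
      then have "start_rank n i \<le> \<rho>"
        using strict_mono_mono[OF strict_mono_start_rank[OF n]] start_le_top[of n j] unfolding j
        by (meson le_trans monoD)
      then show "R k (start_rank n i)" using r(1) R_antimono by blast
    next
      assume ri: "R k (start_rank n i)"
      show "i \<le> j"
      proof (rule ccontr)
        assume "\<not> i \<le> j"
        then have "Suc \<rho> \<le> start_rank n i"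
          using strict_mono_mono[OF strict_mono_start_rank[OF n]] unfolding j start_rank_Suc[OF n, symmetric]
          by (meson not_less_eq_eq monoD)
        then show False using r(2) ri R_antimono by blast
      qed
    qed
    then have "{i. \<exists>q. (k, i, q) \<in> Y} = {..j}" using R_start by auto
    then have "column_height Y k = Suc j" by (simp add: column_height_def)
    then show ?thesis using r(1) R_top by (simp add: full_column_def j)
  qed
  define k where "k = Suc (T (Suc \<rho>))"
  have "T (Suc \<rho>) < k" "k \<le> T \<rho>" "T (Suc \<rho>) < Suc k" "Suc k \<le> T \<rho>" "k \<ge> 1"
    using big by (auto simp: k_def)
  then have "column_height Y k = column_height Y (Suc k)" "full_column n t Y k" "full_column n t Y (Suc k)"
    using full by auto
  moreover have "\<forall>k\<ge>1. \<forall>l\<ge>1. k \<noteq> l \<longrightarrow> full_column n t Y k \<longrightarrow> full_column n t Y l \<longrightarrow>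
      column_height Y k \<noteq> column_height Y l"
    using Y by (simp add: proper_young_walls_def)
  ultimately show False using \<open>k \<ge> 1\<close> by (metis le_SucI n_not_Suc_n)
qed

lemma signed_mult_mem: "signed_mult \<in> multiplicities n t"
  unfolding multiplicities_def
proof (intro CollectI conjI allI impI)
  show "signed_mult 0 = 0" by (simp add: signed_mult_def)
  show "finite {p. signed_mult p \<noteq> 0}" by (rule finite_signed_mult)
  show "signed_mult p \<in> {0, 1}" if "\<not> n dvd p" for p
    using T_diff_le_1[OF that] that by (auto simp: signed_mult_def group_sign_def)
  show "0 \<le> signed_mult (n * h)" if "\<not> split_floor n t h" for h
    using that n by (auto simp: signed_mult_def group_sign_def)
qed

text \<open>
  The one block on an unfilled top floor is forced by the sign. All columns of a group carry it in the same
  place, since a place occupied in a column is occupied in all columns to the right; so it is enough to look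
  at the first column of the group, from which the sign was read off.
\<close>

lemma unfilled_place:
  assumes "k \<ge> 1" "(k, (n - 1) * h, q) \<in> Y" "\<not> floor_filled n t Y k ((n - 1) * h)"
  shows "q = first_place n t signed_mult h"
proof -
  define j where "j = (n - 1) * h"
  have j: "n - 1 dvd j" "j div (n - 1) = h" using n by (auto simp: j_def)
  have rk: "start_rank n j = n * h" "top_rank n j = Suc (n * h)"
    using rank_base[OF n, of 0 h] n by (auto simp: j_def)
  note assms = assms[folded j_def]
  have mem: "q \<in> places (floor_at n t j)" using assms(2) wall(1) by (auto simp: all_places_def)
  show ?thesis
  proof (cases "split_floor n t h")
    case False
    then have pl: "places (floor_at n t j) = {Lower, Upper}" using places_double_floor[OF n j(1), of t] j by simp
    have "q \<noteq> Upper" using assms(2,3) wall(5) pl by (auto simp: floor_filled_def)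
    then show ?thesis using mem pl False by (auto simp: first_place_def)
  next
    case True
    then have pl: "places (floor_at n t j) = {PosA, PosB}" using places_double_floor[OF n j(1), of t] j by simp
    show ?thesis
    proof (cases "h = 0")
      case True
      then have "t \<noteq> n" using \<open>split_floor n t h\<close> by (simp add: split_floor_def)
      then have "(k, j, PosA) \<in> Y" using wall(2) assms(1) True by (auto simp: ground_state_def j_def)
      then have "q = PosA" using assms(2,3) mem pl by (auto simp: floor_filled_def)
      then show ?thesis using \<open>split_floor n t h\<close> True by (simp add: first_place_def)
    next
      case False
      define \<rho> where "\<rho> = n * h"
      have \<rho>: "\<rho> \<ge> 1" using False n by (simp add: \<rho>_def)
      define k1 where "k1 = Suc (T (Suc \<rho>))"
      have "R k \<rho>" using assms(2) R_start[of k j] rk by (auto simp: \<rho>_def)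
      then have kT: "k \<le> T \<rho>" using R_iff[OF \<rho>] by simp
      have "\<not> R k (Suc \<rho>)" using assms(3) R_top[of k j] rk by (simp add: \<rho>_def)
      then have k1: "k1 \<le> k" using R_iff[of "Suc \<rho>" k] assms(1) by (auto simp: k1_def)
      have "(k1, j, q) \<in> Y"
        using k1 assms(2)
      proof (induction rule: inc_induct)
        case (step m)
        then show ?case using wall(6)[of m j q] by (simp add: k1_def)
      qed
      moreover have "\<not> floor_filled n t Y k1 j"
        using R_top[of k1 j] R_iff[of "Suc \<rho>" k1] rk by (simp add: k1_def \<rho>_def)
      ultimately have q: "q = PosA \<longleftrightarrow> (k1, j, PosA) \<in> Y"
        using mem pl by (auto simp: floor_filled_def)
      have "T (Suc \<rho>) < T \<rho>" using kT k1 by (simp add: k1_def)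
      have "group_sign \<rho> = (if q = PosA then 1 else - 1) * (-1) ^ T (Suc \<rho>)"
        using q True n by (simp add: group_sign_def \<rho>_def k1_def j_def)
      then have "signed_mult \<rho> * (-1) ^ parts_from signed_mult (Suc \<rho>) = (if q = PosA then 1 else - 1) * int (T \<rho> - T (Suc \<rho>))"
        using \<rho> parts_from_signed_mult[of "Suc \<rho>"] by (cases "even (T (Suc \<rho>))") (auto simp: signed_mult_def)
      then have "0 < signed_mult \<rho> * (-1) ^ parts_from signed_mult (Suc \<rho>) \<longleftrightarrow> q = PosA"
        using \<open>T (Suc \<rho>) < T \<rho>\<close> by auto
      then show ?thesis using mem pl True False by (auto simp: first_place_def \<rho>_def)
    qed
  qed
qed

lemma wall_of_signed_mult: "wall_of n t signed_mult = Y"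
proof (intro set_eqI iffI)
  fix b assume b: "b \<in> wall_of n t signed_mult"
  obtain k j q where kjq: "b = (k, j, q)" by (cases b)
  have k: "k \<ge> 1" and q: "q \<in> places (floor_at n t j)" using b kjq by (auto simp: wall_of_def)
  show "b \<in> Y"
  proof (cases "floor_filled n t Y k j")
    case True
    then show ?thesis using q kjq by (auto simp: floor_filled_def)
  next
    case False
    then have f: "n - 1 dvd j" "q = first_place n t signed_mult (j div (n - 1))" "R k (start_rank n j)"
      using b kjq reached_signed_mult[OF k] R_top by (auto simp: wall_of_def)
    then obtain q' where q': "(k, j, q') \<in> Y" using R_start by blast
    have "j = (n - 1) * (j div (n - 1))" using f by simp
    then have "q' = first_place n t signed_mult (j div (n - 1))"
      using unfilled_place[OF k, of "j div (n - 1)" q'] q' False by simp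
    then show ?thesis using f q' kjq by simp
  qed
next
  fix b assume b: "b \<in> Y"
  obtain k j q where kjq: "b = (k, j, q)" by (cases b)
  have k: "k \<ge> 1" and q: "q \<in> places (floor_at n t j)" using b kjq wall(1) by (auto simp: all_places_def)
  show "b \<in> wall_of n t signed_mult"
  proof (cases "floor_filled n t Y k j")
    case True
    then show ?thesis using k q kjq reached_signed_mult[OF k] R_top by (auto simp: wall_of_def)
  next
    case False
    have dbl: "n - 1 dvd j"
    proof (rule ccontr)
      assume "\<not> n - 1 dvd j"
      then show False using False b kjq q places_cube_floor[OF n, of j t] by (auto simp: floor_filled_def)
    qed
    then have "j = (n - 1) * (j div (n - 1))" by simp
    then have "q = first_place n t signed_mult (j div (n - 1))"
      using unfilled_place[OF k, of "j div (n - 1)" q] b kjq False by simp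
    moreover have "reached signed_mult k (start_rank n j)" using b kjq R_start reached_signed_mult[OF k] by blast
    ultimately show ?thesis using k q kjq dbl by (auto simp: wall_of_def)
  qed
qed

end

lemma bij_betw_wall_of:
  assumes "n \<ge> 3"
  shows "bij_betw (wall_of n t) (multiplicities n t) (proper_young_walls n t)"
  unfolding bij_betw_def
proof (intro conjI antisym subsetI)
  show "inj_on (wall_of n t) (multiplicities n t)" by (rule inj_on_wall_of[OF assms])
  show "Y \<in> proper_young_walls n t" if "Y \<in> wall_of n t ` multiplicities n t" for Y
    using that wall_of_proper[OF assms] by auto
  show "Y \<in> wall_of n t ` multiplicities n t" if "Y \<in> proper_young_walls n t" for Y
  proof -
    interpret proper_wall n t Y using assms that by unfold_locales
    show ?thesis using signed_mult_mem wall_of_signed_mult by (metis imageI)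
  qed
qed

section \<open>Colors of the added blocks\<close>

text \<open>
  The color of the block laid as the \<open>\<rho>\<close>-th added one, where 0 and 1 are not distinguished and are both
  represented by 1. Counted from multiples of \<open>n\<close>, the colors run through $1, \dots, n$ upwards after a split
  floor and downwards after a floor of half-height blocks.
\<close>

definition rank_color :: "nat \<Rightarrow> nat \<Rightarrow> nat \<Rightarrow> nat" where
  "rank_color n t \<rho> =
     (let x = Suc ((\<rho> - 1) mod n) in if split_floor n t ((\<rho> - 1) div n) then x else Suc n - x)"

lemma rank_color_base:
  assumes "1 \<le> x" "x \<le> n"
  shows "rank_color n t (n * h + x) = (if split_floor n t h then x else Suc n - x)"
proof -
  have e: "n * h + x - 1 = (x - 1) + n * h" using assms by simp
  have "x - 1 < n" using assms by simp
  then have "(x - 1 + n * h) mod n = x - 1" "(x - 1 + n * h) div n = h"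
    by (simp_all only: mod_mult_self2 mod_less div_mult_self2 div_less)
  then have "(n * h + x - 1) mod n = x - 1" "(n * h + x - 1) div n = h"
    by (simp_all only: e)
  moreover have "Suc (x - 1) = x" using assms by simp
  ultimately show ?thesis by (simp only: rank_color_def Let_def)
qed

lemma rank_color_double:
  assumes "n \<ge> 3"
  shows "h \<ge> 1 \<Longrightarrow> rank_color n t (n * h) = (if split_floor n t h then 1 else n)"
    "rank_color n t (Suc (n * h)) = (if split_floor n t h then 1 else n)"
proof -
  assume "h \<ge> 1"
  then obtain h' where h: "h = Suc h'" by (cases h) auto
  show "rank_color n t (n * h) = (if split_floor n t h then 1 else n)"
    using rank_color_base[of n n t h'] assms unfolding h by (simp add: split_floor_def add.commute)
next
  show "rank_color n t (Suc (n * h)) = (if split_floor n t h then 1 else n)"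
    using rank_color_base[of 1 n t h] assms by simp
qed

definition second_place :: "nat \<Rightarrow> nat \<Rightarrow> (nat \<Rightarrow> int) \<Rightarrow> nat \<Rightarrow> place" where
  "second_place n t g h =
     (if \<not> split_floor n t h then Upper else if first_place n t g h = PosA then PosB else PosA)"

text \<open>
  The ranks $nh$ and $nh + 1$ belong to the two places of a double floor, in the order in which they are
  filled. On a split floor this order depends on \<open>g\<close>.
\<close>

definition block_at :: "nat \<Rightarrow> nat \<Rightarrow> (nat \<Rightarrow> int) \<Rightarrow> nat \<Rightarrow> nat \<times> place" where
  "block_at n t g \<rho> =
     (let h = \<rho> div n; x = \<rho> mod n in
      if x = 0 then ((n - 1) * h, first_place n t g h)
      else if x = 1 then ((n - 1) * h, second_place n t g h)
      else ((n - 1) * h + (x - 1), Whole))"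

definition block_rank :: "nat \<Rightarrow> nat \<Rightarrow> (nat \<Rightarrow> int) \<Rightarrow> nat \<times> place \<Rightarrow> nat" where
  "block_rank n t g b = (case b of (j, q) \<Rightarrow>
     if n - 1 dvd j \<and> q = first_place n t g (j div (n - 1)) then start_rank n j else top_rank n j)"

lemma block_at_base:
  assumes "n \<ge> 3" "x < n"
  shows "block_at n t g (n * h + x) =
     (if x = 0 then ((n - 1) * h, first_place n t g h)
      else if x = 1 then ((n - 1) * h, second_place n t g h)
      else ((n - 1) * h + (x - 1), Whole))"
  using assms by (simp add: block_at_def Let_def)

lemma second_not_first: "second_place n t g h \<noteq> first_place n t g h"
  by (auto simp: second_place_def first_place_def)

lemma block_at_props:
  assumes "n \<ge> 3"
  shows "block_rank n t g (block_at n t g \<rho>) = \<rho>"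
    "snd (block_at n t g \<rho>) \<in> places (floor_at n t (fst (block_at n t g \<rho>)))"
proof -
  define h x where "h = \<rho> div n" and "x = \<rho> mod n"
  have \<rho>: "\<rho> = n * h + x" "x < n" using assms by (simp_all add: h_def x_def)
  have j: "n - 1 dvd (n - 1) * h" "(n - 1) * h div (n - 1) = h" using assms by auto
  have rk: "start_rank n ((n - 1) * h) = n * h" "top_rank n ((n - 1) * h) = Suc (n * h)"
    using rank_base[OF assms, of 0 h] assms by auto
  have pl: "places (floor_at n t ((n - 1) * h)) = (if split_floor n t h then {PosA, PosB} else {Lower, Upper})"
    using places_double_floor[OF assms j(1), of t] j by simp
  consider "x = 0" | "x = 1" | "x \<ge> 2" by linarith
  then have "block_rank n t g (block_at n t g \<rho>) = \<rho> \<and>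
    snd (block_at n t g \<rho>) \<in> places (floor_at n t (fst (block_at n t g \<rho>)))"
  proof cases
    case 1
    then have "block_at n t g \<rho> = ((n - 1) * h, first_place n t g h)"
      unfolding \<rho>(1) using block_at_base[OF assms, of x t g h] \<rho>(2) by simp
    then show ?thesis using j rk pl 1 \<rho>(1) first_place_in_places[OF assms j(1), of t g]
      by (simp add: block_rank_def)
  next
    case 2
    then have "block_at n t g \<rho> = ((n - 1) * h, second_place n t g h)"
      unfolding \<rho>(1) using block_at_base[OF assms, of x t g h] \<rho>(2) by simp
    moreover have "second_place n t g h \<in> places (floor_at n t ((n - 1) * h))"
      unfolding pl by (auto simp: second_place_def)
    ultimately show ?thesis using j rk 2 \<rho>(1) second_not_first[of n t g h] by (simp add: block_rank_def)
  next
    case 3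
    define j where "j = (n - 1) * h + (x - 1)"
    have b: "block_at n t g \<rho> = (j, Whole)"
      unfolding \<rho>(1) using block_at_base[OF assms, of x t g h] \<rho>(2) 3 by (simp add: j_def)
    have small: "x - 1 < n - 1" using 3 \<rho>(2) by linarith
    have "top_rank n j = \<rho>" using rank_base(1)[OF assms small, of h] 3 \<rho>(1) by (simp add: j_def)
    moreover have nd: "\<not> n - 1 dvd j"
    proof
      assume "n - 1 dvd j"
      then have "n - 1 dvd x - 1" unfolding j_def by (metis dvd_add_right_iff dvd_triv_left)
      then show False using small 3 by (auto dest!: dvd_imp_le)
    qed
    ultimately show ?thesis using b places_cube_floor[OF assms nd, of t] by (simp add: block_rank_def)
  qed
  then show "block_rank n t g (block_at n t g \<rho>) = \<rho>"
    "snd (block_at n t g \<rho>) \<in> places (floor_at n t (fst (block_at n t g \<rho>)))" by auto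
qed

lemma block_rank_inject:
  assumes n: "n \<ge> 3" and q: "q \<in> places (floor_at n t j)" "q' \<in> places (floor_at n t j')"
    and eq: "block_rank n t g (j, q) = block_rank n t g (j', q')"
  shows "(j, q) = (j', q')"
proof -
  define F where "F j q \<longleftrightarrow> n - 1 dvd j \<and> q = first_place n t g (j div (n - 1))" for j q
  have r: "block_rank n t g (j, q) = (if F j q then start_rank n j else top_rank n j)" for j q
    by (simp add: block_rank_def F_def)
  have d: "n dvd start_rank n j" if "F j q" for j q
    using that dvd_start_rank[OF n] by (auto simp: F_def)
  have "F j q \<longleftrightarrow> F j' q'"
    using eq d not_dvd_top_rank[OF n] unfolding r by (metis (full_types))
  then have "j = j'"
    using eq unfolding r
    by (auto split: if_splits simp: top_rank_inject[OF n] strict_mono_eq[OF strict_mono_start_rank[OF n]])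
  moreover have "q = q'"
  proof (cases "n - 1 dvd j")
    case True
    then show ?thesis
      using \<open>F j q \<longleftrightarrow> F j' q'\<close> \<open>j = j'\<close> q places_double_floor[OF n True, of t]
      by (auto simp: F_def first_place_def split: if_splits)
  next
    case False
    then show ?thesis using q \<open>j = j'\<close> places_cube_floor[OF n False, of t] by auto
  qed
  ultimately show ?thesis by simp
qed

text \<open>
  The added blocks correspond to the cells of the diagram of the conjugate partition: rank \<open>\<rho>\<close> is
  reached by the columns \<open>1, \<dots>, parts_from g \<rho>\<close>. The ground state consists of the blocks of rank 0.
\<close>

lemma added_blocks_bij:
  assumes n: "n \<ge> 3" and g: "g \<in> multiplicities n t"
  shows "bij_betw (\<lambda>(\<rho>, k). (k, block_at n t g \<rho>)) {(\<rho>, k). 1 \<le> \<rho> \<and> 1 \<le> k \<and> k \<le> parts_from g \<rho>}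
           (wall_of n t g - ground_state n t)"
proof -
  note fin = multiplicitiesD(2)[OF g]
  have wall: "(k, j, q) \<in> wall_of n t g \<longleftrightarrow> k \<ge> 1 \<and> q \<in> places (floor_at n t j) \<and> reached g k (block_rank n t g (j, q))"
    for k j q
    using reached_antimono[OF fin start_le_top] by (auto simp: wall_of_def block_rank_def)
  have zero: "block_rank n t g (j, q) = 0 \<longleftrightarrow> j = 0 \<and> q = (if t = n then Lower else PosA)" for j q
  proof -
    have "start_rank n j = 0 \<longleftrightarrow> j = 0"
      using strict_mono_eq[OF strict_mono_start_rank[OF n], of j 0] by (simp add: start_rank_0)
    then show ?thesis by (auto simp: block_rank_def top_rank_def first_place_def split_floor_def)
  qed
  have added: "(k, j, q) \<in> wall_of n t g - ground_state n t \<longleftrightarrow>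
      k \<ge> 1 \<and> q \<in> places (floor_at n t j) \<and> 1 \<le> block_rank n t g (j, q) \<and> k \<le> parts_from g (block_rank n t g (j, q))"
    for k j q
    using wall[of k j q] zero[of j q] by (auto simp: ground_state_def reached_def)
  show ?thesis
  proof (rule bij_betw_byWitness[where f' = "\<lambda>(k, b). (block_rank n t g b, k)"])
    show "\<forall>a\<in>{(\<rho>, k). 1 \<le> \<rho> \<and> 1 \<le> k \<and> k \<le> parts_from g \<rho>}.
       (case case a of (\<rho>, k) \<Rightarrow> (k, block_at n t g \<rho>) of (k, b) \<Rightarrow> (block_rank n t g b, k)) = a"
      by (auto simp: block_at_props[OF n])
    show "\<forall>a\<in>wall_of n t g - ground_state n t.
       (case case a of (k, b) \<Rightarrow> (block_rank n t g b, k) of (\<rho>, k) \<Rightarrow> (k, block_at n t g \<rho>)) = a"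
    proof
      fix a assume a: "a \<in> wall_of n t g - ground_state n t"
      obtain k j q where kjq: "a = (k, j, q)" by (cases a)
      define b where "b = block_at n t g (block_rank n t g (j, q))"
      have "(fst b, snd b) = (j, q)"
        by (rule block_rank_inject[OF n, where g = g])
           (use block_at_props[OF n, of t g "block_rank n t g (j, q)"] a kjq added in \<open>auto simp: b_def\<close>)
      then show "(case case a of (k, b) \<Rightarrow> (block_rank n t g b, k) of (\<rho>, k) \<Rightarrow> (k, block_at n t g \<rho>)) = a"
        by (simp add: kjq b_def)
    qed
    show "(\<lambda>(\<rho>, k). (k, block_at n t g \<rho>)) ` {(\<rho>, k). 1 \<le> \<rho> \<and> 1 \<le> k \<and> k \<le> parts_from g \<rho>}
       \<subseteq> wall_of n t g - ground_state n t"
    proof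
      fix a assume "a \<in> (\<lambda>(\<rho>, k). (k, block_at n t g \<rho>)) ` {(\<rho>, k). 1 \<le> \<rho> \<and> 1 \<le> k \<and> k \<le> parts_from g \<rho>}"
      then obtain \<rho> k where *: "a = (k, block_at n t g \<rho>)" "1 \<le> \<rho>" "1 \<le> k" "k \<le> parts_from g \<rho>" by auto
      obtain j q where jq: "block_at n t g \<rho> = (j, q)" by (cases "block_at n t g \<rho>")
      show "a \<in> wall_of n t g - ground_state n t"
        unfolding *(1) jq added using *(2-) block_at_props[OF n, of t g \<rho>, unfolded jq] by simp
    qed
    show "(\<lambda>(k, b). (block_rank n t g b, k)) ` (wall_of n t g - ground_state n t)
       \<subseteq> {(\<rho>, k). 1 \<le> \<rho> \<and> 1 \<le> k \<and> k \<le> parts_from g \<rho>}"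
      using added by auto
  qed
qed

lemma color_block_at:
  assumes n: "n \<ge> 3" and "\<rho> \<ge> 1"
  shows "rank_color n t \<rho> \<noteq> 1 \<Longrightarrow> color n t (k, block_at n t g \<rho>) = rank_color n t \<rho>"
    and "rank_color n t \<rho> = 1 \<Longrightarrow> color n t (k, block_at n t g \<rho>) \<in> {0, 1}"
proof -
  define h x where "h = \<rho> div n" and "x = \<rho> mod n"
  have \<rho>: "\<rho> = n * h + x" "x < n" using n by (simp_all add: h_def x_def)
  have "(rank_color n t \<rho> \<noteq> 1 \<longrightarrow> color n t (k, block_at n t g \<rho>) = rank_color n t \<rho>) \<and>
     (rank_color n t \<rho> = 1 \<longrightarrow> color n t (k, block_at n t g \<rho>) \<in> {0, 1})"
  proof (cases "x \<le> 1")
    case True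
    have fl: "fst (block_at n t g \<rho>) = (n - 1) * h + 0"
      unfolding \<rho>(1) using block_at_base[OF n \<rho>(2), of t g h] True by auto
    have "floor_at n t (fst (block_at n t g \<rho>)) = (if split_floor n t h then Split else Halves)"
      unfolding fl using floor_at_base[OF n, of 0 t h] n by simp
    moreover have "rank_color n t \<rho> = (if split_floor n t h then 1 else n)"
    proof (cases "x = 0")
      case True
      then have "h \<ge> 1" using \<rho>(1) assms(2) by (cases h) auto
      then show ?thesis using rank_color_double(1)[OF n] True \<rho>(1) by simp
    next
      case False
      then show ?thesis using rank_color_double(2)[OF n] \<open>x \<le> 1\<close> \<rho>(1) by (cases x) auto
    qed
    ultimately show ?thesis using n by (cases "block_at n t g \<rho>") (auto simp: Let_def)
  next
    case False
    have b: "block_at n t g \<rho> = ((n - 1) * h + (x - 1), Whole)"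
      unfolding \<rho>(1) using block_at_base[OF n \<rho>(2), of t g h] False by simp
    have "floor_at n t ((n - 1) * h + (x - 1)) = (if split_floor n t h then Cube x else Cube (Suc n - x))"
      using floor_at_base[OF n, of "x - 1" t h] False \<rho>(2) by auto
    moreover have "rank_color n t \<rho> = (if split_floor n t h then x else Suc n - x)"
      unfolding \<rho>(1) using False \<rho>(2) by (intro rank_color_base) auto
    ultimately show ?thesis unfolding b using False \<rho>(2) by auto
  qed
  then show "rank_color n t \<rho> \<noteq> 1 \<Longrightarrow> color n t (k, block_at n t g \<rho>) = rank_color n t \<rho>"
    and "rank_color n t \<rho> = 1 \<Longrightarrow> color n t (k, block_at n t g \<rho>) \<in> {0, 1}" by auto
qed

definition color_count :: "nat \<Rightarrow> nat \<Rightarrow> nat \<Rightarrow> nat \<Rightarrow> nat" where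
  "color_count n t i p = card {\<rho> \<in> {1..p}. rank_color n t \<rho> = i}"

lemma color_count_Suc:
  "color_count n t i (Suc p) = color_count n t i p + (if rank_color n t (Suc p) = i then 1 else 0)"
proof -
  have "{\<rho> \<in> {1..Suc p}. rank_color n t \<rho> = i} =
     (if rank_color n t (Suc p) = i then insert (Suc p) {\<rho> \<in> {1..p}. rank_color n t \<rho> = i}
      else {\<rho> \<in> {1..p}. rank_color n t \<rho> = i})"
    by (auto simp: le_Suc_eq)
  then show ?thesis by (simp add: color_count_def)
qed

text \<open>
  Each run of \<open>n\<close> consecutive ranks after a multiple of \<open>n\<close> contains every color exactly once.
\<close>

lemma color_count_base:
  assumes "1 \<le> i" "i \<le> n" "x \<le> n"
  shows "color_count n t i (n * h + x) = h + (if (if split_floor n t h then i \<le> x else Suc n - i \<le> x) then 1 else 0)"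
proof -
  have step: "color_count n t i (n * h + x) = c + (if (if split_floor n t h then i \<le> x else Suc n - i \<le> x) then 1 else 0)"
    if "x \<le> n" "color_count n t i (n * h) = c" for h c x
    using that
  proof (induction x)
    case 0
    then show ?case using assms by auto
  next
    case (Suc x)
    have "rank_color n t (Suc (n * h + x)) = (if split_floor n t h then Suc x else n - x)"
      using rank_color_base[of "Suc x" n t h] Suc.prems by simp
    then show ?case
      using Suc assms by (auto simp: color_count_Suc)
  qed
  have "color_count n t i (n * h) = h"
  proof (induction h)
    case 0
    show ?case by (simp add: color_count_def)
  next
    case (Suc h)
    have "color_count n t i (n * h + n) = Suc h"
      using step[OF order_refl Suc] assms by auto
    then show ?case by (simp add: add.commute)
  qed
  from step[OF assms(3) this] show ?thesis .
qed

lemma added_blocks_eq_card: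
  assumes n: "n \<ge> 3" and g: "g \<in> multiplicities n t"
  shows "added_blocks n t (wall_of n t g) i =
     card {(\<rho>, k). 1 \<le> \<rho> \<and> 1 \<le> k \<and> k \<le> parts_from g \<rho> \<and> color n t (k, block_at n t g \<rho>) = i}"
proof -
  let ?f = "\<lambda>(\<rho>, k). (k, block_at n t g \<rho>)"
  let ?Q = "{(\<rho>, k). 1 \<le> \<rho> \<and> 1 \<le> k \<and> k \<le> parts_from g \<rho>}"
  have "{b \<in> wall_of n t g - ground_state n t. color n t b = i} = ?f ` {x \<in> ?Q. color n t (?f x) = i}"
    unfolding bij_betw_imp_surj_on[OF added_blocks_bij[OF n g], symmetric] by blast
  moreover have "inj_on ?f {x \<in> ?Q. color n t (?f x) = i}"
    using bij_betw_imp_inj_on[OF added_blocks_bij[OF n g]] by (rule inj_on_subset) blast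
  ultimately have "added_blocks n t (wall_of n t g) i = card {x \<in> ?Q. color n t (?f x) = i}"
    unfolding added_blocks_def by (simp add: card_image)
  also have "{x \<in> ?Q. color n t (?f x) = i} =
     {(\<rho>, k). 1 \<le> \<rho> \<and> 1 \<le> k \<and> k \<le> parts_from g \<rho> \<and> color n t (k, block_at n t g \<rho>) = i}"
    by auto
  finally show ?thesis .
qed

text \<open>
  Counting the cells of one merged color by columns instead of by ranks.
\<close>

lemma card_layers:
  assumes fin: "finite {p. g p \<noteq> 0}" and M: "\<And>p. p \<ge> M \<Longrightarrow> g p = 0"
  shows "finite {(\<rho>, k). 1 \<le> \<rho> \<and> 1 \<le> k \<and> k \<le> parts_from g \<rho>}"
    "card {(\<rho>, k). 1 \<le> \<rho> \<and> 1 \<le> k \<and> k \<le> parts_from g \<rho> \<and> rank_color n t \<rho> = i}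
       = (\<Sum>p<M. nat \<bar>g p\<bar> * color_count n t i p)"
proof -
  have T: "parts_from g \<rho> = (\<Sum>p<M. if \<rho> \<le> p then nat \<bar>g p\<bar> else 0)" for \<rho>
  proof -
    have "parts_from g \<rho> = (\<Sum>p\<in>{p. p < M \<and> \<rho> \<le> p}. nat \<bar>g p\<bar>)"
      unfolding parts_from_def using M
      by (intro sum.mono_neutral_left) (auto, meson not_le)
    also have "\<dots> = (\<Sum>p\<in>{p\<in>{..<M}. \<rho> \<le> p}. nat \<bar>g p\<bar>)" by (intro sum.cong) auto
    also have "\<dots> = (\<Sum>p<M. if \<rho> \<le> p then nat \<bar>g p\<bar> else 0)" by (subst sum.inter_filter) simp_all
    finally show ?thesis .
  qed
  have big: "parts_from g \<rho> = 0" if "\<rho> \<ge> M" for \<rho>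
    unfolding T using that by (intro sum.neutral) auto
  have Sig: "{(\<rho>, k). 1 \<le> \<rho> \<and> 1 \<le> k \<and> k \<le> parts_from g \<rho> \<and> P \<rho>} =
     (SIGMA \<rho>:{\<rho>\<in>{..<M}. 1 \<le> \<rho> \<and> P \<rho>}. {1..parts_from g \<rho>})" for P
  proof (intro set_eqI iffI)
    fix x assume "x \<in> {(\<rho>, k). 1 \<le> \<rho> \<and> 1 \<le> k \<and> k \<le> parts_from g \<rho> \<and> P \<rho>}"
    then obtain \<rho> k where x: "x = (\<rho>, k)" "1 \<le> \<rho>" "1 \<le> k" "k \<le> parts_from g \<rho>" "P \<rho>" by auto
    then have "parts_from g \<rho> \<noteq> 0" by simp
    then have "\<rho> < M" using big[of \<rho>] by (cases "M \<le> \<rho>") auto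
    then show "x \<in> (SIGMA \<rho>:{\<rho>\<in>{..<M}. 1 \<le> \<rho> \<and> P \<rho>}. {1..parts_from g \<rho>})" using x by simp
  qed auto
  show "finite {(\<rho>, k). 1 \<le> \<rho> \<and> 1 \<le> k \<and> k \<le> parts_from g \<rho>}"
    using Sig[of "\<lambda>_. True"] by simp
  have "card {(\<rho>, k). 1 \<le> \<rho> \<and> 1 \<le> k \<and> k \<le> parts_from g \<rho> \<and> rank_color n t \<rho> = i}
     = (\<Sum>\<rho>\<in>{\<rho>\<in>{..<M}. 1 \<le> \<rho> \<and> rank_color n t \<rho> = i}. parts_from g \<rho>)"
    unfolding Sig by (subst card_SigmaI) simp_all
  also have "\<dots> = (\<Sum>\<rho><M. if 1 \<le> \<rho> \<and> rank_color n t \<rho> = i then parts_from g \<rho> else 0)"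
    by (subst sum.inter_filter) simp_all
  also have "\<dots> = (\<Sum>\<rho><M. \<Sum>p<M. if 1 \<le> \<rho> \<and> rank_color n t \<rho> = i \<and> \<rho> \<le> p then nat \<bar>g p\<bar> else 0)"
    unfolding T by (intro sum.cong refl) auto
  also have "\<dots> = (\<Sum>p<M. \<Sum>\<rho><M. if 1 \<le> \<rho> \<and> rank_color n t \<rho> = i \<and> \<rho> \<le> p then nat \<bar>g p\<bar> else 0)"
    by (rule sum.swap)
  also have "\<dots> = (\<Sum>p<M. nat \<bar>g p\<bar> * color_count n t i p)"
  proof (rule sum.cong[OF refl])
    fix p assume "p \<in> {..<M}"
    have "(\<Sum>\<rho><M. if 1 \<le> \<rho> \<and> rank_color n t \<rho> = i \<and> \<rho> \<le> p then nat \<bar>g p\<bar> else 0)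
       = (\<Sum>\<rho>\<in>{\<rho>\<in>{..<M}. 1 \<le> \<rho> \<and> rank_color n t \<rho> = i \<and> \<rho> \<le> p}. nat \<bar>g p\<bar>)"
      by (subst sum.inter_filter) simp_all
    also have "{\<rho>\<in>{..<M}. 1 \<le> \<rho> \<and> rank_color n t \<rho> = i \<and> \<rho> \<le> p} = {\<rho>\<in>{1..p}. rank_color n t \<rho> = i}"
      using \<open>p \<in> {..<M}\<close> by auto
    finally show "(\<Sum>\<rho><M. if 1 \<le> \<rho> \<and> rank_color n t \<rho> = i \<and> \<rho> \<le> p then nat \<bar>g p\<bar> else 0)
       = nat \<bar>g p\<bar> * color_count n t i p"
      by (simp add: color_count_def mult.commute)
  qed
  finally show "card {(\<rho>, k). 1 \<le> \<rho> \<and> 1 \<le> k \<and> k \<le> parts_from g \<rho> \<and> rank_color n t \<rho> = i}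
       = (\<Sum>p<M. nat \<bar>g p\<bar> * color_count n t i p)" .
qed

lemma added_blocks_large_color:
  assumes n: "n \<ge> 3" and g: "g \<in> multiplicities n t" and M: "\<And>p. p \<ge> M \<Longrightarrow> g p = 0" and "i \<ge> 2"
  shows "added_blocks n t (wall_of n t g) i = (\<Sum>p<M. nat \<bar>g p\<bar> * color_count n t i p)"
proof -
  have "{(\<rho>, k). 1 \<le> \<rho> \<and> 1 \<le> k \<and> k \<le> parts_from g \<rho> \<and> color n t (k, block_at n t g \<rho>) = i}
    = {(\<rho>, k). 1 \<le> \<rho> \<and> 1 \<le> k \<and> k \<le> parts_from g \<rho> \<and> rank_color n t \<rho> = i}"
  proof -
    have "color n t (k, block_at n t g \<rho>) = i \<longleftrightarrow> rank_color n t \<rho> = i" if "\<rho> \<ge> 1" for \<rho> k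
      using color_block_at[OF n that, where t = t and g = g and k = k] \<open>i \<ge> 2\<close>
      by (cases "rank_color n t \<rho> = 1") auto
    then show ?thesis by auto
  qed
  then show ?thesis
    unfolding added_blocks_eq_card[OF n g] using card_layers(2)[OF multiplicitiesD(2)[OF g] M] by simp
qed

lemma added_blocks_0_1:
  assumes n: "n \<ge> 3" and g: "g \<in> multiplicities n t" and M: "\<And>p. p \<ge> M \<Longrightarrow> g p = 0"
  shows "added_blocks n t (wall_of n t g) 0 + added_blocks n t (wall_of n t g) 1
     = (\<Sum>p<M. nat \<bar>g p\<bar> * color_count n t 1 p)"
proof -
  define Q where "Q i = {(\<rho>, k). 1 \<le> \<rho> \<and> 1 \<le> k \<and> k \<le> parts_from g \<rho> \<and> color n t (k, block_at n t g \<rho>) = i}" for i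
  have pos: "rank_color n t \<rho> \<noteq> 0" if "\<rho> \<ge> 1" for \<rho>
    using n mod_less_divisor[of n "\<rho> - 1"] by (simp add: rank_color_def Let_def)
  have "{(\<rho>, k). 1 \<le> \<rho> \<and> 1 \<le> k \<and> k \<le> parts_from g \<rho> \<and> rank_color n t \<rho> = 1} = Q 0 \<union> Q 1"
  proof -
    have "rank_color n t \<rho> = 1 \<longleftrightarrow> color n t (k, block_at n t g \<rho>) = 0 \<or> color n t (k, block_at n t g \<rho>) = 1"
      if "\<rho> \<ge> 1" for \<rho> k
      using color_block_at[OF n that, where t = t and g = g and k = k] pos[OF that]
      by (cases "rank_color n t \<rho> = 1") auto
    then show ?thesis unfolding Q_def by auto
  qed
  moreover have "finite (Q i)" for i
    by (rule finite_subset[OF _ card_layers(1)[OF multiplicitiesD(2)[OF g] M]]) (auto simp: Q_def)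
  moreover have "Q 0 \<inter> Q 1 = {}" by (auto simp: Q_def)
  ultimately have "card {(\<rho>, k). 1 \<le> \<rho> \<and> 1 \<le> k \<and> k \<le> parts_from g \<rho> \<and> rank_color n t \<rho> = 1} = card (Q 0) + card (Q 1)"
    by (simp add: card_Un_disjoint)
  then show ?thesis
    unfolding added_blocks_eq_card[OF n g] Q_def using card_layers(2)[OF multiplicitiesD(2)[OF g] M, where n = n and t = t and i = 1] by simp
qed

section \<open>The weight of a wall\<close>

lemma sum_alternating: "(\<Sum>k=1..T :: nat. if odd k then 1 else - 1 :: int) = (if odd T then 1 else 0)"
  by (induction T) auto

definition color_sign :: "nat \<Rightarrow> int" where
  "color_sign i = (if i = 1 then 1 else if i = 0 then - 1 else 0)"

text \<open>
  The color of place A is 1 in the odd columns, except for $\Lambda_1$ where it is 0.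
\<close>

definition position_sign :: "nat \<Rightarrow> int" where
  "position_sign t = (if t = 1 then - 1 else 1)"

lemma color_sign_split:
  assumes "floor_at n t j = Split"
  shows "color_sign (color n t (k, j, q)) =
     (if q = PosA then 1 else - 1) * position_sign t * (if odd k then 1 else - 1)"
  using assms by (simp add: color_sign_def position_sign_def Let_def)

text \<open>
  The blocks of the colors 0 and 1 lie on split floors. In a column that fills the floor they cancel, except that
  at the bottom the block A belongs to the ground state; so each nonempty column contributes the color of its
  B-block there, and consecutive columns cancel. A group of columns that end in single blocks of a split floor
  contributes alternating signs, that is, the parity sign of its signed multiplicity.
\<close>

lemma added_color_difference:
  assumes n: "n \<ge> 3" and g: "g \<in> multiplicities n t" and H: "H \<ge> 1" "\<And>p. p \<ge> n * H \<Longrightarrow> g p = 0"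
  shows "int (added_blocks n t (wall_of n t g) 1) - int (added_blocks n t (wall_of n t g) 0) =
    position_sign t * ((\<Sum>h<H. if split_floor n t h then parity_sign (g (n * h)) else 0)
       - (if t \<noteq> n \<and> odd (parts_from g 1) then 1 else 0))"
proof -
  note fin = multiplicitiesD(2)[OF g]
  define T where "T = parts_from g"
  define S where "S = (SIGMA \<rho>:{1..<n * H}. {1..T \<rho>})"
  define D where "D \<rho> = (\<Sum>k=1..T \<rho>. color_sign (color n t (k, block_at n t g \<rho>)))" for \<rho>
  define D' where "D' \<rho> = (if \<rho> = 0 then 0 else D \<rho>)" for \<rho>
  have big: "T \<rho> = 0" if "\<rho> \<ge> n * H" for \<rho>
  proof -
    have "{p. \<rho> \<le> p \<and> g p \<noteq> 0} = {}" using H(2) that by auto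
    then show ?thesis by (simp add: T_def parts_from_def)
  qed
  have finS: "finite S" by (simp add: S_def)
  have count: "int (added_blocks n t (wall_of n t g) i)
     = (\<Sum>(\<rho>, k)\<in>S. if color n t (k, block_at n t g \<rho>) = i then 1 else 0)" for i
  proof -
    have "{(\<rho>, k). 1 \<le> \<rho> \<and> 1 \<le> k \<and> k \<le> parts_from g \<rho> \<and> color n t (k, block_at n t g \<rho>) = i}
       = {x \<in> S. case x of (\<rho>, k) \<Rightarrow> color n t (k, block_at n t g \<rho>) = i}"
    proof (intro set_eqI iffI)
      fix x assume "x \<in> {(\<rho>, k). 1 \<le> \<rho> \<and> 1 \<le> k \<and> k \<le> parts_from g \<rho> \<and> color n t (k, block_at n t g \<rho>) = i}"
      then obtain \<rho> k where x: "x = (\<rho>, k)" "1 \<le> \<rho>" "1 \<le> k" "k \<le> T \<rho>" "color n t (k, block_at n t g \<rho>) = i"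
        by (auto simp: T_def)
      then have "T \<rho> \<noteq> 0" by simp
      then have "\<rho> < n * H" using big[of \<rho>] by (cases "n * H \<le> \<rho>") auto
      then show "x \<in> {x \<in> S. case x of (\<rho>, k) \<Rightarrow> color n t (k, block_at n t g \<rho>) = i}"
        using x by (simp add: S_def)
    qed (auto simp: S_def T_def)
    moreover have "int (card {x \<in> S. P x}) = (\<Sum>x\<in>S. if P x then 1 else 0)" for P
      using finS by (simp add: sum.If_cases Int_def)
    ultimately show ?thesis
      unfolding added_blocks_eq_card[OF n g] by (simp add: case_prod_unfold)
  qed
  have "int (added_blocks n t (wall_of n t g) 1) - int (added_blocks n t (wall_of n t g) 0)
     = (\<Sum>(\<rho>, k)\<in>S. color_sign (color n t (k, block_at n t g \<rho>)))"
    unfolding count sum_subtractf[symmetric] by (intro sum.cong refl) (auto simp: color_sign_def)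
  also have "\<dots> = (\<Sum>\<rho>\<in>{1..<n * H}. D \<rho>)"
    unfolding S_def D_def by (subst sum.Sigma) simp_all
  also have "\<dots> = (\<Sum>\<rho><n * H. D' \<rho>)"
    by (rule sum.mono_neutral_cong_left) (auto simp: D'_def)
  also have "\<dots> = (\<Sum>h<H. \<Sum>\<rho>\<in>{h * n..<h * n + n}. D' \<rho>)"
    by (subst sum.nat_group) (simp add: mult.commute)
  also have "\<dots> = (\<Sum>h<H. D' (n * h) + D' (Suc (n * h)))"
  proof (rule sum.cong[OF refl])
    fix h
    have "(\<Sum>\<rho>\<in>{h * n..<h * n + n}. D' \<rho>) = (\<Sum>\<rho>\<in>{n * h, Suc (n * h)}. D' \<rho>)"
    proof (rule sum.mono_neutral_right)
      show "\<forall>\<rho>\<in>{h * n..<h * n + n} - {n * h, Suc (n * h)}. D' \<rho> = 0"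
      proof
        fix \<rho> assume \<rho>: "\<rho> \<in> {h * n..<h * n + n} - {n * h, Suc (n * h)}"
        define x where "x = \<rho> - n * h"
        have x: "\<rho> = n * h + x" "2 \<le> x" "x < n" using \<rho> by (auto simp: x_def mult.commute)
        have "rank_color n t \<rho> = (if split_floor n t h then x else Suc n - x)"
          unfolding x(1) using x by (intro rank_color_base) auto
        then have "rank_color n t \<rho> \<ge> 2" using x by auto
        then have "color n t (k, block_at n t g \<rho>) \<ge> 2" for k
          using color_block_at(1)[OF n, of \<rho> t k g] x by simp
        then have "1 < color n t (k, block_at n t g \<rho>)" for k by (simp add: numeral_2_eq_2 Suc_le_eq)
        then have "color n t (k, block_at n t g \<rho>) \<noteq> 0 \<and> color n t (k, block_at n t g \<rho>) \<noteq> 1" for k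
          by (metis less_irrefl not_one_less_zero)
        then have "color_sign (color n t (k, block_at n t g \<rho>)) = 0" for k
          unfolding color_sign_def by simp
        then show "D' \<rho> = 0" by (simp add: D'_def D_def)
      qed
    qed (use n in \<open>auto simp: mult.commute\<close>)
    then show "(\<Sum>\<rho>\<in>{h * n..<h * n + n}. D' \<rho>) = D' (n * h) + D' (Suc (n * h))" by simp
  qed
  also have "\<dots> = (\<Sum>h<H. position_sign t * ((if split_floor n t h then parity_sign (g (n * h)) else 0)
       - (if h = 0 \<and> t \<noteq> n \<and> odd (T 1) then 1 else 0)))"
  proof (rule sum.cong[OF refl])
    fix h
    have fl: "floor_at n t ((n - 1) * h) = (if split_floor n t h then Split else Halves)"
      using floor_at_base[OF n, of 0 t h] n by simp
    have blocks: "block_at n t g (n * h) = ((n - 1) * h, first_place n t g h)"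
      "block_at n t g (Suc (n * h)) = ((n - 1) * h, second_place n t g h)"
      using block_at_base[OF n, of 0 t g h] block_at_base[OF n, of 1 t g h] n by simp_all
    show "D' (n * h) + D' (Suc (n * h)) = position_sign t * ((if split_floor n t h then parity_sign (g (n * h)) else 0)
       - (if h = 0 \<and> t \<noteq> n \<and> odd (T 1) then 1 else 0))"
    proof (cases "split_floor n t h")
      case False
      then have "D (n * h) = 0" "D (Suc (n * h)) = 0"
        unfolding D_def blocks using fl n by (simp_all add: color_sign_def)
      then show ?thesis using False by (auto simp: D'_def split_floor_def)
    next
      case True
      define \<sigma> :: int where "\<sigma> = (if first_place n t g h = PosA then 1 else - 1)"
      \<comment> \<open>The two places of a split floor have opposite colors in every column.\<close>
      have second: "(if second_place n t g h = PosA then 1 else - 1) = - \<sigma>"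
        using True by (auto simp: second_place_def \<sigma>_def)
      have D1: "D (n * h) = \<sigma> * position_sign t * (if odd (T (n * h)) then 1 else 0)"
      proof -
        have "D (n * h) = (\<Sum>k=1..T (n * h). \<sigma> * position_sign t * (if odd k then 1 else - 1))"
          unfolding D_def blocks \<sigma>_def using fl True by (intro sum.cong refl color_sign_split) simp
        then show ?thesis unfolding sum_distrib_left[symmetric] sum_alternating .
      qed
      have D2: "D (Suc (n * h)) = - \<sigma> * position_sign t * (if odd (T (Suc (n * h))) then 1 else 0)"
      proof -
        have "D (Suc (n * h)) = (\<Sum>k=1..T (Suc (n * h)). - \<sigma> * position_sign t * (if odd k then 1 else - 1))"
          unfolding D_def blocks second[symmetric] using fl True by (intro sum.cong refl color_sign_split) simp
        then show ?thesis unfolding sum_distrib_left[symmetric] sum_alternating .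
      qed
      show ?thesis
      proof (cases "h = 0")
        case True
        then have "t \<noteq> n" using \<open>split_floor n t h\<close> by (simp add: split_floor_def)
        then have "\<sigma> = 1" using True by (simp add: \<sigma>_def first_place_def split_floor_def)
        then show ?thesis using D2 True \<open>t \<noteq> n\<close> multiplicitiesD(1)[OF g]
          by (simp add: D'_def parity_sign_def split_floor_def)
      next
        case False
        have rec: "T (n * h) = nat \<bar>g (n * h)\<bar> + T (Suc (n * h))"
          unfolding T_def by (rule parts_from_rec[OF fin])
        have \<sigma>: "\<sigma> = (if 0 < g (n * h) * (-1) ^ T (Suc (n * h)) then 1 else - 1)"
          using True False by (simp add: \<sigma>_def first_place_def T_def)
        have "\<sigma> * ((if odd (T (n * h)) then 1 else 0) - (if odd (T (Suc (n * h))) then 1 else 0)) = parity_sign (g (n * h))"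
        proof (cases "even (g (n * h))")
          case True
          then have "odd (T (n * h)) \<longleftrightarrow> odd (T (Suc (n * h)))" using rec by (simp add: even_nat_iff)
          then show ?thesis using True by (simp add: parity_sign_def)
        next
          case False
          then have "odd (T (n * h)) \<longleftrightarrow> even (T (Suc (n * h)))" using rec by (simp add: even_nat_iff)
          moreover have "g (n * h) \<noteq> 0" using False by auto
          ultimately show ?thesis using False \<sigma>
            by (cases "even (T (Suc (n * h)))") (auto simp: parity_sign_def sgn_if)
        qed
        moreover have "D' (n * h) + D' (Suc (n * h)) = position_sign t *
           (\<sigma> * ((if odd (T (n * h)) then 1 else 0) - (if odd (T (Suc (n * h))) then 1 else 0)))"
          using False n D1 D2 by (simp add: D'_def algebra_simps)
        ultimately show ?thesis using True False by simp
      qed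
    qed
  qed
  also have "\<dots> = position_sign t * ((\<Sum>h<H. if split_floor n t h then parity_sign (g (n * h)) else 0)
       - (\<Sum>h<H. if h = 0 \<and> t \<noteq> n \<and> odd (T 1) then 1 else 0))"
    by (simp only: sum_distrib_left[symmetric] sum_subtractf)
  also have "(\<Sum>h<H. if h = 0 \<and> t \<noteq> n \<and> odd (T 1) then 1 else 0 :: int)
      = (if t \<noteq> n \<and> odd (parts_from g 1) then 1 else 0)"
  proof -
    have "(\<Sum>h<H. if h = 0 \<and> t \<noteq> n \<and> odd (T 1) then 1 else 0 :: int)
       = (\<Sum>h<H. if h = 0 then (if t \<noteq> n \<and> odd (T 1) then 1 else 0) else 0)"
      by (intro sum.cong) auto
    then show ?thesis using H(1) by (simp add: T_def)
  qed
  finally show ?thesis .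
qed

text \<open>
  The null space of an affine Cartan matrix is one-dimensional. Starting from $c_0 = 0$, rows 0 and 1
  give $c_2 = c_1 = 0$, and row $i \ge 2$ then gives $c_{i+1} = 0$.
\<close>

lemma cartan_kernel:
  assumes n: "n \<ge> 3" and c0: "c 0 = 0"
    and rows: "\<And>i. i \<le> n \<Longrightarrow> (\<Sum>j=0..n. c j * cartan n i j) = 0" and "i \<le> n"
  shows "c i = (0 :: int)"
proof -
  have c2: "c 2 = 0"
  proof -
    have "(\<Sum>j=0..n. c j * cartan n 0 j) = (\<Sum>j=0..n. if j = 2 then - c 2 else 0)"
      using c0 n by (intro sum.cong refl) (auto simp: cartan_def doubleton_eq_iff)
    then show ?thesis using rows[of 0] n by simp
  qed
  have c1: "c 1 = 0"
  proof -
    have "(\<Sum>j=0..n. c j * cartan n 1 j) = (\<Sum>j=0..n. if j = 1 then 2 * c 1 else 0)"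
      using c0 c2 n by (intro sum.cong refl) (auto simp: cartan_def doubleton_eq_iff numeral_2_eq_2)
    then show ?thesis using rows[of 1] n by simp
  qed
  have "\<forall>j\<le>i. c j = 0" using \<open>i \<le> n\<close>
  proof (induction i)
    case 0
    then show ?case using c0 by simp
  next
    case (Suc i)
    then have IH: "\<And>j. j \<le> i \<Longrightarrow> c j = 0" by simp
    show ?case
    proof (cases "Suc i \<le> 2")
      case True
      then have "c (Suc i) = 0" using c1 c2 by (cases "i = 0") (auto simp: numeral_2_eq_2 le_Suc_eq)
      then show ?thesis using IH by (auto simp: le_Suc_eq)
    next
      case False
      then have "2 \<le> i" by simp
    have "(\<Sum>j=0..n. c j * cartan n i j) = (\<Sum>j=0..n. if j = Suc i then - c (Suc i) else 0)"
    proof (intro sum.cong refl)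
      fix j assume "j \<in> {0..n}"
      show "c j * cartan n i j = (if j = Suc i then - c (Suc i) else 0)"
      proof (cases "j \<le> i")
        case True
        then show ?thesis using IH by simp
      next
        case False
        then show ?thesis using Suc.prems \<open>2 \<le> i\<close> \<open>j \<in> {0..n}\<close> by (auto simp: cartan_def doubleton_eq_iff)
      qed
    qed
    then have "c (Suc i) = 0" using rows[of i] Suc.prems by simp
    then show ?thesis using IH by (auto simp: le_Suc_eq)
    qed
  qed
  then show ?thesis by simp
qed

text \<open>
  The labels of $\delta$ are $1, 1, 2, \dots, 2$. The value at \<open>d\<close> fixes the coefficient of $\alpha_0$, and
  the coroots fix the others by \<open>cartan_kernel\<close>.
\<close>

lemma root_combination_eq_null_root_iff:
  assumes n: "n \<ge> 3"
  shows "(\<forall>x. (\<Sum>i=0..n. k i * simple_root n i x) = m * null_root n x) \<longleftrightarrow>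
     k 0 = m \<and> k 1 = m \<and> (\<forall>i\<in>{2..n}. k i = 2 * m)"
proof -
  define c where "c i = k i - m * (if i \<le> 1 then 1 else 2)" for i
  have set: "{0..n} = {0, 1} \<union> {2..n}" using n by auto
  have null: "null_root n x = (\<Sum>i=0..n. (if i \<le> 1 then 1 else 2) * simple_root n i x)" for x
  proof -
    have "(\<Sum>i=0..n. (if i \<le> 1 then 1 else 2) * simple_root n i x) =
       (\<Sum>i\<in>{0, 1}. (if i \<le> 1 then 1 else 2) * simple_root n i x) + (\<Sum>i=2..n. (if i \<le> 1 then 1 else 2) * simple_root n i x)"
      unfolding set by (rule sum.union_disjoint) auto
    also have "(\<Sum>i=2..n. (if i \<le> 1 then 1 else 2) * simple_root n i x) = (\<Sum>i=2..n. 2 * simple_root n i x)"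
      by (intro sum.cong) auto
    finally show ?thesis by (simp add: null_root_def sum_distrib_left)
  qed
  have diff: "(\<Sum>i=0..n. k i * simple_root n i x) - m * null_root n x = (\<Sum>i=0..n. c i * simple_root n i x)" for x
    unfolding null c_def sum_distrib_left sum_subtractf[symmetric]
    by (intro sum.cong refl) (simp add: left_diff_distrib mult.assoc)
  have "(\<forall>x. (\<Sum>i=0..n. k i * simple_root n i x) = m * null_root n x) \<longleftrightarrow> (\<forall>x. (\<Sum>i=0..n. c i * simple_root n i x) = 0)"
    using diff by (metis diff_self eq_iff_diff_eq_0)
  also have "\<dots> \<longleftrightarrow> (\<forall>i\<in>{0..n}. c i = 0)"
  proof
    assume z: "\<forall>x. (\<Sum>i=0..n. c i * simple_root n i x) = 0"
    have "(\<Sum>j=0..n. c j * simple_root n j None) = (\<Sum>j=0..n. if j = 0 then c 0 else 0)"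
      by (intro sum.cong refl) (simp add: simple_root_def)
    then have "c 0 = 0" using z by simp
    moreover have "(\<Sum>j=0..n. c j * cartan n i j) = 0" for i
      using spec[OF z, of "Some i"] by (simp add: simple_root_def)
    ultimately show "\<forall>i\<in>{0..n}. c i = 0" using cartan_kernel[OF n] by auto
  next
    assume "\<forall>i\<in>{0..n}. c i = 0"
    then show "\<forall>x. (\<Sum>i=0..n. c i * simple_root n i x) = 0" by simp
  qed
  also have "\<dots> \<longleftrightarrow> k 0 = m \<and> k 1 = m \<and> (\<forall>i\<in>{2..n}. k i = 2 * m)"
    unfolding set c_def by auto
  finally show ?thesis .
qed

lemma wt_wall_of_iff:
  assumes n: "n \<ge> 3" and g: "g \<in> multiplicities n t" and H: "H \<ge> 1" "\<And>p. p \<ge> n * H \<Longrightarrow> g p = 0"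
  shows "wt n t (wall_of n t g) = (\<lambda>x. fundamental_weight t x - int m * null_root n x) \<longleftrightarrow>
     (\<forall>i\<in>{1..n}. (\<Sum>p<n * H. nat \<bar>g p\<bar> * color_count n t i p) = 2 * m) \<and>
     (\<Sum>h<H. if split_floor n t h then parity_sign (g (n * h)) else 0) =
        (if t \<noteq> n \<and> odd (parts_from g 1) then 1 else 0)"
proof -
  define k where "k = added_blocks n t (wall_of n t g)"
  define K where "K i = (\<Sum>p<n * H. nat \<bar>g p\<bar> * color_count n t i p)" for i
  have "wt n t (wall_of n t g) = (\<lambda>x. fundamental_weight t x - int m * null_root n x) \<longleftrightarrow>
     (\<forall>x. (\<Sum>i=0..n. int (k i) * simple_root n i x) = int m * null_root n x)"
    unfolding wt_def k_def by (auto simp: fun_eq_iff)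
  also have "\<dots> \<longleftrightarrow> int (k 0) = int m \<and> int (k 1) = int m \<and> (\<forall>i\<in>{2..n}. int (k i) = 2 * int m)"
    by (rule root_combination_eq_null_root_iff[OF n])
  also have "\<dots> \<longleftrightarrow> k 0 + k 1 = 2 * m \<and> (\<forall>i\<in>{2..n}. k i = 2 * m) \<and> int (k 1) - int (k 0) = 0"
    by auto
  also have "\<dots> \<longleftrightarrow> (\<forall>i\<in>{1..n}. K i = 2 * m) \<and> int (k 1) - int (k 0) = 0"
  proof -
    have "k 0 + k 1 = K 1" unfolding k_def K_def by (rule added_blocks_0_1[OF n g H(2)])
    moreover have "k i = K i" if "i \<in> {2..n}" for i
      unfolding k_def K_def using that by (intro added_blocks_large_color[OF n g H(2)]) auto
    moreover have "{1..n} = insert 1 {2..n}" using n by auto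
    ultimately show ?thesis by auto
  qed
  also have "int (k 1) - int (k 0) = 0 \<longleftrightarrow>
     (\<Sum>h<H. if split_floor n t h then parity_sign (g (n * h)) else 0) =
        (if t \<noteq> n \<and> odd (parts_from g 1) then 1 else 0)"
  proof -
    have "position_sign t \<noteq> 0" by (simp add: position_sign_def)
    moreover have "int (k 1) - int (k 0) =
      position_sign t * ((\<Sum>h<H. if split_floor n t h then parity_sign (g (n * h)) else 0)
       - (if t \<noteq> n \<and> odd (parts_from g 1) then 1 else 0))"
      unfolding k_def by (rule added_color_difference[OF n g H])
    ultimately show ?thesis by (simp only: mult_eq_0_iff simp_thms eq_iff_diff_eq_0[symmetric])
  qed
  finally show ?thesis unfolding K_def .
qed

section \<open>Decomposition of the multiplicities into words\<close>

text \<open>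
  The parameter \<open>s\<close> of the words: 1 if the ground floor is split, 0 if it consists of half-height blocks.
\<close>

definition ground_split :: "nat \<Rightarrow> nat \<Rightarrow> nat" where
  "ground_split n t = (if t = n then 0 else 1)"

text \<open>
  Every positive size is a multiple of \<open>n\<close>, of one of two parities, or of the form $n(2a+1) \mp j$ with
  $1 \le j < n$. Sorting the multiplicities in this way gives the three kinds of words.
\<close>

definition decode :: "nat \<Rightarrow> nat \<Rightarrow> (nat \<Rightarrow> int) \<Rightarrow> wall_data" where
  "decode n s g =
     (\<lambda>a. g (n * (2 * a + 2 - s)), \<lambda>a. g (n * (2 * a + 1 + s)),
      \<lambda>j\<in>{1..<n}. \<lambda>a. (g (n * (2 * a + 1) - j), g (n * (2 * a + 1) + j)))"

definition encode :: "nat \<Rightarrow> nat \<Rightarrow> wall_data \<Rightarrow> nat \<Rightarrow> int" where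
  "encode n s d p = (case d of (f, v, P) \<Rightarrow>
     if n dvd p then
       (let b = p div n in
        if b = 0 then 0 else if even b \<longleftrightarrow> s = 1 then v ((b - 1 - s) div 2) else f ((b + s - 2) div 2))
     else
       (let a = p div (2 * n); x = p mod (2 * n) in
        if x < n then fst (P (n - x) a) else snd (P (x - n) a)))"

lemma mod_div_of_residue:
  fixes y c a :: nat
  assumes "y < c"
  shows "(y + c * a) mod c = y" "(y + c * a) div c = a"
  using assms by simp_all

lemma encode_values:
  assumes n: "n \<ge> 3" and s: "s \<le> 1"
  shows "encode n s (f, v, P) (n * (2 * a + 2 - s)) = f a"
    "encode n s (f, v, P) (n * (2 * a + 1 + s)) = v a"
    "j \<in> {1..<n} \<Longrightarrow> encode n s (f, v, P) (n * (2 * a + 1) - j) = fst (P j a)"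
    "j \<in> {1..<n} \<Longrightarrow> encode n s (f, v, P) (n * (2 * a + 1) + j) = snd (P j a)"
    "encode n s (f, v, P) 0 = 0"
proof -
  show "encode n s (f, v, P) (n * (2 * a + 2 - s)) = f a"
    using n s by (cases "s = 0") (auto simp: encode_def Let_def)
  show "encode n s (f, v, P) (n * (2 * a + 1 + s)) = v a"
    using n s by (cases "s = 0") (auto simp: encode_def Let_def)
  show "encode n s (f, v, P) 0 = 0" by (simp add: encode_def)
next
  assume j: "j \<in> {1..<n}"
  have p: "n * (2 * a + 1) - j = (n - j) + (2 * n) * a" using j by (simp add: algebra_simps)
  have "(n * (2 * a + 1) - j) mod (2 * n) = n - j" "(n * (2 * a + 1) - j) div (2 * n) = a"
    unfolding p by (rule mod_div_of_residue; use j in auto)+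
  moreover have "\<not> n dvd n * (2 * a + 1) - j"
  proof
    assume "n dvd n * (2 * a + 1) - j"
    moreover have "n dvd (2 * n) * a" by simp
    ultimately have "n dvd n - j" unfolding p by (metis dvd_add_left_iff)
    then show False using j by (auto dest!: dvd_imp_le)
  qed
  moreover have "n - j < n" "n - (n - j) = j" using j by auto
  ultimately show "encode n s (f, v, P) (n * (2 * a + 1) - j) = fst (P j a)"
    by (simp add: encode_def Let_def)
next
  assume j: "j \<in> {1..<n}"
  have p: "n * (2 * a + 1) + j = (n + j) + (2 * n) * a" by (simp add: algebra_simps)
  have "(n * (2 * a + 1) + j) mod (2 * n) = n + j" "(n * (2 * a + 1) + j) div (2 * n) = a"
    unfolding p by (rule mod_div_of_residue; use j in auto)+
  moreover have "\<not> n dvd n * (2 * a + 1) + j"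
  proof
    assume "n dvd n * (2 * a + 1) + j"
    then have "n dvd j" by (metis dvd_add_right_iff dvd_triv_left)
    then show False using j by (auto dest!: dvd_imp_le)
  qed
  ultimately show "encode n s (f, v, P) (n * (2 * a + 1) + j) = snd (P j a)"
    by (simp add: encode_def Let_def)
qed

lemma part_cases:
  fixes n s p :: nat
  assumes n: "n \<ge> 3" and s: "s \<le> 1" and p: "p \<noteq> 0"
  obtains a where "p = n * (2 * a + 2 - s)" | a where "p = n * (2 * a + 1 + s)"
  | a j where "j \<in> {1..<n}" "p = n * (2 * a + 1) - j" | a j where "j \<in> {1..<n}" "p = n * (2 * a + 1) + j"
proof (cases "n dvd p")
  case True
  then obtain b where b: "p = n * b" by blast
  then have "b \<ge> 1" using p by (cases b) auto
  define a where "a = (b - 1) div 2"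
  have "b = 2 * a + 1 \<or> b = 2 * a + 2" using \<open>b \<ge> 1\<close> unfolding a_def by presburger
  moreover have "s = 0 \<or> s = 1" using s by linarith
  ultimately show ?thesis using that(1,2)[of a] b by (elim disjE) simp_all
next
  case False
  define a x where "a = p div (2 * n)" and "x = p mod (2 * n)"
  have p: "p = 2 * n * a + x" "x < 2 * n" using n by (simp_all add: a_def x_def)
  have "\<not> n dvd x" using False unfolding p(1) by (simp add: mult.assoc dvd_add_right_iff)
  then have "x \<noteq> 0" "x \<noteq> n" by (metis dvd_0_right, metis dvd_refl)
  then consider "1 \<le> x" "x < n" | "n < x" by linarith
  then show ?thesis
  proof cases
    case 1
    then have "n - x \<in> {1..<n}" "n * (2 * a + 1) - (n - x) = p"
      using p by (auto simp: algebra_simps)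
    then show ?thesis using that(3) by metis
  next
    case 2
    then have "x - n \<in> {1..<n}" "n * (2 * a + 1) + (x - n) = p"
      using p by (auto simp: algebra_simps)
    then show ?thesis using that(4) by metis
  qed
qed

lemma inj_on_decode:
  assumes n: "n \<ge> 3" and s: "s \<le> 1"
  shows "inj_on (decode n s) (multiplicities n t)"
proof (rule inj_onI)
  fix g g' assume g: "g \<in> multiplicities n t" "g' \<in> multiplicities n t" and eq: "decode n s g = decode n s g'"
  have f: "g (n * (2 * a + 2 - s)) = g' (n * (2 * a + 2 - s))" "g (n * (2 * a + 1 + s)) = g' (n * (2 * a + 1 + s))" for a
    using eq unfolding decode_def by (auto dest: fun_cong[of _ _ a])
  have P: "g (n * (2 * a + 1) - j) = g' (n * (2 * a + 1) - j)" "g (n * (2 * a + 1) + j) = g' (n * (2 * a + 1) + j)"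
    if "j \<in> {1..<n}" for j a
  proof -
    have "snd (snd (decode n s g)) j a = snd (snd (decode n s g')) j a" using eq by simp
    then show "g (n * (2 * a + 1) - j) = g' (n * (2 * a + 1) - j)" "g (n * (2 * a + 1) + j) = g' (n * (2 * a + 1) + j)"
      using that by (simp_all add: decode_def)
  qed
  show "g = g'"
  proof
    fix p
    show "g p = g' p"
    proof (cases "p = 0")
      case True
      then show ?thesis using multiplicitiesD(1)[OF g(1)] multiplicitiesD(1)[OF g(2)] by simp
    next
      case False
      from part_cases[OF n s this] show ?thesis by cases (use f P in auto)
    qed
  qed
qed

lemma split_floor_ground_split: "split_floor n t h \<longleftrightarrow> (even h \<longleftrightarrow> ground_split n t = 1)"
  by (simp add: split_floor_def ground_split_def)

lemma encode_mem:
  assumes n: "n \<ge> 3" and d: "(f, v, P) \<in> wall_data n (ground_split n t)"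
  shows "encode n (ground_split n t) (f, v, P) \<in> multiplicities n t"
    and "decode n (ground_split n t) (encode n (ground_split n t) (f, v, P)) = (f, v, P)"
proof -
  define s where "s = ground_split n t"
  have s: "s \<le> 1" by (simp add: s_def ground_split_def)
  define g where "g = encode n s (f, v, P)"
  note val = encode_values[OF n s, where f = f and v = v and P = P, folded g_def]
  have f: "\<And>a. 0 \<le> f a" "finite {a. f a \<noteq> 0}" using d by (auto simp: wall_data_def free_words_def words_def)
  have v: "finite {a. v a \<noteq> 0}" using d by (auto simp: wall_data_def signed_words_def words_def split: if_splits)
  have P: "P \<in> extensional {1..<n}" "\<And>j a. j \<in> {1..<n} \<Longrightarrow> P j a \<in> {0, 1} \<times> {0, 1}"
    "\<And>j. j \<in> {1..<n} \<Longrightarrow> finite {a. P j a \<noteq> (0, 0)}"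
    using d by (auto simp: wall_data_def balanced_pairs_def words_def PiE_def Pi_def pair_letters_def)
  have "finite {p. g p \<noteq> 0}"
  proof (rule finite_subset)
    show "{p. g p \<noteq> 0} \<subseteq> (\<lambda>a. n * (2 * a + 2 - s)) ` {a. f a \<noteq> 0} \<union> (\<lambda>a. n * (2 * a + 1 + s)) ` {a. v a \<noteq> 0}
       \<union> (\<Union>j\<in>{1..<n}. (\<lambda>a. n * (2 * a + 1) - j) ` {a. P j a \<noteq> (0, 0)} \<union> (\<lambda>a. n * (2 * a + 1) + j) ` {a. P j a \<noteq> (0, 0)})"
      (is "_ \<subseteq> ?S")
    proof
      fix p assume "p \<in> {p. g p \<noteq> 0}"
      then have gp: "g p \<noteq> 0" by simp
      then have "p \<noteq> 0" using val(5) by metis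
      from part_cases[OF n s this] show "p \<in> ?S"
      proof cases
        case (1 a)
        then have "f a \<noteq> 0" using gp val(1) by simp
        then show ?thesis using 1 by blast
      next
        case (2 a)
        then have "v a \<noteq> 0" using gp val(2) by simp
        then show ?thesis using 2 by blast
      next
        case (3 a j)
        then have "P j a \<noteq> (0, 0)" using gp val(3) by fastforce
        then show ?thesis using 3 by blast
      next
        case (4 a j)
        then have "P j a \<noteq> (0, 0)" using gp val(4) by fastforce
        then show ?thesis using 4 by blast
      qed
    qed
    show "finite ?S" using f v P by (intro finite_UnI finite_UN_I finite_imageI) auto
  qed
  moreover have "g p \<in> {0, 1}" if "\<not> n dvd p" for p
  proof -
    have "p \<noteq> 0" using that by (metis dvd_0_right)
    from part_cases[OF n s this] show ?thesis
    proof cases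
      case (3 a j)
      then show ?thesis using val(3)[of j a] P(2)[of j a] by (cases "P j a") auto
    next
      case (4 a j)
      then show ?thesis using val(4)[of j a] P(2)[of j a] by (cases "P j a") auto
    qed (use that in auto)
  qed
  moreover have "0 \<le> g (n * h)" if "\<not> split_floor n t h" for h
  proof (cases "h = 0")
    case False
    have "g (n * h) = f ((h + s - 2) div 2)"
      using that False n by (auto simp: g_def encode_def Let_def split_floor_ground_split s_def)
    then show ?thesis using f by simp
  qed (use val(5) in simp)
  ultimately show "encode n (ground_split n t) (f, v, P) \<in> multiplicities n t"
    using val(5) unfolding s_def[symmetric] g_def[symmetric] multiplicities_def by blast
  have "(\<lambda>j\<in>{1..<n}. \<lambda>a. (g (n * (2 * a + 1) - j), g (n * (2 * a + 1) + j))) = P"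
  proof
    fix j
    show "(\<lambda>j\<in>{1..<n}. \<lambda>a. (g (n * (2 * a + 1) - j), g (n * (2 * a + 1) + j))) j = P j"
    proof (cases "j \<in> {1..<n}")
      case True
      then show ?thesis using val(3,4)[OF True] by (auto simp: fun_eq_iff)
    next
      case False
      then have "P j = undefined" using P(1) unfolding extensional_def by blast
      then show ?thesis using False by (simp only: restrict_def if_False)
    qed
  qed
  then show "decode n (ground_split n t) (encode n (ground_split n t) (f, v, P)) = (f, v, P)"
    unfolding s_def[symmetric] g_def[symmetric] decode_def val(1,2) by simp
qed

lemma sum_shift_pairs:
  fixes G :: "nat \<Rightarrow> 'b :: comm_monoid_add"
  assumes "G 0 = 0" "G (2 * N) = 0"
  shows "(\<Sum>h<2 * N. G h) = (\<Sum>a<N. G (2 * a + 1) + G (2 * a + 2))"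
proof -
  have "(\<Sum>h<2 * N. G h) + G (2 * N) = G 0 + (\<Sum>a<N. G (2 * a + 1) + G (2 * a + 2))"
    by (induction N) (simp_all add: add.assoc)
  then show ?thesis using assms by simp
qed

text \<open>
  The sizes not divisible by \<open>n\<close> are grouped symmetrically around the odd multiples of \<open>n\<close>.
\<close>

lemma sum_over_parts:
  fixes F :: "nat \<Rightarrow> 'b :: comm_monoid_add"
  assumes n: "n \<ge> 3" and s: "s \<le> 1" and F: "F 0 = 0" "F (2 * n * N) = 0"
  shows "(\<Sum>p<n * (2 * N). F p) = (\<Sum>a<N. F (n * (2 * a + 2 - s)) + F (n * (2 * a + 1 + s))
     + (\<Sum>j\<in>{1..<n}. F (n * (2 * a + 1) - j) + F (n * (2 * a + 1) + j)))"
proof -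
  define B where "B h = (\<Sum>x\<in>{1..<n}. F (n * h + x))" for h
  have "(\<Sum>p<n * (2 * N). F p) = (\<Sum>h<2 * N. \<Sum>p\<in>{h * n..<h * n + n}. F p)"
    by (subst sum.nat_group) (simp add: mult.commute)
  also have "\<dots> = (\<Sum>h<2 * N. F (n * h) + B h)"
  proof (rule sum.cong[OF refl])
    fix h
    have "(\<Sum>p\<in>{h * n..<h * n + n}. F p) = (\<Sum>x\<in>{0..<n}. F (x + h * n))"
      using sum.shift_bounds_nat_ivl[of F 0 "h * n" n] by (simp add: add.commute)
    also have "{0..<n} = insert 0 {1..<n}" using n by auto
    finally show "(\<Sum>p\<in>{h * n..<h * n + n}. F p) = F (n * h) + B h"
      by (simp add: B_def mult.commute add.commute)
  qed
  also have "\<dots> = (\<Sum>h<2 * N. F (n * h)) + (\<Sum>h<2 * N. B h)" by (rule sum.distrib)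
  also have "(\<Sum>h<2 * N. F (n * h)) = (\<Sum>a<N. F (n * (2 * a + 1)) + F (n * (2 * a + 2)))"
    using F by (intro sum_shift_pairs) (simp_all add: mult_ac)
  also have "\<dots> = (\<Sum>a<N. F (n * (2 * a + 2 - s)) + F (n * (2 * a + 1 + s)))"
  proof -
    have "s = 0 \<or> s = 1" using s by linarith
    then show ?thesis by (elim disjE) (simp_all add: add.commute)
  qed
  also have "(\<Sum>h<2 * N. B h) = (\<Sum>a<N. B (2 * a) + B (2 * a + 1))"
    by (induction N) (simp_all add: add.assoc)
  also have "\<dots> = (\<Sum>a<N. \<Sum>j\<in>{1..<n}. F (n * (2 * a + 1) - j) + F (n * (2 * a + 1) + j))"
  proof (rule sum.cong[OF refl])
    fix a
    have "B (2 * a) = (\<Sum>j\<in>{1..<n}. F (n * (2 * a + 1) - j))"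
      unfolding B_def
      by (rule sum.reindex_bij_witness[where i = "\<lambda>j. n - j" and j = "\<lambda>x. n - x"])
         (auto simp: algebra_simps)
    then show "B (2 * a) + B (2 * a + 1) = (\<Sum>j\<in>{1..<n}. F (n * (2 * a + 1) - j) + F (n * (2 * a + 1) + j))"
      by (simp add: B_def sum.distrib)
  qed
  finally show ?thesis by (simp add: sum.distrib)
qed

text \<open>
  A part $n(2a+1) \mp j$ contributes $2a+1$ blocks of each color, minus respectively plus one for the
  colors on one side of a threshold determined by \<open>j\<close>.
\<close>

lemma color_count_parts:
  assumes n: "n \<ge> 3" and i: "i \<in> {1..n}"
  shows "color_count n t i (n * b) = b"
    "j \<in> {1..<n} \<Longrightarrow> int (color_count n t i (n * (2 * a + 1) - j)) =
        int (2 * a + 1) - (if (if t = n then i \<le> j else n < i + j) then 1 else 0)"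
    "j \<in> {1..<n} \<Longrightarrow> int (color_count n t i (n * (2 * a + 1) + j)) =
        int (2 * a + 1) + (if (if t = n then i \<le> j else n < i + j) then 1 else 0)"
proof -
  show "color_count n t i (n * b) = b"
    using color_count_base[of i n 0 t b] i by auto
next
  assume j: "j \<in> {1..<n}"
  have p: "n * (2 * a + 1) - j = n * (2 * a) + (n - j)" using j by (auto simp: algebra_simps)
  show "int (color_count n t i (n * (2 * a + 1) - j)) =
        int (2 * a + 1) - (if (if t = n then i \<le> j else n < i + j) then 1 else 0)"
    unfolding p using color_count_base[of i n "n - j" t "2 * a"] i j
    by (auto simp: split_floor_def)
next
  assume j: "j \<in> {1..<n}"
  show "int (color_count n t i (n * (2 * a + 1) + j)) =
        int (2 * a + 1) + (if (if t = n then i \<le> j else n < i + j) then 1 else 0)"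
    using color_count_base[of i n j t "2 * a + 1"] i j
    by (auto simp: split_floor_def)
qed

text \<open>
  For one color no threshold is passed, which determines \<open>W\<close>; the difference of the equations for two
  neighbouring colors isolates a single \<open>d j\<close>.
\<close>

lemma threshold_system_iff:
  fixes d :: "nat \<Rightarrow> int"
  assumes n: "n \<ge> 1"
  shows "(\<forall>i\<in>{1..n}. W + (\<Sum>j\<in>{1..<n}. (if (if t = n then i \<le> j else n < i + j) then 1 else 0) * d j) = c)
     \<longleftrightarrow> W = c \<and> (\<forall>j\<in>{1..<n}. d j = 0)"
proof
  define S where "S i = (\<Sum>j\<in>{1..<n}. (if (if t = n then i \<le> j else n < i + j) then 1 else 0) * d j)" for i
  assume all: "\<forall>i\<in>{1..n}. W + S i = c"
  have delta: "(\<Sum>j\<in>{1..<n}. if j = k then d j else 0) = d k" if "k \<in> {1..<n}" for k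
    using that by simp
  show "W = c \<and> (\<forall>j\<in>{1..<n}. d j = 0)"
  proof (cases "t = n")
    case True
    have "S n = 0" unfolding S_def using True by (intro sum.neutral) auto
    then have "W = c" using all n by auto
    moreover have "d k = 0" if k: "k \<in> {1..<n}" for k
    proof -
      have "S k - S (Suc k) = (\<Sum>j\<in>{1..<n}. if j = k then d j else 0)"
        unfolding S_def sum_subtractf[symmetric] using True by (intro sum.cong refl) auto
      then have "S k - S (Suc k) = d k" using delta[OF k] by simp
      moreover have "W + S k = c" "W + S (Suc k) = c" using all k by auto
      ultimately show ?thesis by simp
    qed
    ultimately show ?thesis by blast
  next
    case False
    have "S 1 = 0" unfolding S_def using False by (intro sum.neutral) auto
    then have "W = c" using all n by auto
    moreover have "d k = 0" if k: "k \<in> {1..<n}" for k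
    proof -
      have "S (Suc (n - k)) - S (n - k) = (\<Sum>j\<in>{1..<n}. if j = k then d j else 0)"
        unfolding S_def sum_subtractf[symmetric] using False k by (intro sum.cong refl) auto
      then have "S (Suc (n - k)) - S (n - k) = d k" using delta[OF k] by simp
      moreover have "W + S (n - k) = c" "W + S (Suc (n - k)) = c" using all k by auto
      ultimately show ?thesis by simp
    qed
    ultimately show ?thesis by blast
  qed
qed simp

text \<open>
  Comparing the numbers of blocks of the merged colors shows that the weight is $\Lambda - m\delta$ only if the
  parts $n(2a+1) - j$ and $n(2a+1) + j$ are equally frequent for each \<open>j\<close> and the data have size $2m$. The colors 0
  and 1 balance if the charge of the signed word is 0, or, when the ground floor is split, equals the parity of the
  number of nonempty columns. In the latter case the charge has the same parity as the number of columns whenever the size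
  is even, so that the condition just says that the charge is 0 or 1.
\<close>

lemma wt_wall_of_iff_decode:
  assumes n: "n \<ge> 3" and g: "g \<in> multiplicities n t"
  shows "wt n t (wall_of n t g) = (\<lambda>x. fundamental_weight t x - int m * null_root n x) \<longleftrightarrow>
     decode n (ground_split n t) g \<in> wall_data n (ground_split n t) \<and>
     data_size n (ground_split n t) (decode n (ground_split n t) g) = 2 * m"
proof -
  define s where "s = ground_split n t"
  have s: "s \<le> 1" by (simp add: s_def ground_split_def)
  note fin = multiplicitiesD(2)[OF g]
  define f where "f a = g (n * (2 * a + 2 - s))" for a
  define v where "v a = g (n * (2 * a + 1 + s))" for a
  define w where "w j a = (g (n * (2 * a + 1) - j), g (n * (2 * a + 1) + j))" for j a
  have decode: "decode n s g = (f, v, restrict w {1..<n})"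
    by (simp add: decode_def f_def v_def w_def fun_eq_iff restrict_def)
  obtain M where M: "\<And>p. p \<ge> M \<Longrightarrow> g p = 0" "\<And>\<rho>. \<rho> \<ge> M \<Longrightarrow> parts_from g \<rho> = 0"
    using parts_from_bound[OF fin] by blast
  \<comment> \<open>All sizes are below $2nN$, that is, within \<open>N\<close> full periods; \<open>N\<close> has to be positive.\<close>
  define N where "N = Suc M"
  have big: "g p = 0" if "p \<ge> n * (2 * N)" for p
  proof -
    have "1 * N \<le> n * (2 * N)" using n by (intro mult_le_mono) auto
    then have "M \<le> n * (2 * N)" by (simp add: N_def)
    then show ?thesis using M(1)[of p] that by simp
  qed
  have small: "a < N" if "g p \<noteq> 0" "n * (2 * a) < p" for p a
  proof -
    have "p < n * (2 * N)" using big[of p] that(1) by (cases "n * (2 * N) \<le> p") auto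
    with that(2) have "n * (2 * a) < n * (2 * N)" by (rule less_trans)
    then show ?thesis by simp
  qed
  have supp_f: "{a. f a \<noteq> 0} \<subseteq> {..<N}"
  proof
    fix a assume "a \<in> {a. f a \<noteq> 0}"
    moreover have "n * (2 * a) < n * (2 * a + 2 - s)" using n s by simp
    ultimately show "a \<in> {..<N}" unfolding f_def using small by blast
  qed
  have supp_v: "{a. v a \<noteq> 0} \<subseteq> {..<N}"
  proof
    fix a assume "a \<in> {a. v a \<noteq> 0}"
    moreover have "n * (2 * a) < n * (2 * a + 1 + s)" using n by (intro mult_strict_left_mono) auto
    ultimately show "a \<in> {..<N}" unfolding v_def using small by blast
  qed
  have supp_w: "{a. w j a \<noteq> (0, 0)} \<subseteq> {..<N}" if j: "j \<in> {1..<n}" for j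
  proof
    fix a assume "a \<in> {a. w j a \<noteq> (0, 0)}"
    then consider "g (n * (2 * a + 1) - j) \<noteq> 0" | "g (n * (2 * a + 1) + j) \<noteq> 0" by (auto simp: w_def)
    then show "a \<in> {..<N}"
    proof cases
      case 1
      moreover have "n * (2 * a) < n * (2 * a + 1) - j" using j by (auto simp: algebra_simps)
      ultimately show ?thesis using small by blast
    next
      case 2
      moreover have "n * (2 * a) < n * (2 * a + 1) + j" using j by (auto simp: algebra_simps)
      ultimately show ?thesis using small by blast
    qed
  qed
  have fnn: "f a \<ge> 0" for a
  proof -
    have "s = 0 \<or> s = 1" using s by linarith
    then have "\<not> split_floor n t (2 * a + 2 - s)"
      unfolding split_floor_ground_split s_def[symmetric] by (elim disjE) simp_all
    then show ?thesis unfolding f_def by (rule multiplicitiesD(4)[OF g])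
  qed
  have wl: "w j a \<in> pair_letters" if j: "j \<in> {1..<n}" for j a
  proof -
    have "\<not> n dvd n * (2 * a + 1) - j"
    proof
      assume "n dvd n * (2 * a + 1) - j"
      moreover have "n * (2 * a + 1) - j = n * (2 * a) + (n - j)" using j by (auto simp: algebra_simps)
      ultimately have "n dvd n - j" by (metis dvd_add_right_iff dvd_triv_left)
      then show False using j by (auto dest!: dvd_imp_le)
    qed
    moreover have "\<not> n dvd n * (2 * a + 1) + j"
    proof
      assume "n dvd n * (2 * a + 1) + j"
      then have "n dvd j" by (metis dvd_add_right_iff dvd_triv_left)
      then show False using j by (auto dest!: dvd_imp_le)
    qed
    ultimately show ?thesis
      using multiplicitiesD(3)[OF g] unfolding w_def pair_letters_def by auto
  qed
  have sums: "free_size s f = (\<Sum>a<N. nat (f a) * (2 * a + 2 - s))"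
    "signed_size s v = (\<Sum>a<N. nat \<bar>v a\<bar> * (2 * a + 1 + s))"
    "(\<Sum>a | v a \<noteq> 0. parity_sign (v a)) = (\<Sum>a<N. parity_sign (v a))"
    unfolding free_size_def signed_size_def using supp_f supp_v
    by (intro sum.mono_neutral_left; auto simp: parity_sign_def)+
  have sums_w: "pairs_size (w j) = (\<Sum>a<N. pair_size a (w j a))"
    "(\<Sum>a | w j a \<noteq> (0, 0). balance (w j a)) = (\<Sum>a<N. balance (w j a))" if "j \<in> {1..<n}" for j
    unfolding pairs_size_def using supp_w[OF that]
    by (intro sum.mono_neutral_left; auto simp: pair_size_def balance_def)+
  define W where "W = data_size n s (decode n s g)"
  define d where "d j = (\<Sum>a<N. balance (w j a))" for j
  define c where "c = (\<Sum>a<N. parity_sign (v a))"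
  have Wsum: "int W = (\<Sum>a<N. \<bar>f a\<bar> * int (2 * a + 2 - s) + \<bar>v a\<bar> * int (2 * a + 1 + s)
       + (\<Sum>j\<in>{1..<n}. (fst (w j a) + snd (w j a)) * int (2 * a + 1)))"
  proof -
    have "int W = int (free_size s f) + int (signed_size s v) + (\<Sum>j\<in>{1..<n}. int (pairs_size (w j)))"
      unfolding W_def decode data_size_def by simp
    also have "int (free_size s f) = (\<Sum>a<N. \<bar>f a\<bar> * int (2 * a + 2 - s))"
      unfolding sums of_nat_sum of_nat_mult using fnn by (intro sum.cong refl) simp
    also have "int (signed_size s v) = (\<Sum>a<N. \<bar>v a\<bar> * int (2 * a + 1 + s))"
      unfolding sums of_nat_sum of_nat_mult by (intro sum.cong refl) simp
    also have "(\<Sum>j\<in>{1..<n}. int (pairs_size (w j)))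
       = (\<Sum>j\<in>{1..<n}. \<Sum>a<N. (fst (w j a) + snd (w j a)) * int (2 * a + 1))"
    proof (rule sum.cong[OF refl])
      fix j assume j: "j \<in> {1..<n}"
      have "int (pair_size a (w j a)) = (fst (w j a) + snd (w j a)) * int (2 * a + 1)" for a
        using wl[OF j, of a] unfolding pair_size_def pair_letters_def of_nat_mult by auto
      then show "int (pairs_size (w j)) = (\<Sum>a<N. (fst (w j a) + snd (w j a)) * int (2 * a + 1))"
        unfolding sums_w(1)[OF j] of_nat_sum by simp
    qed
    also have "\<dots> = (\<Sum>a<N. \<Sum>j\<in>{1..<n}. (fst (w j a) + snd (w j a)) * int (2 * a + 1))"
      by (rule sum.swap)
    finally show ?thesis by (simp only: sum.distrib)
  qed
  have abs_w: "\<bar>g (n * (2 * a + 1) - j)\<bar> = fst (w j a)" "\<bar>g (n * (2 * a + 1) + j)\<bar> = snd (w j a)"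
    if "j \<in> {1..<n}" for j a
    using wl[OF that, of a] by (auto simp: w_def pair_letters_def)
  have reindex: "(\<Sum>p<n * (2 * N). \<bar>g p\<bar> * F p) =
     (\<Sum>a<N. \<bar>f a\<bar> * F (n * (2 * a + 2 - s)) + \<bar>v a\<bar> * F (n * (2 * a + 1 + s))
       + (\<Sum>j\<in>{1..<n}. fst (w j a) * F (n * (2 * a + 1) - j) + snd (w j a) * F (n * (2 * a + 1) + j)))"
    for F :: "nat \<Rightarrow> int"
    using sum_over_parts[OF n s, of "\<lambda>p. \<bar>g p\<bar> * F p" N] multiplicitiesD(1)[OF g] big[of "2 * n * N"] abs_w
    unfolding f_def v_def by (simp add: mult_ac)
  have K: "int (\<Sum>p<n * (2 * N). nat \<bar>g p\<bar> * color_count n t i p) =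
      int W + (\<Sum>j\<in>{1..<n}. (if (if t = n then i \<le> j else n < i + j) then 1 else 0) * d j)"
    if i: "i \<in> {1..n}" for i
  proof -
    define \<theta> :: "nat \<Rightarrow> int" where "\<theta> j = (if (if t = n then i \<le> j else n < i + j) then 1 else 0)" for j
    have "int (\<Sum>p<n * (2 * N). nat \<bar>g p\<bar> * color_count n t i p)
        = (\<Sum>p<n * (2 * N). \<bar>g p\<bar> * int (color_count n t i p))" by simp
    also have "\<dots> = (\<Sum>a<N. \<bar>f a\<bar> * int (2 * a + 2 - s) + \<bar>v a\<bar> * int (2 * a + 1 + s)
       + (\<Sum>j\<in>{1..<n}. fst (w j a) * (int (2 * a + 1) - \<theta> j) + snd (w j a) * (int (2 * a + 1) + \<theta> j)))"
      unfolding reindex color_count_parts(1)[OF n i] \<theta>_def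
      by (intro sum.cong refl arg_cong2[where f = "(+)"]) (simp_all only: color_count_parts(2,3)[OF n i])
    also have "\<dots> = (\<Sum>a<N. (\<bar>f a\<bar> * int (2 * a + 2 - s) + \<bar>v a\<bar> * int (2 * a + 1 + s)
       + (\<Sum>j\<in>{1..<n}. (fst (w j a) + snd (w j a)) * int (2 * a + 1)))
       + (\<Sum>j\<in>{1..<n}. \<theta> j * balance (w j a)))"
    proof (rule sum.cong[OF refl])
      fix a
      have "(\<Sum>j\<in>{1..<n}. fst (w j a) * (int (2 * a + 1) - \<theta> j) + snd (w j a) * (int (2 * a + 1) + \<theta> j))
        = (\<Sum>j\<in>{1..<n}. (fst (w j a) + snd (w j a)) * int (2 * a + 1)) + (\<Sum>j\<in>{1..<n}. \<theta> j * balance (w j a))"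
        unfolding sum.distrib[symmetric] balance_def by (intro sum.cong refl) (simp add: algebra_simps)
      then show "\<bar>f a\<bar> * int (2 * a + 2 - s) + \<bar>v a\<bar> * int (2 * a + 1 + s)
         + (\<Sum>j\<in>{1..<n}. fst (w j a) * (int (2 * a + 1) - \<theta> j) + snd (w j a) * (int (2 * a + 1) + \<theta> j))
        = \<bar>f a\<bar> * int (2 * a + 2 - s) + \<bar>v a\<bar> * int (2 * a + 1 + s)
         + (\<Sum>j\<in>{1..<n}. (fst (w j a) + snd (w j a)) * int (2 * a + 1)) + (\<Sum>j\<in>{1..<n}. \<theta> j * balance (w j a))"
        by (simp only: add.assoc)
    qed
    also have "\<dots> = int W + (\<Sum>a<N. \<Sum>j\<in>{1..<n}. \<theta> j * balance (w j a))"
      unfolding Wsum by (rule sum.distrib)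
    also have "(\<Sum>a<N. \<Sum>j\<in>{1..<n}. \<theta> j * balance (w j a)) = (\<Sum>j\<in>{1..<n}. \<theta> j * d j)"
      unfolding d_def sum_distrib_left by (rule sum.swap)
    finally show ?thesis unfolding \<theta>_def .
  qed
  have charge: "(\<Sum>h<2 * N. if split_floor n t h then parity_sign (g (n * h)) else 0) = c"
  proof -
    have "(\<Sum>h<2 * N. if split_floor n t h then parity_sign (g (n * h)) else 0) =
      (\<Sum>a<N. (if split_floor n t (2 * a + 1) then parity_sign (g (n * (2 * a + 1))) else 0)
         + (if split_floor n t (2 * a + 2) then parity_sign (g (n * (2 * a + 2))) else 0))"
      using multiplicitiesD(1)[OF g] big[of "n * (2 * N)"]
      by (intro sum_shift_pairs) (simp_all add: parity_sign_def)
    also have "\<dots> = c"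
    proof -
      have "s = 0 \<or> s = 1" using s by linarith
      then show ?thesis
        unfolding c_def v_def split_floor_ground_split s_def[symmetric]
        by (intro sum.cong refl) (elim disjE; simp)
    qed
    finally show ?thesis .
  qed
  have T1: "int (parts_from g 1) = (\<Sum>a<N. \<bar>f a\<bar> + \<bar>v a\<bar> + (\<Sum>j\<in>{1..<n}. fst (w j a) + snd (w j a)))"
  proof -
    have "parts_from g 1 = (\<Sum>p<n * (2 * N). nat \<bar>g p\<bar>)"
      unfolding parts_from_def
    proof (rule sum.mono_neutral_left)
      show "{p. 1 \<le> p \<and> g p \<noteq> 0} \<subseteq> {..<n * (2 * N)}"
      proof
        fix p assume "p \<in> {p. 1 \<le> p \<and> g p \<noteq> 0}"
        then show "p \<in> {..<n * (2 * N)}" using big[of p] by (cases "n * (2 * N) \<le> p") auto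
      qed
      show "\<forall>i\<in>{..<n * (2 * N)} - {p. 1 \<le> p \<and> g p \<noteq> 0}. nat \<bar>g i\<bar> = 0"
        using multiplicitiesD(1)[OF g] by (auto simp: Suc_le_eq intro: gr0I)
    qed simp
    then have "int (parts_from g 1) = (\<Sum>p<n * (2 * N). \<bar>g p\<bar> * 1)" by simp
    also note reindex
    finally show ?thesis by simp
  qed
  \<comment> \<open>The number of nonempty columns has the parity of the charge: every term of their difference plus \<open>W\<close> is even,
      because the weights of the free words and of the pairs are odd and
      those of the signed words are even.\<close>
  have parity: "even (int (parts_from g 1) - c)" if "s = 1" "even W"
  proof -
    have "int (parts_from g 1) - c + int W = (\<Sum>a<N. \<bar>f a\<bar> * (2 * int a + 2)
        + (\<bar>v a\<bar> - parity_sign (v a) + \<bar>v a\<bar> * (2 * int a + 2))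
        + (\<Sum>j\<in>{1..<n}. (fst (w j a) + snd (w j a)) * (2 * int a + 2)))"
      unfolding T1 c_def Wsum sum_subtractf[symmetric] sum.distrib[symmetric]
    proof (rule sum.cong[OF refl])
      fix a
      have "(\<Sum>j\<in>{1..<n}. fst (w j a) + snd (w j a)) + (\<Sum>j\<in>{1..<n}. (fst (w j a) + snd (w j a)) * int (2 * a + 1))
         = (\<Sum>j\<in>{1..<n}. (fst (w j a) + snd (w j a)) * (2 * int a + 2))"
        unfolding sum.distrib[symmetric] by (intro sum.cong refl) (simp add: algebra_simps)
      then show "\<bar>f a\<bar> + \<bar>v a\<bar> + (\<Sum>j\<in>{1..<n}. fst (w j a) + snd (w j a)) - parity_sign (v a)
         + (\<bar>f a\<bar> * int (2 * a + 2 - s) + \<bar>v a\<bar> * int (2 * a + 1 + s)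
         + (\<Sum>j\<in>{1..<n}. (fst (w j a) + snd (w j a)) * int (2 * a + 1)))
        = \<bar>f a\<bar> * (2 * int a + 2) + (\<bar>v a\<bar> - parity_sign (v a) + \<bar>v a\<bar> * (2 * int a + 2))
        + (\<Sum>j\<in>{1..<n}. (fst (w j a) + snd (w j a)) * (2 * int a + 2))"
        using that(1) by (simp add: algebra_simps)
    qed
    moreover have "even \<dots>"
      by (intro dvd_sum dvd_add) (auto simp: parity_sign_def sgn_if)
    ultimately have "even (int (parts_from g 1) - c + int W)" by simp
    then show ?thesis using that(2) by simp
  qed
  have "wt n t (wall_of n t g) = (\<lambda>x. fundamental_weight t x - int m * null_root n x) \<longleftrightarrow>
     (\<forall>i\<in>{1..n}. (\<Sum>p<n * (2 * N). nat \<bar>g p\<bar> * color_count n t i p) = 2 * m) \<and>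
     c = (if t \<noteq> n \<and> odd (parts_from g 1) then 1 else 0)"
    using wt_wall_of_iff[OF n g, of "2 * N" m] big unfolding charge by (simp add: N_def)
  also have "(\<forall>i\<in>{1..n}. (\<Sum>p<n * (2 * N). nat \<bar>g p\<bar> * color_count n t i p) = 2 * m) \<longleftrightarrow>
     (\<forall>i\<in>{1..n}. int W + (\<Sum>j\<in>{1..<n}. (if (if t = n then i \<le> j else n < i + j) then 1 else 0) * d j) = int (2 * m))"
  proof (rule ball_cong[OF refl])
    fix i assume i: "i \<in> {1..n}"
    show "(\<Sum>p<n * (2 * N). nat \<bar>g p\<bar> * color_count n t i p) = 2 * m \<longleftrightarrow>
      int W + (\<Sum>j\<in>{1..<n}. (if (if t = n then i \<le> j else n < i + j) then 1 else 0) * d j) = int (2 * m)"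
      unfolding K[OF i, symmetric] of_nat_eq_iff ..
  qed
  also have "\<dots> \<longleftrightarrow> int W = int (2 * m) \<and> (\<forall>j\<in>{1..<n}. d j = 0)"
    using n by (intro threshold_system_iff) simp
  also have "((int W = int (2 * m) \<and> (\<forall>j\<in>{1..<n}. d j = 0)) \<and> c = (if t \<noteq> n \<and> odd (parts_from g 1) then 1 else 0))
     \<longleftrightarrow> W = 2 * m \<and> (\<forall>j\<in>{1..<n}. d j = 0) \<and> (if s = 0 then c = 0 else c = 0 \<or> c = 1)"
  proof (cases "s = 0")
    case True
    then have "t = n" by (simp add: s_def ground_split_def split: if_splits)
    then show ?thesis using True by auto
  next
    case False
    then have "s = 1" "t \<noteq> n" using s by (auto simp: s_def ground_split_def split: if_splits)
    have "c = (if odd (parts_from g 1) then 1 else 0) \<longleftrightarrow> c = 0 \<or> c = 1" if "W = 2 * m"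
      using parity[OF \<open>s = 1\<close>] that by auto
    then show ?thesis using \<open>s = 1\<close> \<open>t \<noteq> n\<close> by auto
  qed
  also have "\<dots> \<longleftrightarrow> decode n s g \<in> wall_data n s \<and> W = 2 * m"
  proof -
    have "finite {a. f a \<noteq> 0}" "finite {a. v a \<noteq> 0}" using supp_f supp_v finite_subset by blast+
    moreover have "finite {a. w j a \<noteq> (0, 0)}" if "j \<in> {1..<n}" for j
      using supp_w[OF that] finite_subset by blast
    ultimately have "f \<in> free_words" "v \<in> signed_words k \<longleftrightarrow> c = k"
      "j \<in> {1..<n} \<Longrightarrow> w j \<in> balanced_pairs \<longleftrightarrow> d j = 0" for k j
      using fnn wl sums(3) sums_w(2)
      by (simp_all add: free_words_def signed_words_def balanced_pairs_def words_def c_def d_def)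
    moreover from this have "restrict w {1..<n} \<in> PiE {1..<n} (\<lambda>_. balanced_pairs) \<longleftrightarrow> (\<forall>j\<in>{1..<n}. d j = 0)"
      by (auto simp: PiE_def Pi_def)
    ultimately show ?thesis unfolding decode wall_data_def by auto
  qed
  finally show ?thesis unfolding W_def s_def .
qed

text \<open>
  The size of the data is measured in powers of $y = q^{1/2}$. Data of odd size do not correspond to
  walls of weight $\Lambda - m\delta$, which is why only the even part of the generating function enters.
\<close>

lemma string_function_nth:
  assumes n: "n \<ge> 3"
  shows "fps_nth (string_function n t (fundamental_weight t)) m =
     fps_nth (gf (wall_data n (ground_split n t)) (data_size n (ground_split n t))) (2 * m)"
proof -
  define \<mu> where "\<mu> = (\<lambda>x. fundamental_weight t x - int m * null_root n x)"
  define s where "s = ground_split n t"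
  define A where "A = {g \<in> multiplicities n t. wt n t (wall_of n t g) = \<mu>}"
  have "proper_young_walls_of_weight n t \<mu> = wall_of n t ` A"
    unfolding proper_young_walls_of_weight_def A_def bij_betw_imp_surj_on[OF bij_betw_wall_of[OF n], symmetric]
    by blast
  moreover have "inj_on (wall_of n t) A"
    using inj_on_wall_of[OF n] by (rule inj_on_subset) (auto simp: A_def)
  ultimately have "card (proper_young_walls_of_weight n t \<mu>) = card A" by (simp add: card_image)
  moreover have "decode n s ` A = {d \<in> wall_data n s. data_size n s d = 2 * m}"
  proof (intro antisym subsetI)
    fix d assume "d \<in> decode n s ` A"
    then show "d \<in> {d \<in> wall_data n s. data_size n s d = 2 * m}"
      using wt_wall_of_iff_decode[OF n, of _ t m] by (auto simp: A_def \<mu>_def s_def)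
  next
    fix d assume d: "d \<in> {d \<in> wall_data n s. data_size n s d = 2 * m}"
    obtain f v P where fvP: "d = (f, v, P)" by (cases d)
    define g where "g = encode n s (f, v, P)"
    have g: "g \<in> multiplicities n t" "decode n s g = d"
      using encode_mem[OF n, of f v P t] d fvP by (auto simp: g_def s_def)
    then have "g \<in> A"
      using wt_wall_of_iff_decode[OF n g(1), of m] d by (simp add: A_def \<mu>_def s_def)
    then show "d \<in> decode n s ` A" using g(2) by blast
  qed
  moreover have "inj_on (decode n s) A"
    using inj_on_decode[OF n, of s t] by (rule inj_on_subset) (auto simp: A_def s_def ground_split_def)
  ultimately have "card (proper_young_walls_of_weight n t \<mu>) = card {d \<in> wall_data n s. data_size n s d = 2 * m}"
    by (metis card_image)
  then show ?thesis by (simp add: string_function_def gf_def \<mu>_def s_def)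
qed

theorem corollary6p12:
  fixes n :: nat
  assumes "n \<ge> 3"
  shows
    "(\<forall>t \<in> {0, 1}.
        fps_compose (string_function n t (fundamental_weight t)) (fps_X ^ 2) =
          fps_const (1 / 2) *
            (1 / (euler_prod fps_X * euler_prod (fps_X ^ 2) ^ (n - 1) * euler_prod (fps_X ^ 4))
             + euler_prod fps_X / euler_prod (fps_X ^ 2) ^ (n + 2))) \<and>
     string_function n n (fundamental_weight n) =
       euler_prod (fps_X ^ 2) / euler_prod fps_X ^ (n + 2)"
proof (intro conjI ballI)
  fix t :: nat
  assume "t \<in> {0, 1}"
  then have "ground_split n t = 1" using assms by (auto simp: ground_split_def)
  then show "fps_compose (string_function n t (fundamental_weight t)) (fps_X ^ 2) =
          fps_const (1 / 2) *
            (1 / (euler_prod fps_X * euler_prod (fps_X ^ 2) ^ (n - 1) * euler_prod (fps_X ^ 4))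
             + euler_prod fps_X / euler_prod (fps_X ^ 2) ^ (n + 2))"
    using string_function_nth[OF assms, of t] by (intro vector_gf_even_part[OF assms]) simp
next
  show "string_function n n (fundamental_weight n) = euler_prod (fps_X ^ 2) / euler_prod fps_X ^ (n + 2)"
    using string_function_nth[OF assms, of n] by (intro spin_gf_even_part[OF assms]) (simp add: ground_split_def)
qed

end
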